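(* Let $a(t)$ be a real analytic quasi-periodic function on $D_\rho$ (for some $\rho>0$) with frequencies $\omega=(\omega_1,\dots,\omega_r)$ and with average $\bar a>0$. Suppose that $\omega$ satisfies the Diophantine condition $$\big|\langle k,\omega\rangle\big|\ge\frac{\alpha}{|k|^\tau}\qquad\text{for all }k\in\mathbb{Z}^r\setminus\{0\},$$ where $\alpha>0$ is a small constant and $\tau>r-1$. Consider the Hamiltonian system, equivalent to Hill's equation $\ddot x+\varepsilon a(t)x=0$ with $y=\dot x$, $$\dot z=(A+\varepsilon Q(t))z,\qquad z=\begin{pmatrix}x\\ y\end{pmatrix},\quad A=\begin{pmatrix}0&1\\ 0&0\end{pmatrix},\quad Q(t)=\begin{pmatrix}0&0\\ -a(t)&0\end{pmatrix}. \tag{$*$}$$ Then for all sufficiently small $\varepsilon_0>0$ there is a non-empty Cantor subset $E_{\varepsilon_0}\subset(0,\varepsilon_0)$ with positive Lebesgue measure such that for every $\varepsilon\in E_{\varepsilon_0}$ the Hamiltonian system $( * )$ is reducible. Moreover, the relative measure of $E_{\varepsilon_0}$ in $(0,\varepsilon_0)$ is close to $1$ when $\varepsilon_0$ is small, i.e. $\operatorname{meas}(E_{\varepsilon_0})/\varepsilon_0\to1$ as $\varepsilon_0\to0$.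
   Context: For $\rho>0$, $D_\rho=\{\theta\in\mathbb{C}^r:|\mathrm{Im}\,\theta_j|\le\rho,\ j=1,\dots,r\}$. A function $f(t)$ is quasi-periodic with basic frequencies $\omega=(\omega_1,\dots,\omega_r)$ if $f(t)=F(\omega_1t,\dots,\omega_rt)$ where $F(\theta_1,\dots,\theta_r)$ is $2\pi$-periodic in each argument; it is analytic quasi-periodic on $D_\rho$ if moreover $F$ is analytic on $D_\rho$. A matrix is (analytic) quasi-periodic if all its entries are. The average of $a$ is $\bar a=\lim_{T\to\infty}\frac1{2T}\int_{-T}^Ta(t)\,dt$. For $k\in\mathbb{Z}^r$, $|k|=|k_1|+\dots+|k_r|$ and $\langle k,\omega\rangle=\sum_jk_j\omega_j$. Let $J=\begin{pmatrix}0&1\\ -1&0\end{pmatrix}$. A $2\times2$ matrix $M$ is Hamiltonian if $M=JM_J$ with $M_J$ symmetric, and a transformation $z=\psi(t)w$ is symplectic if $\psi(t)^TJ\psi(t)=J$ for all $t$. The Hamiltonian system $( * )$ is called reducible if there is an analytic quasi-periodic symplectic transformation $z=\psi(t)w$, where $\psi(t)$ has the same frequencies $\omega$ as $Q(t)$, which changes it into a Hamiltonian system $\dot w=Bw$ with $B$ a constant matrix. *)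

theory Defs
  imports "HOL-Analysis.Analysis"
begin

definition strip :: "real \<Rightarrow> (complex ^ 'n) set" where
  "strip \<rho> = {\<theta>. \<forall>j. \<bar>Im (\<theta> $ j)\<bar> \<le> \<rho>}"

text \<open>Analyticity in several complex variables: complex-linear Frechet
  differentiability on an open neighbourhood, in analogy with \<^const>\<open>analytic_on\<close>.\<close>

definition analytic_nvar_on :: "(complex ^ 'n \<Rightarrow> complex) \<Rightarrow> (complex ^ 'n) set \<Rightarrow> bool" where
  "analytic_nvar_on F S \<longleftrightarrow>
     (\<exists>U. open U \<and> S \<subseteq> U \<and>
       (\<forall>\<theta>\<in>U. \<exists>c :: complex ^ 'n.
          (F has_derivative (\<lambda>h. \<Sum>j\<in>UNIV. c $ j * h $ j)) (at \<theta>)))"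

definition analytic_quasi_periodic :: "real ^ 'n \<Rightarrow> real \<Rightarrow> (real \<Rightarrow> real) \<Rightarrow> bool" where
  "analytic_quasi_periodic \<omega> \<rho> f \<longleftrightarrow>
     (\<exists>F :: complex ^ 'n \<Rightarrow> complex.
        analytic_nvar_on F (strip \<rho>) \<and>
        (\<forall>\<theta>\<in>strip \<rho>. \<forall>j. F (\<theta> + axis j (2 * complex_of_real pi)) = F \<theta>) \<and>
        (\<forall>t. complex_of_real (f t) = F (\<chi> j. complex_of_real (\<omega> $ j * t))))"

definition has_average :: "(real \<Rightarrow> real) \<Rightarrow> real \<Rightarrow> bool" where
  "has_average a m \<longleftrightarrow> ((\<lambda>T. 1 / (2 * T) * integral {-T..T} a) \<longlongrightarrow> m) at_top"

definition freq_norm :: "int ^ 'n \<Rightarrow> int" where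
  "freq_norm k = (\<Sum>j\<in>UNIV. \<bar>k $ j\<bar>)"

definition diophantine :: "real ^ 'n \<Rightarrow> real \<Rightarrow> real \<Rightarrow> bool" where
  "diophantine \<omega> \<alpha> \<tau> \<longleftrightarrow>
     (\<forall>k :: int ^ 'n. k \<noteq> 0 \<longrightarrow>
        \<bar>\<Sum>j\<in>UNIV. real_of_int (k $ j) * \<omega> $ j\<bar> \<ge> \<alpha> / real_of_int (freq_norm k) powr \<tau>)"

definition J :: "real ^ 2 ^ 2" where
  "J = vector [vector [0, 1], vector [-1, 0]]"

definition hamiltonian_matrix :: "real ^ 2 ^ 2 \<Rightarrow> bool" where
  "hamiltonian_matrix M \<longleftrightarrow> (\<exists>S. transpose S = S \<and> M = J ** S)"

definition symplectic_transformation :: "(real \<Rightarrow> real ^ 2 ^ 2) \<Rightarrow> bool" where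
  "symplectic_transformation \<psi> \<longleftrightarrow> (\<forall>t. transpose (\<psi> t) ** J ** \<psi> t = J)"

definition linear_solution :: "(real \<Rightarrow> real ^ 2 ^ 2) \<Rightarrow> (real \<Rightarrow> real ^ 2) \<Rightarrow> bool" where
  "linear_solution M z \<longleftrightarrow> (\<forall>t. (z has_vector_derivative M t *v z t) (at t))"

text \<open>The last conjunct says that the change of variables \<open>z = \<psi>(t) w\<close> transforms
  \<open>z' = M(t) z\<close> into \<open>w' = B w\<close>.  The transformation is real and has
  exactly the frequencies \<open>\<omega>\<close>; its strip of analyticity is not prescribed.\<close>

definition reducible :: "real ^ 'n \<Rightarrow> (real \<Rightarrow> real ^ 2 ^ 2) \<Rightarrow> bool" where
  "reducible \<omega> M \<longleftrightarrow>
     (\<exists>\<psi> B. \<exists>\<rho>>0.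
        (\<forall>i j. analytic_quasi_periodic \<omega> \<rho> (\<lambda>t. \<psi> t $ i $ j)) \<and>
        symplectic_transformation \<psi> \<and>
        hamiltonian_matrix B \<and>
        (\<forall>w. linear_solution M (\<lambda>t. \<psi> t *v w t) \<longleftrightarrow> linear_solution (\<lambda>t. B) w))"

definition hill_A :: "real ^ 2 ^ 2" where
  "hill_A = vector [vector [0, 1], vector [0, 0]]"

definition hill_Q :: "(real \<Rightarrow> real) \<Rightarrow> real \<Rightarrow> real ^ 2 ^ 2" where
  "hill_Q a t = vector [vector [0, 0], vector [- a t, 0]]"

text \<open>Non-empty, compact, perfect and totally disconnected.\<close>

definition cantor_set :: "real set \<Rightarrow> bool" where
  "cantor_set S \<longleftrightarrow>
     S \<noteq> {} \<and> compact S \<and> (\<forall>x\<in>S. x islimpt S) \<and>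
     (\<forall>x\<in>S. connected_component_set S x = {x})"

end

theory Submission
  imports Defs "HOL-Complex_Analysis.Cauchy_Integral_Formula"
begin

text \<open>If \<open>m\<close> is a quasi-periodic solution of the Riccati equation \<open>m' + m\<^sup>2 + \<epsilon> a = 0\<close>
  with positive imaginary part, then \<open>x = exp (\<integral> m)\<close> is a complex Floquet solution of Hill's
  equation and the system is reducible.  Newton's method for the Riccati equation is a scalar KAM
  scheme: given an approximate solution \<open>m = \<mu> + \<partial>M\<close> (\<open>\<mu>\<close> constant) with error \<open>e\<close>, the linearised equation
  \<open>d' + 2 m d = - e\<close> becomes the constant coefficient equation \<open>c' + 2 \<mu> c = - e exp (2 M)\<close> for
  \<open>c = d exp (2 M)\<close>, and \<open>m + d\<close> has error exactly \<open>d\<^sup>2\<close>.  The small divisors are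
  \<open>\<langle>k, \<omega>\<rangle> + 2 Im \<mu>\<close>.  The parameter is scaled as \<open>\<epsilon> = \<delta>\<^sup>2 x\<close> with \<open>x \<in> {1..2}\<close>.  All estimates include
  Lipschitz bounds in \<open>x\<close>, so that \<open>Im \<mu>\<close> grows at rate at least \<open>\<delta> \<kappa> / 8\<close>, where
  \<open>\<kappa>\<^sup>2\<close> is the average of \<open>a\<close>; hence each resonance excludes only a short interval of
  parameters.  Since \<open>Im \<mu> = O(\<delta>)\<close>, the Diophantine condition on \<open>\<omega>\<close> permits resonances only for large \<open>k\<close>,
  and the excluded measure is \<open>O(\<delta>\<^sup>2)\<close>.\<close>

text \<open>The unperturbed matrix is nilpotent, so at \<open>\<epsilon> = 0\<close> there is no
  frequency to start from: the Floquet frequency is created by the average of \<open>a\<close> and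
  has order \<open>\<delta>\<close>. Hence the divisor at \<open>k = 0\<close> is itself of order
  \<open>\<delta>\<close>, one Newton step costs a factor \<open>1 / \<delta>\<close>, and the
  iteration contracts only when the error is small compared with \<open>\<delta>\<^sup>2\<close>.
  The constant guess \<open>\<i> * \<delta> * \<kappa> * sqrt x\<close> leaves an error of exactly
  that order; adding a primitive of the oscillating part of the potential brings it down to
  \<open>\<delta> ^ 3\<close>. The Lipschitz estimates lose no second factor
  \<open>1 / \<delta>\<close>, because the frequency also varies with \<open>x\<close> at rate
  \<open>\<delta>\<close>. They are difference quotients on whatever parameters survive, and each
  resonant set is enclosed in a ball because any two of its points are close. The Cantor structure
  comes afterwards from regularity of Lebesgue measure: inside the surviving parameters one takes a
  compact set avoiding a small neighbourhood of the rationals and keeps its points of locally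
  positive measure.\<close>

section \<open>Fourier series on a strip\<close>

lemma summable_on_exp_int:
  fixes a :: real
  assumes "a > 0"
  shows "(\<lambda>m::int. exp (- a * \<bar>real_of_int m\<bar>)) summable_on UNIV"
proof -
  have geo: "summable (\<lambda>n::nat. exp (- a * real n))"
  proof -
    have "(\<lambda>n::nat. exp (- a * real n)) = (\<lambda>n. exp (- a) ^ n)"
      by (simp add: exp_of_nat_mult [symmetric] mult.commute)
    then show ?thesis using assms by (simp add: summable_geometric)
  qed
  have nat: "(\<lambda>n::nat. exp (- a * real n)) summable_on UNIV"
    using geo by (intro summable_nonneg_imp_summable_on) auto
  have A: "(\<lambda>m::int. exp (- a * \<bar>real_of_int m\<bar>)) summable_on range int"
    by (subst summable_on_reindex) (use nat in \<open>auto simp: o_def\<close>)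
  have B: "(\<lambda>m::int. exp (- a * \<bar>real_of_int m\<bar>)) summable_on range (\<lambda>n. - int n)"
    by (subst summable_on_reindex) (use nat in \<open>auto simp: o_def inj_on_def\<close>)
  have "(\<lambda>m::int. exp (- a * \<bar>real_of_int m\<bar>)) summable_on (range int \<union> range (\<lambda>n. - int n))"
    using A B by (rule summable_on_union)
  moreover have "range int \<union> range (\<lambda>n. - int n) = UNIV"
  proof -
    have "m \<in> range int \<union> range (\<lambda>n. - int n)" for m
      by (cases m rule: int_cases2) auto
    then show ?thesis by blast
  qed
  ultimately show ?thesis by simp
qed

definition line_strip :: "real \<Rightarrow> complex set" where
  "line_strip \<rho> = {z. \<bar>Im z\<bar> < \<rho>}"

lemma open_line_strip: "open (line_strip \<rho>)"
  unfolding line_strip_def by (intro open_Collect_less continuous_intros)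

lemma convex_line_strip: "convex (line_strip \<rho>)"
proof -
  have "line_strip \<rho> = {z. Im z < \<rho>} \<inter> {z. Im z > - \<rho>}"
    by (auto simp: line_strip_def)
  then show ?thesis
    by (simp add: convex_Int convex_halfspace_Im_lt convex_halfspace_Im_gt)
qed

text \<open>Stated as a contour integral over the segment from 0 to 2 pi so that Cauchy's theorem
  can move the segment off the real axis.\<close>

definition fourier_coeff :: "int \<Rightarrow> (complex \<Rightarrow> complex) \<Rightarrow> complex" where
  "fourier_coeff m h =
     contour_integral (linepath 0 (2 * complex_of_real pi)) (\<lambda>s. h s * exp (- \<i> * of_int m * s)) / (2 * pi)"

lemma exp_int_2pi: "exp (\<i> * of_int m * (2 * of_real pi)) = 1"
proof -
  have "exp (\<i> * of_int m * (2 * of_real pi)) = exp ((2 * of_int m * pi) * \<i>)"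
    by (simp add: mult_ac)
  also have "\<dots> = 1" by (rule exp_integer_2pi) auto
  finally show ?thesis .
qed

lemma exp_int_2pi': "exp (- \<i> * of_int m * (2 * of_real pi)) = 1"
  using exp_int_2pi [of "- m"] by simp

text \<open>The vertical sides of the rectangle cancel by periodicity.\<close>

lemma fourier_coeff_shift:
  fixes h :: "complex \<Rightarrow> complex" and \<sigma> \<rho> :: real
  assumes h: "h holomorphic_on line_strip \<rho>"
    and per: "\<And>z::complex. z \<in> line_strip \<rho> \<Longrightarrow> h (z + 2 * pi) = h z"
    and \<sigma>: "\<bar>\<sigma>\<bar> < \<rho>"
  shows "fourier_coeff m h =
     contour_integral (linepath (\<i> * \<sigma>) (2 * pi + \<i> * \<sigma>)) (\<lambda>s. h s * exp (- \<i> * of_int m * s)) / (2 * pi)"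
proof -
  define F where "F = (\<lambda>s. h s * exp (- \<i> * of_int m * s))"
  define a b c d where "a = (0::complex)" and "b = 2 * complex_of_real pi"
    and "c = 2 * pi + \<i> * \<sigma>" and "d = \<i> * \<sigma>"
  have F: "F holomorphic_on line_strip \<rho>"
    unfolding F_def by (intro holomorphic_intros h)
  have mem: "a \<in> line_strip \<rho>" "b \<in> line_strip \<rho>" "c \<in> line_strip \<rho>" "d \<in> line_strip \<rho>"
    using \<sigma> by (auto simp: line_strip_def a_def b_def c_def d_def)
  have seg: "closed_segment x y \<subseteq> line_strip \<rho>" if "x \<in> line_strip \<rho>" "y \<in> line_strip \<rho>" for x y
    using that convex_line_strip by (rule closed_segment_subset)
  have ci: "F contour_integrable_on linepath x y" if "x \<in> line_strip \<rho>" "y \<in> line_strip \<rho>" for x y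
    using F seg [OF that] by (intro contour_integrable_continuous_linepath)
      (meson holomorphic_on_imp_continuous_on continuous_on_subset)
  let ?g = "linepath a b +++ linepath b c +++ linepath c d +++ linepath d a"
  have "(F has_contour_integral 0) ?g"
    using seg mem
    by (intro Cauchy_theorem_convex_simple [OF F convex_line_strip]) (auto simp: path_image_join)
  then have "contour_integral ?g F = 0"
    by (rule contour_integral_unique)
  then have eq: "contour_integral (linepath a b) F + (contour_integral (linepath b c) F +
      (contour_integral (linepath c d) F + contour_integral (linepath d a) F)) = 0"
    using mem by (simp add: contour_integral_join ci contour_integrable_joinI)
  have Fper: "F (z + 2 * pi) = F z" if "z \<in> line_strip \<rho>" for z
    using per [OF that] exp_int_2pi' [of m]
    by (simp add: F_def distrib_left exp_diff exp_add exp_minus)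
  have "contour_integral (linepath b c) F = contour_integral (linepath a d) F"
  proof -
    have "contour_integral (linepath b c) F = integral {0..1} (\<lambda>x. F (linepath b c x)) * (c - b)"
      by (simp add: contour_integral_integral)
    also have "(\<lambda>x. F (linepath b c x)) x = (\<lambda>x. F (linepath a d x)) x" if "x \<in> {0..1}" for x
    proof -
      have "linepath a d x \<in> line_strip \<rho>"
        using seg [of a d] mem that by (metis linepath_in_path subsetD)
      moreover have "linepath b c x = linepath a d x + 2 * pi"
        by (simp add: linepath_def a_def b_def c_def d_def algebra_simps scaleR_conv_of_real)
      ultimately show ?thesis using Fper by simp
    qed
    then have "integral {0..1} (\<lambda>x. F (linepath b c x)) = integral {0..1} (\<lambda>x. F (linepath a d x))"
      by (intro integral_cong) auto
    also have "integral {0..1} (\<lambda>x. F (linepath a d x)) * (c - b) = contour_integral (linepath a d) F"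
      by (simp add: contour_integral_integral a_def b_def c_def d_def)
    finally show ?thesis .
  qed
  moreover have "contour_integral (linepath d a) F = - contour_integral (linepath a d) F"
    using contour_integral_reversepath [of "linepath a d" F] by simp
  moreover have "contour_integral (linepath c d) F = - contour_integral (linepath d c) F"
    using contour_integral_reversepath [of "linepath d c" F] by simp
  ultimately have "contour_integral (linepath a b) F = contour_integral (linepath d c) F"
    using eq by simp
  then show ?thesis
    unfolding fourier_coeff_def F_def a_def b_def c_def d_def by simp
qed

lemma fourier_coeff_bound:
  assumes h: "h holomorphic_on line_strip \<rho>"
    and per: "\<And>z::complex. z \<in> line_strip \<rho> \<Longrightarrow> h (z + 2 * pi) = h z"
    and \<sigma>: "0 \<le> \<sigma>" "\<sigma> < \<rho>" and B: "\<And>z. \<bar>Im z\<bar> \<le> \<sigma> \<Longrightarrow> norm (h z) \<le> B"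
  shows "norm (fourier_coeff m h) \<le> B * exp (- \<sigma> * \<bar>real_of_int m\<bar>)"
proof -
  \<comment> \<open>The segment is moved to the side on which
    \<open>exp (- \<i> * of_int m * s)\<close> decays; its modulus at height \<open>t\<close> is
    \<open>exp (m * t)\<close>.\<close>
  define t where "t = (if m \<ge> 0 then - \<sigma> else \<sigma>)"
  have t: "\<bar>t\<bar> < \<rho>" "\<bar>t\<bar> \<le> \<sigma>" and mt: "real_of_int m * t = - \<sigma> * \<bar>real_of_int m\<bar>"
    using \<sigma> by (auto simp: t_def)
  have B0: "0 \<le> B" using B [of 0] \<sigma> by (smt (verit) norm_ge_zero zero_complex.simps(2))
  let ?F = "\<lambda>s. h s * exp (- \<i> * of_int m * s)"
  have Im: "Im z = t" if z: "z \<in> closed_segment (\<i> * t) (2 * pi + \<i> * t)" for z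
  proof -
    obtain u :: real where "z = (1 - u) *\<^sub>R (\<i> * t) + u *\<^sub>R (2 * pi + \<i> * t)"
      using z unfolding closed_segment_def by blast
    then show ?thesis by (simp add: algebra_simps)
  qed
  have bd: "norm (?F z) \<le> B * exp (- \<sigma> * \<bar>real_of_int m\<bar>)"
    if "z \<in> closed_segment (\<i> * t) (2 * pi + \<i> * t)" for z
  proof -
    have "norm (exp (- \<i> * of_int m * z)) = exp (real_of_int m * t)"
      using Im [OF that] by (simp add: norm_exp_eq_Re)
    then show ?thesis
      using B [of z] Im [OF that] t unfolding norm_mult mt by (intro mult_mono B0) auto
  qed
  have ci: "?F contour_integrable_on linepath (\<i> * t) (2 * pi + \<i> * t)"
  proof (rule contour_integrable_continuous_linepath)
    show "continuous_on (closed_segment (\<i> * t) (2 * pi + \<i> * t)) ?F"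
    proof (rule continuous_on_subset)
      show "continuous_on (line_strip \<rho>) ?F"
        by (intro continuous_intros holomorphic_on_imp_continuous_on [OF h])
      show "closed_segment (\<i> * t) (2 * pi + \<i> * t) \<subseteq> line_strip \<rho>"
        using Im t by (auto simp: line_strip_def)
    qed
  qed
  have "norm (contour_integral (linepath (\<i> * t) (2 * pi + \<i> * t)) ?F)
      \<le> (B * exp (- \<sigma> * \<bar>real_of_int m\<bar>)) * norm ((2 * pi + \<i> * t) - \<i> * t)"
    by (rule contour_integral_bound_linepath [OF ci _ bd]) (use B0 in auto)
  then show ?thesis
    using fourier_coeff_shift [of h \<rho> t m] h per t(1)
    by (simp add: norm_divide divide_le_eq)
qed

lemma fourier_coeff_cong:
  assumes "\<And>s. s \<in> closed_segment 0 (2 * complex_of_real pi) \<Longrightarrow> f s = g s"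
  shows "fourier_coeff m f = fourier_coeff m g"
  unfolding fourier_coeff_def
  by (intro arg_cong2 [of _ _ _ _ "(/)"] contour_integral_cong refl) (use assms in auto)

lemma fourier_coeff_diff:
  assumes "continuous_on (closed_segment 0 (2 * complex_of_real pi)) f" "continuous_on (closed_segment 0 (2 * complex_of_real pi)) g"
  shows "fourier_coeff m (\<lambda>s. f s - g s) = fourier_coeff m f - fourier_coeff m g"
proof -
  have "(\<lambda>s. f s * exp (- \<i> * of_int m * s)) contour_integrable_on linepath 0 (2 * complex_of_real pi)"
    "(\<lambda>s. g s * exp (- \<i> * of_int m * s)) contour_integrable_on linepath 0 (2 * complex_of_real pi)"
    using assms by (auto intro!: contour_integrable_continuous_linepath continuous_intros)
  from contour_integral_diff [OF this] show ?thesis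
    by (simp add: fourier_coeff_def left_diff_distrib diff_divide_distrib)
qed

lemma fourier_coeff_const: "fourier_coeff m (\<lambda>s. c) = (if m = 0 then c else 0)"
proof (cases "m = 0")
  case True
  then show ?thesis by (simp add: fourier_coeff_def)
next
  case False
  have "((\<lambda>s. c * exp (- \<i> * of_int m * s)) has_contour_integral
      (c * exp (- \<i> * of_int m * pathfinish (linepath 0 (2 * complex_of_real pi))) / (- \<i> * of_int m)
       - c * exp (- \<i> * of_int m * pathstart (linepath 0 (2 * complex_of_real pi))) / (- \<i> * of_int m)))
       (linepath 0 (2 * complex_of_real pi))"
    by (rule contour_integral_primitive [where S = UNIV])
      (use False valid_path_linepath in \<open>auto intro!: derivative_eq_intros simp del: linepath_0\<close>)
  from contour_integral_unique [OF this] show ?thesis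
    using False exp_int_2pi' [of m] by (simp add: fourier_coeff_def)
qed

lemma periodic_int:
  assumes per: "\<And>z::complex. z \<in> line_strip \<rho> \<Longrightarrow> h (z + 2 * pi) = h z" and z: "z \<in> line_strip \<rho>"
  shows "h (z + 2 * pi * of_int n) = h z"
proof -
  have mem: "w + 2 * pi * of_int k \<in> line_strip \<rho>" if "w \<in> line_strip \<rho>" for w k
    using that by (simp add: line_strip_def)
  have nat: "h (w + 2 * pi * of_nat n) = h w" if "w \<in> line_strip \<rho>" for n :: nat and w
  proof (induction n)
    case (Suc n)
    have "h (w + 2 * pi * of_nat (Suc n)) = h ((w + 2 * pi * of_nat n) + 2 * pi)"
      by (simp add: algebra_simps)
    also have "\<dots> = h w" using Suc per [of "w + 2 * pi * of_nat n"] mem [OF that, of "int n"] by simp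
    finally show ?case .
  qed simp
  show ?thesis
  proof (cases n rule: int_cases2)
    case (nonneg k)
    then show ?thesis using nat [OF z, of k] by simp
  next
    case (nonpos k)
    have "h ((z + 2 * pi * of_int n) + 2 * pi * of_nat k) = h (z + 2 * pi * of_int n)"
      by (rule nat [OF mem [OF z]])
    then show ?thesis using nonpos by simp
  qed
qed

lemma periodic_bounded_strip:
  assumes cont: "continuous_on (line_strip \<rho>) g"
    and per: "\<And>z::complex. z \<in> line_strip \<rho> \<Longrightarrow> g (z + 2 * pi) = g z" and \<sigma>: "\<sigma> < \<rho>"
  obtains B where "\<And>z. \<bar>Im z\<bar> \<le> \<sigma> \<Longrightarrow> norm (g z) \<le> B"
proof -
  let ?K = "cbox (Complex 0 (- \<sigma>)) (Complex (2 * pi) \<sigma>)"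
  have "compact (g ` ?K)"
    using \<sigma> by (intro compact_continuous_image continuous_on_subset [OF cont])
      (auto simp: line_strip_def in_cbox_complex_iff)
  then obtain B where B: "\<And>z. z \<in> ?K \<Longrightarrow> norm (g z) \<le> B"
    by (metis bounded_iff compact_imp_bounded imageI)
  have "norm (g z) \<le> B" if z: "\<bar>Im z\<bar> \<le> \<sigma>" for z
  proof -
    define n where "n = \<lfloor>Re z / (2 * pi)\<rfloor>"
    have "of_int n \<le> Re z / (2 * pi)" "Re z / (2 * pi) < of_int n + 1"
      unfolding n_def by linarith+
    then have "of_int n * (2 * pi) \<le> Re z" "Re z < (of_int n + 1) * (2 * pi)"
      by (simp_all add: field_simps)
    then have "z + 2 * pi * of_int (- n) \<in> ?K"
      using z by (auto simp: in_cbox_complex_iff algebra_simps)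
    moreover have "g (z + 2 * pi * of_int (- n)) = g z"
      using z \<sigma> by (intro periodic_int [where \<rho> = \<rho>] per) (auto simp: line_strip_def)
    ultimately show ?thesis using B by metis
  qed
  then show ?thesis using that by blast
qed

text \<open>Writing \<open>h s - h z\<close> as a multiple of \<open>exp (\<i> (s - z)) - 1\<close> makes the partial sums of the
  Fourier series at \<open>z\<close> telescope.\<close>

lemma fourier_quotient:
  assumes h: "h holomorphic_on line_strip \<rho>"
    and per: "\<And>z::complex. z \<in> line_strip \<rho> \<Longrightarrow> h (z + 2 * pi) = h z" and z: "z \<in> line_strip \<rho>"
  obtains g where "g holomorphic_on line_strip \<rho>"
    "\<And>s::complex. s \<in> line_strip \<rho> \<Longrightarrow> g (s + 2 * pi) = g s"
    "\<And>s. s \<in> line_strip \<rho> \<Longrightarrow> h s - h z = g s * (exp (\<i> * (s - z)) - 1)"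
proof -
  define g where "g s = (if exp (\<i> * (s - z)) = 1 then deriv h s / \<i>
    else (h s - h z) / (exp (\<i> * (s - z)) - 1))" for s
  let ?S = "line_strip \<rho>"
  have hz: "h s = h z" if one: "exp (\<i> * (s - z)) = 1" for s
  proof -
    obtain n :: int where "Re (\<i> * (s - z)) = 0" "Im (\<i> * (s - z)) = of_int (2 * n) * pi"
      using one unfolding exp_eq_1 by blast
    then have "\<i> * (s - z) = \<i> * (2 * pi * of_int n)" by (simp add: complex_eq_iff)
    then have "s - z = 2 * pi * of_int n"
      using complex_i_not_zero mult_cancel_left by blast
    then have "s = z + 2 * pi * of_int n" by (simp add: algebra_simps)
    then show ?thesis using periodic_int [of \<rho> h z n] per z by simp
  qed
  have hol: "g field_differentiable (at s)" if s: "s \<in> ?S" for s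
  proof (cases "exp (\<i> * (s - z)) = 1")
    case False
    define T where "T = {w \<in> ?S. exp (\<i> * (w - z)) - 1 \<noteq> 0}"
    have "T = ?S \<inter> {w. exp (\<i> * (w - z)) - 1 \<noteq> 0}" by (auto simp: T_def)
    then have "open T"
      by (auto intro!: open_Int open_line_strip open_Collect_neq continuous_intros)
    have "(\<lambda>s. (h s - h z) / (exp (\<i> * (s - z)) - 1)) holomorphic_on T"
      by (intro holomorphic_intros holomorphic_on_subset [OF h]) (auto simp: T_def)
    then have "g holomorphic_on T"
      by (rule holomorphic_transform) (auto simp: g_def T_def)
    then show ?thesis
      using \<open>open T\<close> s False by (auto simp: T_def intro: holomorphic_on_imp_differentiable_at)
  next
    case True
    \<comment> \<open>Zeros of the denominator are 2 pi apart, so a ball of radius 1 around one of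
      them contains no other.\<close>
    define T where "T = ?S \<inter> ball s 1"
    have T: "open T" "s \<in> T" using s by (auto simp: T_def open_line_strip)
    \<comment> \<open>Near \<open>s\<close> the quotient is rewritten as a ratio of two divided
      differences; both are holomorphic, and the lower one equals \<open>\<i>\<close> at
      \<open>s\<close>.\<close>
    define hq where "hq = (\<lambda>w. if w = s then deriv h s else (h w - h s) / (w - s))"
    define eq where "eq = (\<lambda>w. if w = s then deriv (\<lambda>w. exp (\<i> * (w - s))) s
        else (exp (\<i> * (w - s)) - exp (\<i> * (s - s))) / (w - s))"
    have hq: "hq holomorphic_on T"
      unfolding hq_def by (rule pole_lemma_open [OF _ T(1)])
        (use h in \<open>auto simp: T_def intro: holomorphic_on_subset\<close>)
    have eq: "eq holomorphic_on T"
      unfolding eq_def by (rule pole_lemma_open [OF _ T(1)]) (intro holomorphic_intros)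
    have d: "deriv (\<lambda>w. exp (\<i> * (w - s))) s = \<i>"
      by (rule DERIV_imp_deriv) (auto intro!: derivative_eq_intros)
    have shift: "exp (\<i> * (w - z)) = exp (\<i> * (w - s))" for w
    proof -
      have "exp (\<i> * (w - z)) = exp (\<i> * (w - s)) * exp (\<i> * (s - z))"
        by (simp add: exp_add [symmetric] algebra_simps)
      then show ?thesis using True by simp
    qed
    have ne: "exp (\<i> * (w - s)) \<noteq> 1" if "w \<in> T" "w \<noteq> s" for w
    proof
      assume "exp (\<i> * (w - s)) = 1"
      then obtain n :: int where n: "Im (\<i> * (w - s)) = of_int (2 * n) * pi" "Re (\<i> * (w - s)) = 0"
        unfolding exp_eq_1 by blast
      have "\<bar>Re (w - s)\<bar> < 1"
        using that abs_Re_le_cmod [of "w - s"] by (auto simp: T_def dist_norm norm_minus_commute)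
      then have "\<bar>of_int (2 * n) * pi\<bar> < 1" using n by simp
      then have "n = 0"
      proof -
        have "1 \<le> \<bar>n\<bar>" if "n \<noteq> 0" using that by simp
        then have "pi \<le> \<bar>of_int (2 * n) * pi\<bar>" if "n \<noteq> 0"
          using that by (simp add: abs_mult)
        then show ?thesis using \<open>\<bar>of_int (2 * n) * pi\<bar> < 1\<close> pi_gt3 by fastforce
      qed
      then have "w = s" using n by (auto simp: complex_eq_iff)
      then show False using that by simp
    qed
    have "(\<lambda>w. hq w / eq w) holomorphic_on T"
      by (intro holomorphic_intros hq eq) (use ne d in \<open>auto simp: eq_def\<close>)
    then have "g holomorphic_on T"
    proof (rule holomorphic_transform)
      fix w assume w: "w \<in> T"
      show "hq w / eq w = g w"
        using ne [OF w] d hz [OF True]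
        by (cases "w = s") (auto simp: g_def hq_def eq_def shift)
    qed
    then show ?thesis using T by (auto intro: holomorphic_on_imp_differentiable_at)
  qed
  show ?thesis
  proof
    show "g holomorphic_on ?S"
      using hol by (auto simp: holomorphic_on_def intro: field_differentiable_at_within)
    show eq: "h s - h z = g s * (exp (\<i> * (s - z)) - 1)" if "s \<in> ?S" for s
      using hz [of s] by (auto simp: g_def)
    show "g (s + 2 * pi) = g s" if s: "s \<in> ?S" for s
    proof -
      have e: "exp (\<i> * (s + 2 * pi - z)) = exp (\<i> * (s - z))"
        using exp_int_2pi [of 1] by (simp add: algebra_simps exp_add exp_diff)
      have "deriv h (s + 2 * pi) = deriv h s"
      proof -
        have "s + 2 * pi \<in> ?S" using s by (simp add: line_strip_def)
        then have "(h has_field_derivative deriv h (s + 2 * pi)) (at (s + 2 * pi))"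
          using h open_line_strip holomorphic_derivI by blast
        then have "((\<lambda>w. h (w + 2 * pi)) has_field_derivative deriv h (s + 2 * pi)) (at s)"
          by (simp add: DERIV_shift)
        then have "(h has_field_derivative deriv h (s + 2 * pi)) (at s)"
          by (rule has_field_derivative_transform_within_open [OF _ open_line_strip s]) (use per in auto)
        then show ?thesis by (metis DERIV_imp_deriv)
      qed
      then show ?thesis unfolding g_def e using per [OF s] by simp
    qed
  qed
qed

text \<open>The coefficients decay at a rate above \<open>\<bar>Im z\<bar>\<close>, so the series is
  absolutely summable. Its value is found from symmetric partial sums: these differ from
  \<open>h z\<close> by two boundary terms, which are Fourier terms of the quotient \<open>g\<close>
  and tend to 0.\<close>

lemma fourier_series_strip:
  assumes h: "h holomorphic_on line_strip \<rho>"
    and per: "\<And>z::complex. z \<in> line_strip \<rho> \<Longrightarrow> h (z + 2 * pi) = h z" and z: "z \<in> line_strip \<rho>"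
  shows "((\<lambda>m. fourier_coeff m h * exp (\<i> * of_int m * z)) has_sum h z) UNIV"
proof -
  obtain g where g: "g holomorphic_on line_strip \<rho>"
    "\<And>s::complex. s \<in> line_strip \<rho> \<Longrightarrow> g (s + 2 * pi) = g s"
    "\<And>s. s \<in> line_strip \<rho> \<Longrightarrow> h s - h z = g s * (exp (\<i> * (s - z)) - 1)"
    using fourier_quotient [OF h per z] by blast
  obtain \<sigma> where \<sigma>: "\<bar>Im z\<bar> < \<sigma>" "\<sigma> < \<rho>"
    using z dense unfolding line_strip_def by blast
  then have \<sigma>0: "0 \<le> \<sigma>" by linarith
  define r where "r = \<sigma> - \<bar>Im z\<bar>"
  have r: "r > 0" using \<sigma> by (simp add: r_def)
  have dec: "\<exists>B. \<forall>m. norm (fourier_coeff m f * exp (\<i> * of_int m * z)) \<le> B * exp (- r * \<bar>real_of_int m\<bar>)"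
    if f: "f holomorphic_on line_strip \<rho>"
      and fper: "\<And>z::complex. z \<in> line_strip \<rho> \<Longrightarrow> f (z + 2 * pi) = f z" for f
  proof -
    obtain B where B: "\<And>z. \<bar>Im z\<bar> \<le> \<sigma> \<Longrightarrow> norm (f z) \<le> B"
      using periodic_bounded_strip [OF holomorphic_on_imp_continuous_on [OF f] fper \<sigma>(2)] by blast
    have B0: "0 \<le> B" using B [of 0] \<sigma>0 by (smt (verit) norm_ge_zero zero_complex.simps(2))
    have "norm (fourier_coeff m f * exp (\<i> * of_int m * z)) \<le> B * exp (- r * \<bar>real_of_int m\<bar>)" for m
    proof -
      have "norm (fourier_coeff m f * exp (\<i> * of_int m * z))
          \<le> (B * exp (- \<sigma> * \<bar>real_of_int m\<bar>)) * exp (\<bar>real_of_int m\<bar> * \<bar>Im z\<bar>)"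
        unfolding norm_mult
      proof (intro mult_mono)
        show "norm (exp (\<i> * of_int m * z)) \<le> exp (\<bar>real_of_int m\<bar> * \<bar>Im z\<bar>)"
          by (simp add: norm_exp_eq_Re abs_mult [symmetric])
      qed (use fourier_coeff_bound [OF f fper \<sigma>0 \<sigma>(2) B] B0 in auto)
      also have "\<dots> = B * exp (- r * \<bar>real_of_int m\<bar>)"
        by (simp add: exp_add [symmetric] r_def algebra_simps)
      finally show ?thesis .
    qed
    then show ?thesis by blast
  qed
  obtain B where B: "\<And>m. norm (fourier_coeff m h * exp (\<i> * of_int m * z)) \<le> B * exp (- r * \<bar>real_of_int m\<bar>)"
    using dec [OF h per] by blast
  obtain C where C: "\<And>m. norm (fourier_coeff m g * exp (\<i> * of_int m * z)) \<le> C * exp (- r * \<bar>real_of_int m\<bar>)"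
    using dec [OF g(1,2)] by blast
  let ?u = "\<lambda>m. fourier_coeff m h * exp (\<i> * of_int m * z)"
  have "(\<lambda>m. B * exp (- r * \<bar>real_of_int m\<bar>)) summable_on UNIV"
    using summable_on_exp_int [OF r] by (intro summable_on_cmult_right) auto
  then have "(\<lambda>m. norm (?u m)) summable_on UNIV"
    by (rule Infinite_Sum.abs_summable_on_comparison_test') (rule B)
  then have "?u summable_on UNIV"
    by (rule abs_summable_summable)
  then obtain S where S: "(?u has_sum S) UNIV"
    by (auto simp: summable_on_def)
  have real_in: "closed_segment 0 (2 * complex_of_real pi) \<subseteq> line_strip \<rho>"
    using \<sigma> \<sigma>0 by (intro closed_segment_subset convex_line_strip) (auto simp: line_strip_def)
  define a where "a m = fourier_coeff m g * exp (\<i> * of_int m * z)" for m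
  \<comment> \<open>Multiplication by \<open>exp (\<i> * (s - z))\<close> shifts the index of a
    Fourier term of \<open>g\<close> by one, and the constant \<open>h z\<close> contributes to mode
    0 only.\<close>
  have tel: "?u m - (if m = 0 then h z else 0) = a (m - 1) - a m" for m
  proof -
    have cg: "continuous_on (closed_segment 0 (2 * complex_of_real pi)) g" "continuous_on (closed_segment 0 (2 * complex_of_real pi)) h"
      using real_in g(1) h by (auto intro: continuous_on_subset holomorphic_on_imp_continuous_on)
    have "fourier_coeff m (\<lambda>s. h s - h z) = fourier_coeff m (\<lambda>s. exp (\<i> * (s - z)) * g s - g s)"
    proof (rule fourier_coeff_cong)
      fix s assume "s \<in> closed_segment 0 (2 * complex_of_real pi)"
      then show "h s - h z = exp (\<i> * (s - z)) * g s - g s"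
        using g(3) [of s] real_in by (auto simp: right_diff_distrib mult.commute)
    qed
    also have "\<dots> = fourier_coeff m (\<lambda>s. exp (\<i> * (s - z)) * g s) - fourier_coeff m g"
      by (intro fourier_coeff_diff continuous_intros cg)
    also have "fourier_coeff m (\<lambda>s. exp (\<i> * (s - z)) * g s) = exp (- \<i> * z) * fourier_coeff (m - 1) g"
    proof -
      have "(\<lambda>s. exp (\<i> * (s - z)) * g s * exp (- \<i> * of_int m * s))
          = (\<lambda>s. exp (- \<i> * z) * (g s * exp (- \<i> * of_int (m - 1) * s)))"
        by (rule ext) (simp add: exp_add [symmetric] exp_diff exp_minus field_simps)
      moreover have "(\<lambda>s. g s * exp (- \<i> * of_int (m - 1) * s)) contour_integrable_on linepath 0 (2 * complex_of_real pi)"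
        using cg by (auto intro!: contour_integrable_continuous_linepath continuous_intros)
      ultimately show ?thesis
        by (simp add: fourier_coeff_def contour_integral_lmul)
    qed
    finally have "fourier_coeff m h - (if m = 0 then h z else 0)
        = exp (- \<i> * z) * fourier_coeff (m - 1) g - fourier_coeff m g"
      using fourier_coeff_diff [OF cg(2), of "\<lambda>s. h z" m] by (simp add: fourier_coeff_const)
    then have "(fourier_coeff m h - (if m = 0 then h z else 0)) * exp (\<i> * of_int m * z)
        = (exp (- \<i> * z) * exp (\<i> * of_int m * z)) * fourier_coeff (m - 1) g - a m"
      by (simp only: a_def) (simp only: left_diff_distrib right_diff_distrib mult.assoc mult.commute mult.left_commute)
    moreover have "exp (- \<i> * z) * exp (\<i> * of_int m * z) = exp (\<i> * of_int (m - 1) * z)"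
      by (simp add: exp_add [symmetric] algebra_simps)
    ultimately show ?thesis
      by (auto simp: a_def algebra_simps)
  qed
  have part: "(\<Sum>m\<in>{- int N..int N}. ?u m) = h z + a (- int N - 1) - a (int N)" for N
  proof (induction N)
    case 0
    then show ?case using tel [of 0] by (simp add: algebra_simps)
  next
    case (Suc N)
    have "{- int (Suc N)..int (Suc N)} = insert (- int N - 1) (insert (int N + 1) {- int N..int N})"
      by auto
    then have "(\<Sum>m\<in>{- int (Suc N)..int (Suc N)}. ?u m)
        = ?u (- int N - 1) + (?u (int N + 1) + (\<Sum>m\<in>{- int N..int N}. ?u m))"
      by simp
    also have "?u (- int N - 1) = a (- int (Suc N) - 1) - a (- int N - 1)"
      using tel [of "- int N - 1"] by simp
    also have "?u (int N + 1) = a (int N) - a (int (Suc N))"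
      using tel [of "int N + 1"] by (simp add: add.commute)
    also note Suc
    finally have "(\<Sum>m\<in>{- int (Suc N)..int (Suc N)}. ?u m) = a (- int (Suc N) - 1) - a (- int N - 1)
        + (a (int N) - a (int (Suc N)) + (h z + a (- int N - 1) - a (int N)))" .
    also have "\<dots> = h z + a (- int (Suc N) - 1) - a (int (Suc N))" by simp
    finally show ?case .
  qed
  have lim0: "(\<lambda>N. C * exp (- r * real N)) \<longlonglongrightarrow> 0"
  proof -
    have "(\<lambda>N. exp (- r) ^ N) \<longlonglongrightarrow> 0"
      using r by (intro LIMSEQ_power_zero) auto
    then have "(\<lambda>N. C * exp (- r) ^ N) \<longlonglongrightarrow> 0"
      by (rule tendsto_mult_right_zero)
    then show ?thesis by (simp add: exp_of_nat_mult [symmetric] mult.commute)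
  qed
  have C0: "0 \<le> C" using order_trans [OF norm_ge_zero C [of 0]] by simp
  have "(\<lambda>N. a (int N)) \<longlonglongrightarrow> 0"
    by (rule Lim_null_comparison [OF _ lim0], rule always_eventually)
      (use C [of "int _"] in \<open>auto simp: a_def\<close>)
  moreover have "(\<lambda>N. a (- int N - 1)) \<longlonglongrightarrow> 0"
  proof (rule Lim_null_comparison [OF _ lim0], rule always_eventually, rule allI)
    fix N
    have "norm (a (- int N - 1)) \<le> C * exp (- r * \<bar>real_of_int (- int N - 1)\<bar>)"
      unfolding a_def by (rule C)
    also have "\<dots> \<le> C * exp (- r * real N)"
      using r C0 by (intro mult_left_mono) auto
    finally show "norm (a (- int N - 1)) \<le> C * exp (- r * real N)" .
  qed
  ultimately have "(\<lambda>N. h z + a (- int N - 1) - a (int N)) \<longlonglongrightarrow> h z + 0 - 0"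
    by (intro tendsto_intros)
  then have lim1: "(\<lambda>N. \<Sum>m\<in>{- int N..int N}. ?u m) \<longlonglongrightarrow> h z"
    by (simp add: part)
  \<comment> \<open>Symmetric intervals eventually contain every finite set, so the unordered sum is
    the limit of the partial sums just computed.\<close>
  have "filterlim (\<lambda>N. {- int N..int N}) (finite_subsets_at_top UNIV) sequentially"
    unfolding filterlim_finite_subsets_at_top
  proof (intro allI impI)
    fix X :: "int set" assume "finite X \<and> X \<subseteq> UNIV"
    then have b: "\<forall>x\<in>X. \<bar>x\<bar> \<le> b" if "b = Max (insert 0 (abs ` X))" for b
      unfolding that by simp
    define b where "b = Max (insert 0 (abs ` X))"
    show "\<forall>\<^sub>F N in sequentially. finite {- int N..int N} \<and> X \<subseteq> {- int N..int N} \<and> {- int N..int N} \<subseteq> UNIV"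
      using eventually_ge_at_top [of "nat b"]
      by eventually_elim (use b [OF b_def] in force)
  qed
  then have "(\<lambda>N. \<Sum>m\<in>{- int N..int N}. ?u m) \<longlonglongrightarrow> S"
    using S unfolding has_sum_def by (rule filterlim_compose [rotated])
  then have "S = h z" using lim1 LIMSEQ_unique by blast
  then show ?thesis using S by simp
qed

section \<open>Fourier series in several variables\<close>

definition ostrip :: "real \<Rightarrow> (complex ^ 'n) set" where
  "ostrip \<rho> = {\<theta>. \<forall>j. \<bar>Im (\<theta> $ j)\<bar> < \<rho>}"

definition vec_upd :: "'a ^ 'n \<Rightarrow> 'n \<Rightarrow> 'a \<Rightarrow> 'a ^ 'n" where
  "vec_upd \<theta> j z = (\<chi> i. if i = j then z else \<theta> $ i)"

lemma vec_upd_nth [simp]: "vec_upd \<theta> j z $ i = (if i = j then z else \<theta> $ i)"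
  by (simp add: vec_upd_def)

lemma vec_upd_same [simp]: "vec_upd \<theta> j (\<theta> $ j) = \<theta>"
  by (simp add: vec_eq_iff)

lemma vec_upd_upd [simp]: "vec_upd (vec_upd \<theta> j z) j w = vec_upd \<theta> j w"
  by (simp add: vec_eq_iff)

lemma vec_upd_commute: "i \<noteq> j \<Longrightarrow> vec_upd (vec_upd \<theta> j z) i w = vec_upd (vec_upd \<theta> i w) j z"
  by (simp add: vec_eq_iff)

lemma continuous_on_vec_upd [continuous_intros]:
  fixes f :: "'b::topological_space \<Rightarrow> 'a::topological_space ^ 'n"
  assumes "continuous_on S f" "continuous_on S g"
  shows "continuous_on S (\<lambda>x. vec_upd (f x) j (g x))"
  unfolding vec_upd_def
proof (rule continuous_on_vec_lambda)
  fix i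
  show "continuous_on S (\<lambda>x. if i = j then g x else f x $ i)"
    using assms by (cases "i = j") (auto intro!: continuous_intros)
qed

lemma vec_upd_in_ostrip: "\<theta> \<in> ostrip \<rho> \<Longrightarrow> z \<in> line_strip \<rho> \<Longrightarrow> vec_upd \<theta> j z \<in> ostrip \<rho>"
  by (simp add: ostrip_def line_strip_def)

lemma open_ostrip: "open (ostrip \<rho> :: (complex ^ 'n) set)"
proof -
  have "ostrip \<rho> = (\<Inter>j\<in>UNIV. {\<theta> :: complex ^ 'n. \<bar>Im (\<theta> $ j)\<bar> < \<rho>})"
    by (auto simp: ostrip_def)
  then show ?thesis
    by (simp add: open_INT open_Collect_less continuous_intros)
qed

text \<open>Joint continuity together with holomorphy in each coordinate passes through integration
  in one variable, reflection and uniform limits by one-variable arguments. Joint complex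
  differentiability is recovered from the Fourier series in
  \<open>analytic_of_hol_per\<close>.\<close>

definition hol_per :: "real \<Rightarrow> (complex ^ 'n \<Rightarrow> complex) \<Rightarrow> bool" where
  "hol_per \<rho> f \<longleftrightarrow> continuous_on (ostrip \<rho>) f \<and>
     (\<forall>\<theta>\<in>ostrip \<rho>. \<forall>j. (\<lambda>z. f (vec_upd \<theta> j z)) holomorphic_on line_strip \<rho>) \<and>
     (\<forall>\<theta>\<in>ostrip \<rho>. \<forall>j. f (vec_upd \<theta> j (\<theta> $ j + 2 * pi)) = f \<theta>)"

lemma hol_perD:
  assumes "hol_per \<rho> f"
  shows "continuous_on (ostrip \<rho>) f"
    and "\<theta> \<in> ostrip \<rho> \<Longrightarrow> (\<lambda>z. f (vec_upd \<theta> j z)) holomorphic_on line_strip \<rho>"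
    and "\<theta> \<in> ostrip \<rho> \<Longrightarrow> f (vec_upd \<theta> j (\<theta> $ j + 2 * pi)) = f \<theta>"
  using assms by (auto simp: hol_per_def)

lemma hol_per_slice_periodic:
  assumes "hol_per \<rho> f" "\<theta> \<in> ostrip \<rho>" "z \<in> line_strip \<rho>"
  shows "f (vec_upd \<theta> j (z + 2 * pi)) = f (vec_upd \<theta> j z)"
  using hol_perD(3) [OF assms(1), of "vec_upd \<theta> j z" j] assms vec_upd_in_ostrip by fastforce

text \<open>Kept as a function on the whole space, constant in coordinate \<open>j\<close>, so that
  it can be expanded again in another coordinate.\<close>

definition fourier_coord :: "'n \<Rightarrow> int \<Rightarrow> (complex ^ 'n \<Rightarrow> complex) \<Rightarrow> complex ^ 'n \<Rightarrow> complex" where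
  "fourier_coord j m f \<theta> = fourier_coeff m (\<lambda>s. f (vec_upd \<theta> j s))"

lemma segment_2pi_subset:
  assumes "\<rho> > 0"
  shows "closed_segment 0 (2 * complex_of_real pi) \<subseteq> line_strip \<rho>"
  using assms by (intro closed_segment_subset convex_line_strip) (auto simp: line_strip_def)

lemma ostrip_pos: "\<theta> \<in> ostrip \<rho> \<Longrightarrow> \<rho> > 0"
  by (smt (verit) abs_ge_zero mem_Collect_eq ostrip_def)

lemma continuous_on_contour_integral_param:
  fixes F :: "'b::topological_space \<Rightarrow> complex \<Rightarrow> complex"
  assumes "continuous_on (U \<times> closed_segment a b) (\<lambda>(x, s). F x s)"
  shows "continuous_on U (\<lambda>x. contour_integral (linepath a b) (F x))"
proof -
  have "continuous_on (U \<times> cbox 0 1) (\<lambda>(x, t). F x (linepath a b t))"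
  proof -
    have "continuous_on (U \<times> cbox 0 1) ((\<lambda>(x, s). F x s) \<circ> (\<lambda>(x, t). (x, linepath a b t)))"
    proof (intro continuous_on_compose)
      show "continuous_on (U \<times> cbox 0 1) (\<lambda>(x, t). (x, linepath a b t))"
        unfolding linepath_def case_prod_beta by (intro continuous_intros)
      show "continuous_on ((\<lambda>(x, t). (x, linepath a b t)) ` (U \<times> cbox 0 1)) (\<lambda>(x, s). F x s)"
        by (rule continuous_on_subset [OF assms]) (auto simp: linepath_in_path)
    qed
    then show ?thesis by (simp add: o_def case_prod_beta)
  qed
  then have "continuous_on U (\<lambda>x. integral (cbox 0 1) (\<lambda>t. F x (linepath a b t)))"
    by (rule integral_continuous_on_param)
  then show ?thesis
    unfolding contour_integral_integral by (simp add: continuous_intros)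
qed

lemma hol_per_integrand_continuous:
  assumes f: "hol_per \<rho> f" and \<rho>: "\<rho> > 0"
  shows "continuous_on (ostrip \<rho> \<times> closed_segment 0 (2 * complex_of_real pi))
    (\<lambda>(\<theta>, s). f (vec_upd \<theta> j s) * exp (- \<i> * of_int m * s))"
proof -
  have "continuous_on (ostrip \<rho> \<times> closed_segment 0 (2 * complex_of_real pi))
      (f \<circ> (\<lambda>(\<theta>, s). vec_upd \<theta> j s))"
  proof (rule continuous_on_compose)
    show "continuous_on (ostrip \<rho> \<times> closed_segment 0 (2 * complex_of_real pi)) (\<lambda>(\<theta>, s). vec_upd \<theta> j s)"
      unfolding case_prod_beta by (intro continuous_intros)
    show "continuous_on ((\<lambda>(\<theta>, s). vec_upd \<theta> j s) ` (ostrip \<rho> \<times> closed_segment 0 (2 * complex_of_real pi))) f"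
      using segment_2pi_subset [OF \<rho>]
      by (intro continuous_on_subset [OF hol_perD(1) [OF f]]) (auto intro: vec_upd_in_ostrip)
  qed
  then have "continuous_on (ostrip \<rho> \<times> closed_segment 0 (2 * complex_of_real pi))
      (\<lambda>x. f (vec_upd (fst x) j (snd x)))" by (simp add: o_def case_prod_beta)
  then show ?thesis unfolding case_prod_beta by (intro continuous_intros)
qed

lemma fourier_coord_continuous:
  fixes f :: "complex ^ 'n \<Rightarrow> complex"
  assumes f: "hol_per \<rho> f"
  shows "continuous_on (ostrip \<rho>) (fourier_coord j m f)"
proof (cases "\<rho> > 0")
  case True
  have "continuous_on (ostrip \<rho>) (\<lambda>\<theta>. contour_integral (linepath 0 (2 * complex_of_real pi))
      (\<lambda>s. f (vec_upd \<theta> j s) * exp (- \<i> * of_int m * s)))"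
    by (rule continuous_on_contour_integral_param [OF hol_per_integrand_continuous [OF f True]])
  then show ?thesis
    unfolding fourier_coord_def fourier_coeff_def by (intro continuous_intros) auto
next
  case False
  then have "ostrip \<rho> = ({} :: (complex ^ 'n) set)" using ostrip_pos by blast
  then show ?thesis by simp
qed

text \<open>Differentiation under the integral sign is replaced by Morera's theorem.\<close>

lemma fourier_coord_holomorphic:
  assumes f: "hol_per \<rho> f" and \<theta>: "\<theta> \<in> ostrip \<rho>"
  shows "(\<lambda>z. fourier_coord j m f (vec_upd \<theta> l z)) holomorphic_on line_strip \<rho>"
proof (cases "l = j")
  case True
  then show ?thesis by (simp add: fourier_coord_def)
next
  case False
  have \<rho>: "\<rho> > 0" using \<theta> by (rule ostrip_pos)
  let ?L = "linepath 0 (2 * complex_of_real pi)" and ?K = "closed_segment 0 (2 * complex_of_real pi)"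
  define F where "F z s = f (vec_upd (vec_upd \<theta> l z) j s) * exp (- \<i> * of_int m * s)" for z s
  have Fc: "continuous_on (line_strip \<rho> \<times> ?K) (\<lambda>(z, s). F z s)"
  proof -
    have "continuous_on (line_strip \<rho> \<times> ?K) ((\<lambda>(\<theta>, s). f (vec_upd \<theta> j s) * exp (- \<i> * of_int m * s))
        \<circ> (\<lambda>(z, s). (vec_upd \<theta> l z, s)))"
    proof (rule continuous_on_compose)
      show "continuous_on (line_strip \<rho> \<times> ?K) (\<lambda>(z, s). (vec_upd \<theta> l z, s))"
        unfolding case_prod_beta by (intro continuous_intros)
      show "continuous_on ((\<lambda>(z, s). (vec_upd \<theta> l z, s)) ` (line_strip \<rho> \<times> ?K))
          (\<lambda>(\<theta>, s). f (vec_upd \<theta> j s) * exp (- \<i> * of_int m * s))"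
        by (rule continuous_on_subset [OF hol_per_integrand_continuous [OF f \<rho>]])
          (use \<theta> in \<open>auto intro: vec_upd_in_ostrip\<close>)
    qed
    then show ?thesis by (simp add: o_def case_prod_beta F_def)
  qed
  have Fh: "(\<lambda>z. F z s) holomorphic_on line_strip \<rho>" if "s \<in> ?K" for s
  proof -
    have "s \<in> line_strip \<rho>" using that segment_2pi_subset [OF \<rho>] by blast
    then have "(\<lambda>z. f (vec_upd (vec_upd \<theta> j s) l z)) holomorphic_on line_strip \<rho>"
      using hol_perD(2) [OF f] vec_upd_in_ostrip \<theta> by blast
    then show ?thesis
      unfolding F_def by (intro holomorphic_intros) (simp add: vec_upd_commute [OF False [symmetric]])
  qed
  have "(\<lambda>z. contour_integral ?L (F z)) analytic_on line_strip \<rho>"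
  proof (rule Morera_triangle)
    show "continuous_on (line_strip \<rho>) (\<lambda>z. contour_integral ?L (F z))"
      by (rule continuous_on_contour_integral_param [OF Fc])
    show "open (line_strip \<rho>)" by (rule open_line_strip)
    fix a b c
    show "convex hull {a, b, c} \<subseteq> line_strip \<rho> \<longrightarrow>
        contour_integral (linepath a b) (\<lambda>z. contour_integral ?L (F z)) +
        contour_integral (linepath b c) (\<lambda>z. contour_integral ?L (F z)) +
        contour_integral (linepath c a) (\<lambda>z. contour_integral ?L (F z)) = 0"
    proof
      assume abc: "convex hull {a, b, c} \<subseteq> line_strip \<rho>"
      have mem: "a \<in> line_strip \<rho>" "b \<in> line_strip \<rho>" "c \<in> line_strip \<rho>"
        using abc hull_subset [of "{a, b, c}" convex] by auto
      have seg: "closed_segment x y \<subseteq> line_strip \<rho>" if "x \<in> line_strip \<rho>" "y \<in> line_strip \<rho>" for x y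
        using that convex_line_strip by (rule closed_segment_subset)
      define I where "I x y s = contour_integral (linepath x y) (\<lambda>z. F z s)" for x y s
      have Fxy: "continuous_on (closed_segment x y \<times> ?K) (\<lambda>(z, s). F z s)"
        if "x \<in> line_strip \<rho>" "y \<in> line_strip \<rho>" for x y
        by (rule continuous_on_subset [OF Fc]) (use seg [OF that] in auto)
      \<comment> \<open>Fubini on the product of a triangle side with the period segment; the inner
        integral around the triangle then vanishes by Cauchy's theorem.\<close>
      have swap: "contour_integral (linepath x y) (\<lambda>z. contour_integral ?L (F z)) = contour_integral ?L (I x y)"
        if "x \<in> line_strip \<rho>" "y \<in> line_strip \<rho>" for x y
        unfolding I_def
        by (rule contour_integral_swap) (use Fxy [OF that] in \<open>auto simp del: linepath_0\<close>)
      have int: "I x y contour_integrable_on ?L" if "x \<in> line_strip \<rho>" "y \<in> line_strip \<rho>" for x y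
      proof (rule contour_integrable_continuous_linepath)
        have "continuous_on (?K \<times> closed_segment x y) ((\<lambda>(z, s). F z s) \<circ> prod.swap)"
          by (intro continuous_on_compose continuous_on_swap)
            (use Fxy [OF that] in \<open>simp add: product_swap\<close>)
        then have "continuous_on (?K \<times> closed_segment x y) (\<lambda>(s, z). F z s)"
          by (simp add: o_def case_prod_beta prod.swap_def)
        then show "continuous_on ?K (I x y)"
          unfolding I_def by (rule continuous_on_contour_integral_param)
      qed
      have "I a b s + I b c s + I c a s = 0" if s: "s \<in> ?K" for s
      proof -
        have "((\<lambda>z. F z s) has_contour_integral 0) (linepath a b +++ linepath b c +++ linepath c a)"
          using mem seg
          by (intro Cauchy_theorem_convex_simple [OF Fh [OF s] convex_line_strip]) (auto simp: path_image_join)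
        moreover have "(\<lambda>z. F z s) contour_integrable_on linepath x y"
          if "x \<in> line_strip \<rho>" "y \<in> line_strip \<rho>" for x y
          using holomorphic_on_imp_continuous_on [OF Fh [OF s]] seg [OF that]
          by (intro contour_integrable_continuous_linepath) (rule continuous_on_subset)
        ultimately show ?thesis
          using mem contour_integral_unique unfolding I_def
          by (fastforce simp: contour_integral_join contour_integrable_joinI add.assoc)
      qed
      then have "contour_integral ?L (\<lambda>s. I a b s + I b c s + I c a s) = contour_integral ?L (\<lambda>s. 0)"
        by (intro contour_integral_cong) auto
      moreover have "contour_integral ?L (\<lambda>s. I a b s + I b c s + I c a s)
          = contour_integral ?L (I a b) + contour_integral ?L (I b c) + contour_integral ?L (I c a)"
        using mem int by (simp add: contour_integral_add contour_integrable_add)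
      ultimately show "contour_integral (linepath a b) (\<lambda>z. contour_integral ?L (F z)) +
        contour_integral (linepath b c) (\<lambda>z. contour_integral ?L (F z)) +
        contour_integral (linepath c a) (\<lambda>z. contour_integral ?L (F z)) = 0"
        using mem by (simp add: swap)
    qed
  qed
  then have "(\<lambda>z. contour_integral ?L (F z)) holomorphic_on line_strip \<rho>"
    by (rule analytic_imp_holomorphic)
  then show ?thesis
    unfolding fourier_coord_def fourier_coeff_def F_def by (intro holomorphic_intros) auto
qed

lemma hol_per_fourier_coord:
  assumes f: "hol_per \<rho> f"
  shows "hol_per \<rho> (fourier_coord j m f)"
  unfolding hol_per_def
proof (intro conjI ballI allI)
  show "continuous_on (ostrip \<rho>) (fourier_coord j m f)"
    by (rule fourier_coord_continuous [OF f])
  fix \<theta> :: "complex ^ 'a" and l assume \<theta>: "\<theta> \<in> ostrip \<rho>"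
  show "(\<lambda>z. fourier_coord j m f (vec_upd \<theta> l z)) holomorphic_on line_strip \<rho>"
    by (rule fourier_coord_holomorphic [OF f \<theta>])
  show "fourier_coord j m f (vec_upd \<theta> l (\<theta> $ l + 2 * pi)) = fourier_coord j m f \<theta>"
  proof (cases "l = j")
    case False
    show ?thesis unfolding fourier_coord_def
    proof (rule fourier_coeff_cong)
      fix s assume "s \<in> closed_segment 0 (2 * complex_of_real pi)"
      then have "s \<in> line_strip \<rho>" using segment_2pi_subset ostrip_pos [OF \<theta>] by blast
      then have "vec_upd \<theta> j s \<in> ostrip \<rho>" using \<theta> by (rule vec_upd_in_ostrip [rotated])
      from hol_perD(3) [OF f this, of l] show "f (vec_upd (vec_upd \<theta> l (\<theta> $ l + 2 * pi)) j s) = f (vec_upd \<theta> j s)"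
        using False by (simp add: vec_upd_commute [of j l])
    qed
  qed (simp add: fourier_coord_def)
qed

lemma fourier_coord_bound:
  assumes f: "hol_per \<rho> f" and B: "\<And>\<theta>. \<theta> \<in> ostrip \<rho> \<Longrightarrow> norm (f \<theta>) \<le> B" and \<theta>: "\<theta> \<in> ostrip \<rho>"
  shows "norm (fourier_coord j m f \<theta>) \<le> B * exp (- \<rho> * \<bar>real_of_int m\<bar>)"
proof -
  have \<rho>: "\<rho> > 0" using \<theta> by (rule ostrip_pos)
  have bd: "norm (fourier_coord j m f \<theta>) \<le> B * exp (- \<sigma> * \<bar>real_of_int m\<bar>)" if \<sigma>: "0 < \<sigma>" "\<sigma> < \<rho>" for \<sigma>
    unfolding fourier_coord_def
  proof (rule fourier_coeff_bound [where \<rho> = \<rho>])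
    show "norm (f (vec_upd \<theta> j z)) \<le> B" if "\<bar>Im z\<bar> \<le> \<sigma>" for z
      using that \<sigma> by (intro B vec_upd_in_ostrip \<theta>) (simp add: line_strip_def)
    show "f (vec_upd \<theta> j (z + 2 * pi)) = f (vec_upd \<theta> j z)" if "z \<in> line_strip \<rho>" for z
      by (rule hol_per_slice_periodic [OF f \<theta> that])
  qed (use \<sigma> in \<open>auto intro: hol_perD(2) [OF f \<theta>]\<close>)
  \<comment> \<open>Letting the height tend to \<open>\<rho>\<close> gives the full decay rate, so
    taking coefficients costs no width.\<close>
  have "((\<lambda>\<sigma>. B * exp (- \<sigma> * \<bar>real_of_int m\<bar>)) \<longlongrightarrow> B * exp (- \<rho> * \<bar>real_of_int m\<bar>)) (at_left \<rho>)"
    by (intro tendsto_intros)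
  moreover have "\<forall>\<^sub>F \<sigma> in at_left \<rho>. norm (fourier_coord j m f \<theta>) \<le> B * exp (- \<sigma> * \<bar>real_of_int m\<bar>)"
    using eventually_at_left_real [OF \<rho>] by eventually_elim (use bd in auto)
  ultimately show ?thesis
    by (intro tendsto_lowerbound) auto
qed

lemma fourier_coord_has_sum:
  assumes f: "hol_per \<rho> f" and \<theta>: "\<theta> \<in> ostrip \<rho>"
  shows "((\<lambda>m. fourier_coord j m f \<theta> * exp (\<i> * of_int m * \<theta> $ j)) has_sum f \<theta>) UNIV"
proof -
  have "\<theta> $ j \<in> line_strip \<rho>" using \<theta> by (simp add: ostrip_def line_strip_def)
  then have "((\<lambda>m. fourier_coord j m f \<theta> * exp (\<i> * of_int m * \<theta> $ j)) has_sum f (vec_upd \<theta> j (\<theta> $ j))) UNIV"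
    unfolding fourier_coord_def
    by (intro fourier_series_strip [where \<rho> = \<rho>] hol_perD(2) [OF f] hol_per_slice_periodic [OF f] \<theta>)
  then show ?thesis by simp
qed

section \<open>Multi-indices and Fourier series in all coordinates\<close>

definition freq_abs :: "int ^ 'n \<Rightarrow> real" where
  "freq_abs k = real_of_int (freq_norm k)"

lemma freq_abs_eq: "freq_abs k = (\<Sum>j\<in>UNIV. \<bar>real_of_int (k $ j)\<bar>)"
  by (simp add: freq_abs_def freq_norm_def)

lemma freq_abs_nonneg [simp]: "0 \<le> freq_abs k"
  by (simp add: freq_abs_eq sum_nonneg)

lemma abs_nth_le_freq_abs: "\<bar>real_of_int (k $ j)\<bar> \<le> freq_abs k"
  unfolding freq_abs_eq by (rule member_le_sum) auto

lemma freq_abs_ge_1: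
  assumes "k \<noteq> 0"
  shows "1 \<le> freq_abs k"
proof -
  obtain j where "k $ j \<noteq> 0" using assms by (auto simp: vec_eq_iff)
  then have "1 \<le> \<bar>real_of_int (k $ j)\<bar>" by linarith
  also have "\<dots> \<le> freq_abs k" by (rule abs_nth_le_freq_abs)
  finally show ?thesis .
qed

text \<open>A finite set of multi-indices lies in a box, over which the sum of the products is the
  product of the sums.\<close>

lemma summable_on_prod_int:
  fixes g :: "int \<Rightarrow> real"
  assumes "g summable_on UNIV" and g0: "\<And>m. 0 \<le> g m"
  shows "(\<lambda>k :: int ^ 'n. \<Prod>j\<in>UNIV. g (k $ j)) summable_on UNIV"
proof (rule nonneg_bdd_above_summable_on)
  show "0 \<le> (\<Prod>j\<in>UNIV. g (k $ j))" for k :: "int ^ 'n"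
    by (simp add: prod_nonneg g0)
  have "(\<Sum>k\<in>F. \<Prod>j\<in>UNIV. g (k $ j)) \<le> (infsum g UNIV) ^ CARD('n)" if F: "finite F" for F :: "(int ^ 'n) set"
  proof -
    define A where "A = (\<Union>j. (\<lambda>k. k $ j) ` F)"
    have A: "finite A" using F by (simp add: A_def)
    have "(\<Sum>k\<in>F. \<Prod>j\<in>UNIV. g (k $ j)) = (\<Sum>x\<in>vec_nth ` F. \<Prod>j\<in>(UNIV :: 'n set). g (x j))"
      by (subst sum.reindex) (auto simp: inj_on_def vec_eq_iff fun_eq_iff)
    also have "\<dots> \<le> (\<Sum>x\<in>Pi\<^sub>E (UNIV :: 'n set) (\<lambda>_. A). \<Prod>j\<in>(UNIV :: 'n set). g (x j))"
      by (rule sum_mono2) (use A in \<open>auto simp: A_def prod_nonneg g0 intro!: finite_PiE\<close>)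
    also have "\<dots> = (\<Prod>j\<in>(UNIV :: 'n set). \<Sum>a\<in>A. g a)"
      using A by (subst prod_sum_PiE) auto
    also have "\<dots> \<le> (\<Prod>j\<in>(UNIV :: 'n set). infsum g UNIV)"
      by (intro prod_mono) (use A assms in \<open>auto intro!: sum_nonneg finite_sum_le_infsum\<close>)
    finally show ?thesis by simp
  qed
  then show "bdd_above (sum (\<lambda>k :: int ^ 'n. \<Prod>j\<in>UNIV. g (k $ j)) ` {F. F \<subseteq> UNIV \<and> finite F})"
    by (intro bdd_aboveI) auto
qed

lemma summable_on_exp_freq:
  assumes "r > 0"
  shows "(\<lambda>k :: int ^ 'n. exp (- r * freq_abs k)) summable_on UNIV"
proof -
  have "exp (- r * freq_abs k) = (\<Prod>j\<in>UNIV. exp (- r * \<bar>real_of_int (k $ j)\<bar>))" for k :: "int ^ 'n"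
    by (simp add: freq_abs_eq exp_sum [symmetric] sum_distrib_left sum_negf)
  then show ?thesis
    using summable_on_prod_int [OF summable_on_exp_int [OF assms]] by simp
qed

definition char_fun :: "int ^ 'n \<Rightarrow> complex ^ 'n \<Rightarrow> complex" where
  "char_fun k \<theta> = exp (\<i> * (\<Sum>j\<in>UNIV. of_int (k $ j) * \<theta> $ j))"

lemma char_fun_prod: "char_fun k \<theta> = (\<Prod>j\<in>UNIV. exp (\<i> * of_int (k $ j) * \<theta> $ j))"
  by (simp add: char_fun_def exp_sum [symmetric] sum_distrib_left mult.assoc)

lemma norm_char_fun_le:
  assumes "\<And>j. \<bar>Im (\<theta> $ j)\<bar> \<le> \<sigma>"
  shows "norm (char_fun k \<theta>) \<le> exp (\<sigma> * freq_abs k)"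
proof -
  have "norm (char_fun k \<theta>) = exp (- (\<Sum>j\<in>UNIV. real_of_int (k $ j) * Im (\<theta> $ j)))"
    by (simp add: char_fun_def norm_exp_eq_Re)
  moreover have "- (\<Sum>j\<in>UNIV. real_of_int (k $ j) * Im (\<theta> $ j)) \<le> (\<Sum>j\<in>UNIV. \<sigma> * \<bar>real_of_int (k $ j)\<bar>)"
    unfolding sum_negf [symmetric]
  proof (rule sum_mono)
    fix j
    have "- (real_of_int (k $ j) * Im (\<theta> $ j)) \<le> \<bar>real_of_int (k $ j)\<bar> * \<bar>Im (\<theta> $ j)\<bar>"
      by (metis abs_ge_minus_self abs_mult)
    also have "\<dots> \<le> \<bar>real_of_int (k $ j)\<bar> * \<sigma>" by (intro mult_left_mono assms) auto
    finally show "- (real_of_int (k $ j) * Im (\<theta> $ j)) \<le> \<sigma> * \<bar>real_of_int (k $ j)\<bar>"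
      by (simp add: mult.commute)
  qed
  ultimately show ?thesis by (simp add: freq_abs_eq sum_distrib_left)
qed

text \<open>Expansion in part of the coordinates only, which is what an induction on the number of
  variables needs.\<close>

primrec fourier_list :: "'n list \<Rightarrow> int ^ 'n \<Rightarrow> (complex ^ 'n \<Rightarrow> complex) \<Rightarrow> complex ^ 'n \<Rightarrow> complex" where
  "fourier_list [] k f = f"
| "fourier_list (j # js) k f = fourier_coord j (k $ j) (fourier_list js k f)"

lemma hol_per_fourier_list: "hol_per \<rho> f \<Longrightarrow> hol_per \<rho> (fourier_list js k f)"
  by (induction js) (auto intro: hol_per_fourier_coord)

lemma fourier_list_bound:
  assumes f: "hol_per \<rho> f" and B: "\<And>\<theta>. \<theta> \<in> ostrip \<rho> \<Longrightarrow> norm (f \<theta>) \<le> B" and \<theta>: "\<theta> \<in> ostrip \<rho>"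
  shows "norm (fourier_list js k f \<theta>) \<le> B * exp (- \<rho> * (\<Sum>j\<leftarrow>js. \<bar>real_of_int (k $ j)\<bar>))"
  using \<theta>
proof (induction js arbitrary: \<theta>)
  case Nil
  then show ?case using B by simp
next
  case (Cons j js)
  have "norm (fourier_coord j (k $ j) (fourier_list js k f) \<theta>)
      \<le> (B * exp (- \<rho> * (\<Sum>j\<leftarrow>js. \<bar>real_of_int (k $ j)\<bar>))) * exp (- \<rho> * \<bar>real_of_int (k $ j)\<bar>)"
    by (rule fourier_coord_bound [OF hol_per_fourier_list [OF f] Cons.IH Cons.prems])
  then show ?case by (simp add: exp_add [symmetric] algebra_simps)
qed

lemma fourier_list_indep:
  "(\<And>i. i \<notin> set js \<Longrightarrow> \<theta> $ i = \<theta>' $ i) \<Longrightarrow> fourier_list js k f \<theta> = fourier_list js k f \<theta>'"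
proof (induction js arbitrary: \<theta> \<theta>')
  case Nil
  then have "\<theta> = \<theta>'" by (simp add: vec_eq_iff)
  then show ?case by simp
next
  case (Cons j js)
  have "fourier_list js k f (vec_upd \<theta> j s) = fourier_list js k f (vec_upd \<theta>' j s)" for s
    by (rule Cons.IH) (use Cons.prems in auto)
  then show ?case by (simp add: fourier_coord_def)
qed

lemma fourier_list_cong:
  "(\<And>i. i \<in> set js \<Longrightarrow> k $ i = k' $ i) \<Longrightarrow> fourier_list js k f = fourier_list js k' f"
  by (induction js) auto

text \<open>Each coefficient is expanded in one more coordinate. The iterated sums merge into one
  because the joint series is absolutely summable by \<open>fourier_list_bound\<close>. Restricting
  to multi-indices supported on \<open>js\<close> makes the index set grow with the list.\<close>

lemma fourier_list_has_sum:
  assumes f: "hol_per \<rho> f" and B: "\<And>\<theta>. \<theta> \<in> ostrip \<rho> \<Longrightarrow> norm (f \<theta>) \<le> B" and \<theta>: "\<theta> \<in> ostrip \<rho>"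
  shows "distinct js \<Longrightarrow>
    ((\<lambda>k. fourier_list js k f \<theta> * char_fun k \<theta>) has_sum f \<theta>) {k. \<forall>i. i \<notin> set js \<longrightarrow> k $ i = 0}"
proof (induction js)
  case Nil
  have "{k :: int ^ 'a. \<forall>i. i \<notin> set [] \<longrightarrow> k $ i = 0} = {0}" by (auto simp: vec_eq_iff)
  moreover have "char_fun 0 \<theta> = 1" by (simp add: char_fun_def)
  ultimately show ?case by (simp add: has_sum_finiteI)
next
  case (Cons j js)
  let ?K = "\<lambda>js. {k :: int ^ 'a. \<forall>i. i \<notin> set js \<longrightarrow> k $ i = 0}"
  have jn: "j \<notin> set js" using Cons.prems by simp
  \<comment> \<open>A multi-index supported on \<open>j # js\<close> corresponds to one supported on
    \<open>js\<close> together with its entry at \<open>j\<close>.\<close>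
  define h where "h = (\<lambda>(k :: int ^ 'a, m). vec_upd k j m)"
  define u where "u k = fourier_list (j # js) k f \<theta> * char_fun k \<theta>" for k
  have bij: "bij_betw h (Sigma (?K js) (\<lambda>_. UNIV)) (?K (j # js))"
    unfolding h_def
    by (rule bij_betwI [where g = "\<lambda>k. (vec_upd k j 0, k $ j)"]) (use jn in \<open>auto simp: vec_eq_iff\<close>)
  have uh: "u (h (k, m)) = (fourier_coord j m (fourier_list js k f) \<theta> * exp (\<i> * of_int m * \<theta> $ j)) * char_fun k \<theta>"
    if k: "k \<in> ?K js" for k m
  proof -
    have "fourier_list js (vec_upd k j m) f = fourier_list js k f"
      by (rule fourier_list_cong) (use jn in auto)
    moreover have "char_fun (vec_upd k j m) \<theta> = exp (\<i> * of_int m * \<theta> $ j) * char_fun k \<theta>"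
    proof -
      have "k $ j = 0" using k jn by auto
      then have "char_fun k \<theta> = (\<Prod>i\<in>UNIV - {j}. exp (\<i> * of_int (k $ i) * \<theta> $ i))"
        unfolding char_fun_prod by (subst prod.remove [of _ j]) auto
      moreover have "char_fun (vec_upd k j m) \<theta>
          = exp (\<i> * of_int m * \<theta> $ j) * (\<Prod>i\<in>UNIV - {j}. exp (\<i> * of_int (k $ i) * \<theta> $ i))"
        unfolding char_fun_prod by (subst prod.remove [of _ j]) (auto intro!: prod.cong)
      ultimately show ?thesis by simp
    qed
    ultimately show ?thesis by (simp add: u_def h_def)
  qed
  \<comment> \<open>There are finitely many coordinates, so the largest imaginary part is still
    below \<open>\<rho>\<close>; the gap is the decay rate of the series at this point.\<close>
  define \<sigma> where "\<sigma> = Max (range (\<lambda>j. \<bar>Im (\<theta> $ j)\<bar>))"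
  have \<sigma>: "\<bar>Im (\<theta> $ j)\<bar> \<le> \<sigma>" for j unfolding \<sigma>_def by (intro Max_ge) auto
  have \<sigma>\<rho>: "\<sigma> < \<rho>" unfolding \<sigma>_def using \<theta> by (subst Max_less_iff) (auto simp: ostrip_def)
  have ub: "norm (u k) \<le> B * exp (- (\<rho> - \<sigma>) * freq_abs k)" if k: "k \<in> ?K (j # js)" for k
  proof -
    have eq: "(\<Sum>j\<leftarrow>j # js. \<bar>real_of_int (k $ j)\<bar>) = freq_abs k"
    proof -
      have "(\<Sum>j\<leftarrow>j # js. \<bar>real_of_int (k $ j)\<bar>) = (\<Sum>j\<in>set (j # js). \<bar>real_of_int (k $ j)\<bar>)"
        using Cons.prems by (simp only: sum_list_distinct_conv_sum_set)
      also have "\<dots> = freq_abs k" unfolding freq_abs_eq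
        by (rule sum.mono_neutral_left) (use k in auto)
      finally show ?thesis .
    qed
    have B0: "0 \<le> B" using B [OF \<theta>] norm_ge_zero order_trans by blast
    have "norm (u k) \<le> (B * exp (- \<rho> * freq_abs k)) * exp (\<sigma> * freq_abs k)"
      unfolding u_def norm_mult
      using fourier_list_bound [OF f B \<theta>, of "j # js" k] norm_char_fun_le [of \<theta> \<sigma> k] \<sigma> B0
      unfolding eq by (intro mult_mono) auto
    also have "\<dots> = B * exp (- (\<rho> - \<sigma>) * freq_abs k)"
      by (simp add: exp_add [symmetric] algebra_simps)
    finally show ?thesis .
  qed
  have "(\<lambda>k :: int ^ 'a. B * exp (- (\<rho> - \<sigma>) * freq_abs k)) summable_on UNIV"
    using summable_on_exp_freq [of "\<rho> - \<sigma>"] \<sigma>\<rho> by (intro summable_on_cmult_right) auto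
  then have "(\<lambda>k. B * exp (- (\<rho> - \<sigma>) * freq_abs k)) summable_on ?K (j # js)"
    by (rule summable_on_subset) auto
  then have "(\<lambda>k. norm (u k)) summable_on ?K (j # js)"
    by (rule Infinite_Sum.abs_summable_on_comparison_test') (rule ub)
  then have "u summable_on ?K (j # js)" by (rule abs_summable_summable)
  then have summ: "(\<lambda>x. u (h x)) summable_on Sigma (?K js) (\<lambda>_. UNIV)"
    by (subst summable_on_reindex_bij_betw [OF bij])
  have "((\<lambda>x. u (h x)) has_sum f \<theta>) (Sigma (?K js) (\<lambda>_. UNIV))"
  proof (rule has_sum_SigmaI [OF _ _ summ])
    fix k assume k: "k \<in> ?K js"
    show "((\<lambda>m. u (h (k, m))) has_sum fourier_list js k f \<theta> * char_fun k \<theta>) UNIV"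
      unfolding uh [OF k]
      by (intro has_sum_cmult_left fourier_coord_has_sum [OF _ \<theta>] hol_per_fourier_list f)
  next
    show "((\<lambda>k. fourier_list js k f \<theta> * char_fun k \<theta>) has_sum f \<theta>) (?K js)"
      using Cons by simp
  qed
  then have "(u has_sum f \<theta>) (?K (j # js))"
    by (subst (asm) has_sum_reindex_bij_betw [OF bij])
  then show ?case by (simp only: u_def [abs_def])
qed

definition all_coords :: "'n::finite list" where
  "all_coords = (SOME js. set js = UNIV \<and> distinct js)"

lemma all_coords: "set all_coords = UNIV" "distinct all_coords"
  using someI_ex [OF finite_distinct_list [OF finite [of UNIV]]] unfolding all_coords_def by auto

text \<open>Once every coordinate has been integrated out the result is constant, by
  \<open>fourier_list_indep\<close>; 0 is an arbitrary evaluation point.\<close>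

definition fourier :: "(complex ^ 'n \<Rightarrow> complex) \<Rightarrow> int ^ 'n \<Rightarrow> complex" where
  "fourier f k = fourier_list all_coords k f 0"

lemma fourier_bound:
  assumes f: "hol_per \<rho> f" and \<rho>: "\<rho> > 0" and B: "\<And>\<theta>. \<theta> \<in> ostrip \<rho> \<Longrightarrow> norm (f \<theta>) \<le> B"
  shows "norm (fourier f k) \<le> B * exp (- \<rho> * freq_abs k)"
proof -
  have "(0 :: complex ^ 'a) \<in> ostrip \<rho>" using \<rho> by (simp add: ostrip_def)
  from fourier_list_bound [OF f B this, of all_coords k] show ?thesis
    by (simp add: fourier_def sum_list_distinct_conv_sum_set all_coords freq_abs_eq)
qed

lemma fourier_has_sum:
  assumes f: "hol_per \<rho> f" and B: "\<And>\<theta>. \<theta> \<in> ostrip \<rho> \<Longrightarrow> norm (f \<theta>) \<le> B" and \<theta>: "\<theta> \<in> ostrip \<rho>"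
  shows "((\<lambda>k. fourier f k * char_fun k \<theta>) has_sum f \<theta>) UNIV"
proof -
  have "fourier_list all_coords k f \<theta> = fourier f k" for k
    unfolding fourier_def by (rule fourier_list_indep) (simp add: all_coords)
  then show ?thesis
    using fourier_list_has_sum [OF f B \<theta> all_coords(2)] by (simp add: all_coords(1))
qed

lemma fourier_diff:
  assumes f: "hol_per \<rho> f" and g: "hol_per \<rho> g" and \<rho>: "\<rho> > 0"
  shows "fourier (\<lambda>\<theta>. f \<theta> - g \<theta>) k = fourier f k - fourier g k"
proof -
  have "fourier_list js k (\<lambda>\<theta>. f \<theta> - g \<theta>) \<theta> = fourier_list js k f \<theta> - fourier_list js k g \<theta>"
    if "\<theta> \<in> ostrip \<rho>" for js \<theta>
    using that
  proof (induction js arbitrary: \<theta>)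
    case (Cons j js)
    have in1: "s \<in> line_strip \<rho>" if "s \<in> closed_segment 0 (2 * complex_of_real pi)" for s
      using that segment_2pi_subset [OF \<rho>] by blast
    have cont: "continuous_on (closed_segment 0 (2 * complex_of_real pi)) (\<lambda>s. fourier_list js k u (vec_upd \<theta> j s))"
      if "hol_per \<rho> u" for u
      using hol_perD(2) [OF hol_per_fourier_list [OF that] Cons.prems]
      by (meson holomorphic_on_imp_continuous_on continuous_on_subset segment_2pi_subset [OF \<rho>])
    have "fourier_list (j # js) k (\<lambda>\<theta>. f \<theta> - g \<theta>) \<theta>
        = fourier_coeff (k $ j) (\<lambda>s. fourier_list js k f (vec_upd \<theta> j s) - fourier_list js k g (vec_upd \<theta> j s))"
      unfolding fourier_list.simps fourier_coord_def
      by (rule fourier_coeff_cong) (intro Cons.IH vec_upd_in_ostrip Cons.prems in1)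
    also have "\<dots> = fourier_list (j # js) k f \<theta> - fourier_list (j # js) k g \<theta>"
      unfolding fourier_list.simps fourier_coord_def
      by (intro fourier_coeff_diff cont f g)
    finally show ?case .
  qed simp
  moreover have "(0 :: complex ^ 'a) \<in> ostrip \<rho>" using \<rho> by (simp add: ostrip_def)
  ultimately show ?thesis by (simp add: fourier_def)
qed

section \<open>Closure properties of periodic holomorphic functions\<close>

lemma ostrip_mono: "\<rho>' \<le> \<rho> \<Longrightarrow> ostrip \<rho>' \<subseteq> ostrip \<rho>"
  by (auto simp: ostrip_def intro: less_le_trans)

lemma line_strip_mono: "\<rho>' \<le> \<rho> \<Longrightarrow> line_strip \<rho>' \<subseteq> line_strip \<rho>"
  by (force simp: line_strip_def)

lemma hol_per_mono:
  assumes "hol_per \<rho> f" "\<rho>' \<le> \<rho>"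
  shows "hol_per \<rho>' f"
  using assms ostrip_mono [OF assms(2)] line_strip_mono [OF assms(2)] unfolding hol_per_def
  by (meson continuous_on_subset holomorphic_on_subset subsetD)

lemma hol_per_const: "hol_per \<rho> (\<lambda>\<theta>. c)"
  by (simp add: hol_per_def)

lemma hol_per_add: "hol_per \<rho> f \<Longrightarrow> hol_per \<rho> g \<Longrightarrow> hol_per \<rho> (\<lambda>\<theta>. f \<theta> + g \<theta>)"
  by (auto simp: hol_per_def intro!: continuous_intros holomorphic_intros)

lemma hol_per_diff: "hol_per \<rho> f \<Longrightarrow> hol_per \<rho> g \<Longrightarrow> hol_per \<rho> (\<lambda>\<theta>. f \<theta> - g \<theta>)"
  by (auto simp: hol_per_def intro!: continuous_intros holomorphic_intros)

lemma hol_per_mult: "hol_per \<rho> f \<Longrightarrow> hol_per \<rho> g \<Longrightarrow> hol_per \<rho> (\<lambda>\<theta>. f \<theta> * g \<theta>)"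
  by (auto simp: hol_per_def intro!: continuous_intros holomorphic_intros)

lemma hol_per_compose:
  fixes f :: "complex ^ 'n \<Rightarrow> complex"
  assumes f: "hol_per \<rho> f" and g: "g holomorphic_on W" and W: "\<And>\<theta>. \<theta> \<in> ostrip \<rho> \<Longrightarrow> f \<theta> \<in> W"
  shows "hol_per \<rho> (\<lambda>\<theta>. g (f \<theta>))"
  unfolding hol_per_def
proof (intro conjI ballI allI)
  have "continuous_on (ostrip \<rho>) (g \<circ> f)"
    by (intro continuous_on_compose hol_perD(1) [OF f] continuous_on_subset [OF holomorphic_on_imp_continuous_on [OF g]])
      (use W in auto)
  then show "continuous_on (ostrip \<rho>) (\<lambda>\<theta>. g (f \<theta>))" by (simp add: o_def)
next
  fix \<theta> :: "complex ^ 'n" and j assume \<theta>: "\<theta> \<in> ostrip \<rho>"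
  have "g \<circ> (\<lambda>z. f (vec_upd \<theta> j z)) holomorphic_on line_strip \<rho>"
    by (rule holomorphic_on_compose_gen [OF hol_perD(2) [OF f \<theta>] g])
      (use W vec_upd_in_ostrip [OF \<theta>] in auto)
  then show "(\<lambda>z. g (f (vec_upd \<theta> j z))) holomorphic_on line_strip \<rho>" by (simp add: o_def)
  show "g (f (vec_upd \<theta> j (\<theta> $ j + 2 * pi))) = g (f \<theta>)"
    using hol_perD(3) [OF f \<theta>] by simp
qed

definition vec_cnj :: "complex ^ 'n \<Rightarrow> complex ^ 'n" where
  "vec_cnj \<theta> = (\<chi> j. cnj (\<theta> $ j))"

lemma vec_cnj_nth [simp]: "vec_cnj \<theta> $ j = cnj (\<theta> $ j)"
  by (simp add: vec_cnj_def)

text \<open>Reflecting argument and value together keeps holomorphy. On real arguments this is plain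
  conjugation, so it supplies holomorphic extensions of real and imaginary parts.\<close>

lemma hol_per_cnj:
  assumes f: "hol_per \<rho> f"
  shows "hol_per \<rho> (\<lambda>\<theta>. cnj (f (vec_cnj \<theta>)))"
  unfolding hol_per_def
proof (intro conjI ballI allI)
  have mem: "vec_cnj \<theta> \<in> ostrip \<rho>" if "\<theta> \<in> ostrip \<rho>" for \<theta> :: "complex ^ 'a"
    using that by (simp add: ostrip_def vec_cnj_def)
  have upd: "vec_cnj (vec_upd \<theta> j z) = vec_upd (vec_cnj \<theta>) j (cnj z)" for \<theta> :: "complex ^ 'a" and j z
    by (simp add: vec_eq_iff vec_cnj_def)
  have "continuous_on (ostrip \<rho>) (vec_cnj :: complex ^ 'a \<Rightarrow> _)"
    unfolding vec_cnj_def by (intro continuous_intros)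
  then have "continuous_on (ostrip \<rho>) (f \<circ> vec_cnj)"
    by (intro continuous_on_compose continuous_on_subset [OF hol_perD(1) [OF f]]) (use mem in auto)
  then show "continuous_on (ostrip \<rho>) (\<lambda>\<theta>. cnj (f (vec_cnj \<theta>)))"
    by (intro continuous_intros) (simp add: o_def)
  fix \<theta> :: "complex ^ 'a" and j assume \<theta>: "\<theta> \<in> ostrip \<rho>"
  have "cnj ` line_strip \<rho> = line_strip \<rho>"
    unfolding image_cnj_conv_vimage_cnj by (auto simp: line_strip_def)
  then have "cnj \<circ> (\<lambda>z. f (vec_upd (vec_cnj \<theta>) j z)) \<circ> cnj holomorphic_on line_strip \<rho>"
    by (intro holomorphic_on_compose_cnj_cnj open_line_strip) (simp add: hol_perD(2) [OF f mem [OF \<theta>]])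
  then show "(\<lambda>z. cnj (f (vec_cnj (vec_upd \<theta> j z)))) holomorphic_on line_strip \<rho>"
    by (simp add: o_def upd)
  show "cnj (f (vec_cnj (vec_upd \<theta> j (\<theta> $ j + 2 * pi)))) = cnj (f (vec_cnj \<theta>))"
    using hol_perD(3) [OF f mem [OF \<theta>], of j] by (simp add: upd)
qed

lemma hol_per_uniform_limit:
  fixes g :: "complex ^ 'n \<Rightarrow> complex"
  assumes f: "\<And>n. hol_per \<rho> (f n)" and lim: "uniform_limit (ostrip \<rho>) f g sequentially"
  shows "hol_per \<rho> g"
  unfolding hol_per_def
proof (intro conjI ballI allI)
  show "continuous_on (ostrip \<rho>) g"
    by (rule uniform_limit_theorem [OF _ lim]) (use hol_perD(1) [OF f] in auto)
  fix \<theta> :: "complex ^ 'n" and j assume \<theta>: "\<theta> \<in> ostrip \<rho>"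
  show "(\<lambda>z. g (vec_upd \<theta> j z)) holomorphic_on line_strip \<rho>"
  proof (rule holomorphic_uniform_sequence [OF open_line_strip])
    show "(\<lambda>z. f n (vec_upd \<theta> j z)) holomorphic_on line_strip \<rho>" for n
      by (rule hol_perD(2) [OF f \<theta>])
    fix z assume "z \<in> line_strip \<rho>"
    then obtain d where d: "d > 0" "cball z d \<subseteq> line_strip \<rho>"
      using open_line_strip open_contains_cball by blast
    have "uniform_limit (cball z d) (\<lambda>n z. f n (vec_upd \<theta> j z)) (\<lambda>z. g (vec_upd \<theta> j z)) sequentially"
      unfolding uniform_limit_iff
    proof (intro allI impI)
      fix e :: real assume "e > 0"
      with lim have "\<forall>\<^sub>F n in sequentially. \<forall>x\<in>ostrip \<rho>. dist (f n x) (g x) < e"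
        by (simp add: uniform_limit_iff)
      then show "\<forall>\<^sub>F n in sequentially. \<forall>w\<in>cball z d. dist (f n (vec_upd \<theta> j w)) (g (vec_upd \<theta> j w)) < e"
        by eventually_elim (use d(2) vec_upd_in_ostrip [OF \<theta>] in blast)
    qed
    with d show "\<exists>d>0. cball z d \<subseteq> line_strip \<rho> \<and>
        uniform_limit (cball z d) (\<lambda>n z. f n (vec_upd \<theta> j z)) (\<lambda>z. g (vec_upd \<theta> j z)) sequentially"
      by blast
  qed
  have "(\<lambda>n. f n \<theta>) \<longlonglongrightarrow> g \<theta>" using lim \<theta> by (rule tendsto_uniform_limitI)
  moreover have "2 * pi + \<theta> $ j \<in> line_strip \<rho>" using \<theta> by (simp add: ostrip_def line_strip_def)
  then have "vec_upd \<theta> j (\<theta> $ j + 2 * pi) \<in> ostrip \<rho>"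
    by (intro vec_upd_in_ostrip \<theta>) (simp add: add.commute)
  then have "(\<lambda>n. f n (vec_upd \<theta> j (\<theta> $ j + 2 * pi))) \<longlonglongrightarrow> g (vec_upd \<theta> j (\<theta> $ j + 2 * pi))"
    using lim by (intro tendsto_uniform_limitI)
  ultimately show "g (vec_upd \<theta> j (\<theta> $ j + 2 * pi)) = g \<theta>"
    using hol_perD(3) [OF f \<theta>] by (simp add: LIMSEQ_unique)
qed

lemma hol_per_bounded:
  fixes f :: "complex ^ 'n \<Rightarrow> complex"
  assumes f: "hol_per \<rho> f" and \<sigma>: "\<sigma> < \<rho>"
  obtains B where "\<And>\<theta>. \<theta> \<in> ostrip \<sigma> \<Longrightarrow> norm (f \<theta>) \<le> B"
proof -
  define K :: "(complex ^ 'n) set" where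
    "K = {\<theta>. \<forall>j. \<theta> $ j \<in> cbox (Complex 0 (- \<sigma>)) (Complex (2 * pi) \<sigma>)}"
  have "compact K"
  proof -
    have "K = (\<Inter>j. (\<lambda>\<theta>. \<theta> $ j) -` cbox (Complex 0 (- \<sigma>)) (Complex (2 * pi) \<sigma>))"
      by (auto simp: K_def)
    then have "closed K"
      by (auto intro!: closed_INT closed_vimage closed_cbox continuous_intros)
    moreover have "bounded K"
    proof -
      obtain M where M: "\<And>z. z \<in> cbox (Complex 0 (- \<sigma>)) (Complex (2 * pi) \<sigma>) \<Longrightarrow> norm z \<le> M"
        using bounded_cbox bounded_iff by metis
      have "norm \<theta> \<le> (\<Sum>j\<in>(UNIV :: 'n set). M)" if "\<theta> \<in> K" for \<theta>
        unfolding norm_vec_def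
        by (rule order_trans [OF L2_set_le_sum sum_mono]) (use M that in \<open>auto simp: K_def\<close>)
      then show ?thesis by (auto simp: bounded_iff)
    qed
    ultimately show ?thesis by (simp add: compact_eq_bounded_closed)
  qed
  moreover have "K \<subseteq> ostrip \<rho>"
    using \<sigma> by (auto simp: K_def ostrip_def in_cbox_complex_iff abs_less_iff) (smt (verit))+
  ultimately have "compact (f ` K)"
    by (intro compact_continuous_image continuous_on_subset [OF hol_perD(1) [OF f]])
  then obtain B where B: "\<And>\<theta>. \<theta> \<in> K \<Longrightarrow> norm (f \<theta>) \<le> B"
    by (metis bounded_iff compact_imp_bounded imageI)
  have "norm (f \<theta>) \<le> B" if \<theta>: "\<theta> \<in> ostrip \<sigma>" for \<theta>
  proof -
    \<comment> \<open>Periodicity holds in one coordinate at a time, so the real parts are brought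
      into a period interval by induction over a list of coordinates.\<close>
    have "\<exists>\<theta>'\<in>ostrip \<sigma>. f \<theta>' = f \<theta> \<and> (\<forall>j\<in>set js. 0 \<le> Re (\<theta>' $ j) \<and> Re (\<theta>' $ j) \<le> 2 * pi)" for js
    proof (induction js)
      case (Cons j js)
      then obtain \<theta>' where \<theta>': "\<theta>' \<in> ostrip \<sigma>" "f \<theta>' = f \<theta>"
          "\<forall>j\<in>set js. 0 \<le> Re (\<theta>' $ j) \<and> Re (\<theta>' $ j) \<le> 2 * pi" by blast
      have \<theta>\<rho>: "\<theta>' \<in> ostrip \<rho>" using \<theta>'(1) \<sigma> ostrip_mono [of \<sigma> \<rho>] by auto
      define n where "n = \<lfloor>Re (\<theta>' $ j) / (2 * pi)\<rfloor>"
      define w where "w = \<theta>' $ j + 2 * pi * of_int (- n)"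
      have "of_int n \<le> Re (\<theta>' $ j) / (2 * pi)" "Re (\<theta>' $ j) / (2 * pi) < of_int n + 1"
        unfolding n_def by linarith+
      then have w: "0 \<le> Re w" "Re w \<le> 2 * pi" "Im w = Im (\<theta>' $ j)"
        by (simp_all add: w_def field_simps)
      have "f (vec_upd \<theta>' j w) = f (vec_upd \<theta>' j (\<theta>' $ j))"
        unfolding w_def
        by (rule periodic_int [where h = "\<lambda>z. f (vec_upd \<theta>' j z)" and \<rho> = \<rho>])
          (use \<theta>\<rho> in \<open>auto intro!: hol_per_slice_periodic [OF f, simplified] simp: line_strip_def ostrip_def\<close>)
      moreover have "vec_upd \<theta>' j w \<in> ostrip \<sigma>"
        using \<theta>'(1) w by (simp add: ostrip_def)
      ultimately show ?case
        using \<theta>' w by (intro bexI [of _ "vec_upd \<theta>' j w"]) auto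
    qed (use \<theta> in auto)
    from this [of all_coords] obtain \<theta>' where \<theta>': "\<theta>' \<in> ostrip \<sigma>" "f \<theta>' = f \<theta>"
          "\<forall>j. 0 \<le> Re (\<theta>' $ j) \<and> Re (\<theta>' $ j) \<le> 2 * pi" by (auto simp: all_coords)
    then have "\<theta>' \<in> K" by (auto simp: K_def ostrip_def in_cbox_complex_iff abs_less_iff less_imp_le) (smt (verit))
    then show ?thesis using B \<theta>'(2) by metis
  qed
  then show ?thesis using that by blast
qed

subsection \<open>Weighted sums over frequencies\<close>

text \<open>Unlike the norm itself it is at least 1 at \<open>k = 0\<close> as well, so its powers
  are monotone in the exponent and invertible.\<close>

definition wt :: "int ^ 'n \<Rightarrow> real" where "wt k = 1 + freq_abs k"

lemma wt_ge_1 [simp]: "1 \<le> wt k" and wt_pos [simp]: "0 < wt k"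
  by (auto simp: wt_def add_pos_nonneg)

lemma wt_nonneg [simp]: "0 \<le> wt k"
  using wt_pos [of k] by linarith

lemma summable_on_inverse_square_int: "(\<lambda>m::int. inverse ((1 + \<bar>real_of_int m\<bar>)\<^sup>2)) summable_on UNIV"
proof -
  have "summable (\<lambda>n::nat. inverse ((real (Suc n))\<^sup>2))"
    using inverse_power_summable [of 2, where 'a = real] by (subst summable_Suc_iff) auto
  then have nat: "(\<lambda>n::nat. inverse ((1 + real n)\<^sup>2)) summable_on UNIV"
    by (intro summable_nonneg_imp_summable_on) auto
  have A: "(\<lambda>m::int. inverse ((1 + \<bar>real_of_int m\<bar>)\<^sup>2)) summable_on range int"
    by (subst summable_on_reindex) (use nat in \<open>auto simp: o_def\<close>)
  have B: "(\<lambda>m::int. inverse ((1 + \<bar>real_of_int m\<bar>)\<^sup>2)) summable_on range (\<lambda>n. - int n)"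
    by (subst summable_on_reindex) (use nat in \<open>auto simp: o_def inj_on_def\<close>)
  have "m \<in> range int \<union> range (\<lambda>n. - int n)" for m
    by (cases m rule: int_cases2) auto
  then have "range int \<union> range (\<lambda>n. - int n) = UNIV" by blast
  then show ?thesis using summable_on_union [OF A B] by simp
qed

text \<open>The exponent provides a factor of at least
  \<open>(1 + \<bar>k $ j\<bar>)\<^sup>2\<close> for each coordinate, so a product of convergent
  one-dimensional series dominates.\<close>

lemma summable_on_inverse_wt:
  "(\<lambda>k :: int ^ 'n. inverse (wt k ^ (2 * CARD('n)))) summable_on UNIV"
proof (rule summable_on_comparison_test)
  show "(\<lambda>k :: int ^ 'n. \<Prod>j\<in>UNIV. inverse ((1 + \<bar>real_of_int (k $ j)\<bar>)\<^sup>2)) summable_on UNIV"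
    by (rule summable_on_prod_int [OF summable_on_inverse_square_int]) auto
  fix k :: "int ^ 'n"
  have "(\<Prod>j\<in>UNIV. (1 + \<bar>real_of_int (k $ j)\<bar>)\<^sup>2) \<le> (\<Prod>j\<in>(UNIV :: 'n set). (wt k)\<^sup>2)"
  proof (intro prod_mono conjI power_mono)
    fix j
    show "1 + \<bar>real_of_int (k $ j)\<bar> \<le> wt k" by (simp add: wt_def abs_nth_le_freq_abs)
  qed auto
  also have "\<dots> = wt k ^ (2 * CARD('n))" by (simp add: power_mult)
  finally show "inverse (wt k ^ (2 * CARD('n))) \<le> (\<Prod>j\<in>UNIV. inverse ((1 + \<bar>real_of_int (k $ j)\<bar>)\<^sup>2))"
    using prod_inversef [of "\<lambda>j. (1 + \<bar>real_of_int (k $ j)\<bar>)\<^sup>2" UNIV]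
      le_imp_inverse_le [of "\<Prod>j\<in>UNIV. (1 + \<bar>real_of_int (k $ j)\<bar>)\<^sup>2" "wt k ^ (2 * CARD('n))"]
    by (simp add: o_def prod_pos zero_less_power add_pos_nonneg)
qed (auto simp: less_imp_le)

lemma power_div_fact_le_exp:
  fixes x :: real
  assumes "0 \<le> x"
  shows "x ^ n / fact n \<le> exp x"
proof -
  have "(\<Sum>i\<in>{n}. x ^ i /\<^sub>R fact i) \<le> (\<Sum>i. x ^ i /\<^sub>R fact i)"
    using assms by (intro sum_le_suminf summable_exp_generic) auto
  then show ?thesis by (simp add: exp_def divide_inverse mult.commute)
qed

text \<open>The power is absorbed by one term of the exponential series at
  \<open>\<sigma> * (1 + x)\<close>; what remains is \<open>exp \<sigma>\<close>, at most
  \<open>exp 1\<close>. This is the exchange of width for polynomial growth in the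
  frequency.\<close>

lemma power_exp_le:
  fixes x \<sigma> :: real
  assumes "0 < \<sigma>" "\<sigma> \<le> 1" "0 \<le> x"
  shows "(1 + x) ^ N * exp (- \<sigma> * x) \<le> fact N * exp 1 / \<sigma> ^ N"
proof -
  have "(\<sigma> * (1 + x)) ^ N / fact N \<le> exp (\<sigma> * (1 + x))"
    using assms by (intro power_div_fact_le_exp) auto
  then have "(1 + x) ^ N \<le> fact N * exp (\<sigma> * (1 + x)) / \<sigma> ^ N"
    using assms by (simp add: power_mult_distrib pos_divide_le_eq pos_le_divide_eq mult_ac)
  then have "(1 + x) ^ N * exp (- \<sigma> * x) \<le> fact N * exp (\<sigma> * (1 + x)) / \<sigma> ^ N * exp (- \<sigma> * x)"
    by (intro mult_right_mono) auto
  also have "\<dots> = fact N * (exp (\<sigma> * (1 + x)) * exp (- \<sigma> * x)) / \<sigma> ^ N"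
    by simp
  also have "exp (\<sigma> * (1 + x)) * exp (- \<sigma> * x) = exp \<sigma>"
    unfolding exp_add [symmetric] by (simp add: algebra_simps)
  finally have "(1 + x) ^ N * exp (- \<sigma> * x) \<le> fact N * exp \<sigma> / \<sigma> ^ N" .
  also have "\<dots> \<le> fact N * exp 1 / \<sigma> ^ N"
    using assms by (intro divide_right_mono mult_left_mono) auto
  finally show ?thesis .
qed

text \<open>The type argument records the dimension, on which alone the constant depends.\<close>

definition wt_sum :: "'n::finite itself \<Rightarrow> real" where
  "wt_sum _ = infsum (\<lambda>k :: int ^ 'n. inverse (wt k ^ (2 * CARD('n)))) UNIV"

lemma wt_sum_nonneg: "0 \<le> wt_sum TYPE('n::finite)"
  unfolding wt_sum_def by (intro infsum_nonneg) (auto simp: less_imp_le)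

text \<open>The exponent is raised by \<open>2 * CARD('n)\<close> before \<open>power_exp_le\<close>
  is applied and lowered afterwards, so a summable weight is left over.\<close>

lemma wt_exp_bound:
  fixes k :: "int ^ 'n"
  assumes "0 < \<sigma>" "\<sigma> \<le> 1"
  shows "wt k ^ p * exp (- \<sigma> * freq_abs k)
    \<le> (fact (p + 2 * CARD('n)) * exp 1 / \<sigma> ^ (p + 2 * CARD('n))) * inverse (wt k ^ (2 * CARD('n)))"
proof -
  have "wt k ^ (p + 2 * CARD('n)) * exp (- \<sigma> * freq_abs k) \<le> fact (p + 2 * CARD('n)) * exp 1 / \<sigma> ^ (p + 2 * CARD('n))"
    unfolding wt_def using assms by (intro power_exp_le) auto
  then have "wt k ^ (p + 2 * CARD('n)) * exp (- \<sigma> * freq_abs k) * inverse (wt k ^ (2 * CARD('n)))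
      \<le> fact (p + 2 * CARD('n)) * exp 1 / \<sigma> ^ (p + 2 * CARD('n)) * inverse (wt k ^ (2 * CARD('n)))"
    by (intro mult_right_mono) (auto simp: less_imp_le)
  moreover have "wt k ^ (p + 2 * CARD('n)) * exp (- \<sigma> * freq_abs k) * inverse (wt k ^ (2 * CARD('n)))
      = wt k ^ p * exp (- \<sigma> * freq_abs k)"
  proof -
    have "wt k \<noteq> 0" using wt_pos [of k] by linarith
    then show ?thesis by (simp add: power_add)
  qed
  ultimately show ?thesis by (simp only:)
qed

lemma summable_on_wt_exp:
  assumes "\<sigma> > 0"
  shows "(\<lambda>k :: int ^ 'n. wt k ^ p * exp (- \<sigma> * freq_abs k)) summable_on UNIV"
proof (rule summable_on_comparison_test)
  define s where "s = min \<sigma> 1"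
  have s: "0 < s" "s \<le> 1" "s \<le> \<sigma>" using assms by (auto simp: s_def)
  show "(\<lambda>k :: int ^ 'n. (fact (p + 2 * CARD('n)) * exp 1 / s ^ (p + 2 * CARD('n))) * inverse (wt k ^ (2 * CARD('n)))) summable_on UNIV"
    by (intro summable_on_cmult_right summable_on_inverse_wt)
  fix k :: "int ^ 'n"
  have "wt k ^ p * exp (- \<sigma> * freq_abs k) \<le> wt k ^ p * exp (- s * freq_abs k)"
    using s by (intro mult_left_mono) (auto simp: mult_right_mono)
  also have "\<dots> \<le> (fact (p + 2 * CARD('n)) * exp 1 / s ^ (p + 2 * CARD('n))) * inverse (wt k ^ (2 * CARD('n)))"
    by (rule wt_exp_bound [OF s(1,2)])
  finally show "wt k ^ p * exp (- \<sigma> * freq_abs k)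
    \<le> (fact (p + 2 * CARD('n)) * exp 1 / s ^ (p + 2 * CARD('n))) * inverse (wt k ^ (2 * CARD('n)))" .
qed auto

lemma infsum_wt_exp_le:
  assumes "0 < \<sigma>" "\<sigma> \<le> 1"
  shows "infsum (\<lambda>k :: int ^ 'n. wt k ^ p * exp (- \<sigma> * freq_abs k)) UNIV
    \<le> (fact (p + 2 * CARD('n)) * exp 1 * wt_sum TYPE('n)) / \<sigma> ^ (p + 2 * CARD('n))"
proof -
  have "infsum (\<lambda>k :: int ^ 'n. wt k ^ p * exp (- \<sigma> * freq_abs k)) UNIV
    \<le> infsum (\<lambda>k :: int ^ 'n. (fact (p + 2 * CARD('n)) * exp 1 / \<sigma> ^ (p + 2 * CARD('n))) * inverse (wt k ^ (2 * CARD('n)))) UNIV"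
    by (intro infsum_mono summable_on_wt_exp assms summable_on_cmult_right summable_on_inverse_wt wt_exp_bound)
  also have "\<dots> = (fact (p + 2 * CARD('n)) * exp 1 / \<sigma> ^ (p + 2 * CARD('n))) * wt_sum TYPE('n)"
    unfolding wt_sum_def by (intro infsum_cmult_right summable_on_inverse_wt)
  finally show ?thesis by (simp add: mult_ac)
qed

subsection \<open>Trigonometric series\<close>

lemma has_sum_diff:
  fixes f g :: "'a \<Rightarrow> complex"
  assumes "(f has_sum a) A" "(g has_sum b) A"
  shows "((\<lambda>x. f x - g x) has_sum (a - b)) A"
  using has_sum_add [OF assms(1) has_sum_uminusI [OF assms(2)]] by simp

lemma has_sum_finite_sum:
  fixes f :: "'i \<Rightarrow> 'a \<Rightarrow> 'b::topological_comm_monoid_add"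
  assumes "\<And>i. i \<in> I \<Longrightarrow> (f i has_sum s i) A"
  shows "((\<lambda>x. \<Sum>i\<in>I. f i x) has_sum (\<Sum>i\<in>I. s i)) A"
  using assms by (induction I rule: infinite_finite_induct) (auto intro!: has_sum_add)

definition trig :: "(int ^ 'n \<Rightarrow> complex) \<Rightarrow> complex ^ 'n \<Rightarrow> complex" where
  "trig c \<theta> = infsum (\<lambda>k. c k * char_fun k \<theta>) UNIV"

lemma trig_term_bound:
  assumes c: "norm (c k) \<le> C * wt k ^ p * exp (- \<rho> * freq_abs k)" and \<sigma>: "\<And>j. \<bar>Im (\<theta> $ j)\<bar> \<le> \<sigma>"
  shows "norm (c k * char_fun k \<theta>) \<le> C * (wt k ^ p * exp (- (\<rho> - \<sigma>) * freq_abs k))"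
proof -
  have "norm (c k * char_fun k \<theta>) \<le> (C * wt k ^ p * exp (- \<rho> * freq_abs k)) * exp (\<sigma> * freq_abs k)"
    unfolding norm_mult using norm_char_fun_le [of \<theta> \<sigma> k, OF \<sigma>] c
    by (intro mult_mono) (auto intro: order_trans [OF norm_ge_zero])
  also have "\<dots> = C * (wt k ^ p * exp (- (\<rho> - \<sigma>) * freq_abs k))"
    by (simp add: exp_add [symmetric] algebra_simps)
  finally show ?thesis .
qed

lemma trig_abs_summable:
  fixes c :: "int ^ 'n \<Rightarrow> complex"
  assumes c: "\<And>k. norm (c k) \<le> C * wt k ^ p * exp (- \<rho> * freq_abs k)"
    and \<sigma>: "\<And>j. \<bar>Im (\<theta> $ j)\<bar> \<le> \<sigma>" and "\<sigma> < \<rho>"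
  shows "(\<lambda>k. norm (c k * char_fun k \<theta>)) summable_on UNIV"
  by (rule Infinite_Sum.abs_summable_on_comparison_test' [OF _ trig_term_bound [OF c \<sigma>]])
    (intro summable_on_cmult_right summable_on_wt_exp, use assms(3) in simp)

lemma ostrip_Max:
  fixes \<theta> :: "complex ^ 'n"
  assumes "\<theta> \<in> ostrip \<rho>"
  obtains \<sigma> where "\<And>j. \<bar>Im (\<theta> $ j)\<bar> \<le> \<sigma>" "\<sigma> < \<rho>"
proof
  show "\<bar>Im (\<theta> $ j)\<bar> \<le> Max (range (\<lambda>j. \<bar>Im (\<theta> $ j)\<bar>))" for j by (intro Max_ge) auto
  show "Max (range (\<lambda>j. \<bar>Im (\<theta> $ j)\<bar>)) < \<rho>"
    using assms by (subst Max_less_iff) (auto simp: ostrip_def)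
qed

lemma trig_has_sum:
  assumes c: "\<And>k. norm (c k) \<le> C * wt k ^ p * exp (- \<rho> * freq_abs k)" and \<theta>: "\<theta> \<in> ostrip \<rho>"
  shows "((\<lambda>k. c k * char_fun k \<theta>) has_sum trig c \<theta>) UNIV"
proof -
  obtain \<sigma> where "\<And>j. \<bar>Im (\<theta> $ j)\<bar> \<le> \<sigma>" "\<sigma> < \<rho>" using ostrip_Max [OF \<theta>] by blast
  from abs_summable_summable [OF trig_abs_summable [OF c this]] show ?thesis
    unfolding trig_def by (rule has_sum_infsum)
qed

text \<open>On the smaller strip a character grows at most like
  \<open>exp ((\<rho> - \<sigma>) * freq_abs k)\<close>, which leaves decay at rate
  \<open>\<sigma>\<close> to pay for the polynomial factor.\<close>

lemma trig_bound:
  fixes c :: "int ^ 'n \<Rightarrow> complex"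
  assumes c: "\<And>k. norm (c k) \<le> C * wt k ^ p * exp (- \<rho> * freq_abs k)"
    and \<sigma>: "0 < \<sigma>" "\<sigma> \<le> 1" and \<theta>: "\<theta> \<in> ostrip (\<rho> - \<sigma>)"
  shows "norm (trig c \<theta>) \<le> C * ((fact (p + 2 * CARD('n)) * exp 1 * wt_sum TYPE('n)) / \<sigma> ^ (p + 2 * CARD('n)))"
proof -
  have im: "\<bar>Im (\<theta> $ j)\<bar> \<le> \<rho> - \<sigma>" for j using \<theta> by (auto simp: ostrip_def less_imp_le)
  have C: "0 \<le> C"
    using order_trans [OF norm_ge_zero c [of 0]] by (simp add: wt_def zero_le_mult_iff freq_abs_eq)
  have \<theta>': "\<theta> \<in> ostrip \<rho>" using \<theta> \<sigma> ostrip_mono [of "\<rho> - \<sigma>" \<rho>] by auto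
  have summ: "(\<lambda>k. norm (c k * char_fun k \<theta>)) summable_on UNIV"
    by (rule trig_abs_summable [OF c im]) (use \<sigma> in auto)
  have "norm (trig c \<theta>) \<le> infsum (\<lambda>k. norm (c k * char_fun k \<theta>)) UNIV"
    unfolding trig_def by (rule norm_infsum_bound [OF summ])
  also have "\<dots> \<le> infsum (\<lambda>k :: int ^ 'n. C * (wt k ^ p * exp (- (\<rho> - (\<rho> - \<sigma>)) * freq_abs k))) UNIV"
  proof (rule infsum_mono [OF summ])
    show "(\<lambda>k :: int ^ 'n. C * (wt k ^ p * exp (- (\<rho> - (\<rho> - \<sigma>)) * freq_abs k))) summable_on UNIV"
      by (intro summable_on_cmult_right summable_on_wt_exp) (use \<sigma> in simp)
  qed (rule trig_term_bound [OF c im])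
  also have "\<dots> = C * infsum (\<lambda>k :: int ^ 'n. wt k ^ p * exp (- \<sigma> * freq_abs k)) UNIV"
    using summable_on_wt_exp [OF \<sigma>(1), of p] by (subst infsum_cmult_right) auto
  also have "\<dots> \<le> C * ((fact (p + 2 * CARD('n)) * exp 1 * wt_sum TYPE('n)) / \<sigma> ^ (p + 2 * CARD('n)))"
    by (intro mult_left_mono C infsum_wt_exp_le \<sigma>)
  finally show ?thesis .
qed

lemma char_fun_add: "char_fun k (\<theta> + h) = char_fun k \<theta> * char_fun k h"
  by (simp add: char_fun_def exp_add [symmetric] algebra_simps sum.distrib)

lemma norm_dot_le: "norm (\<Sum>j\<in>UNIV. of_int (k $ j) * (h :: complex ^ 'n) $ j) \<le> freq_abs k * norm h"
proof -
  have "norm (\<Sum>j\<in>UNIV. of_int (k $ j) * h $ j) \<le> (\<Sum>j\<in>UNIV. \<bar>real_of_int (k $ j)\<bar> * norm h)"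
    by (rule sum_norm_le) (auto simp: norm_mult intro!: mult_left_mono Finite_Cartesian_Product.norm_nth_le)
  then show ?thesis by (simp add: freq_abs_eq sum_distrib_right)
qed

lemma trig_derivative_coeff_bound:
  fixes c :: "int ^ 'n \<Rightarrow> complex"
  assumes "norm (c k) \<le> C * wt k ^ p * exp (- \<rho> * freq_abs k)"
  shows "norm (\<i> * of_int (k $ j) * c k) \<le> C * wt k ^ Suc p * exp (- \<rho> * freq_abs k)"
proof -
  have "\<bar>real_of_int (k $ j)\<bar> \<le> wt k"
    using abs_nth_le_freq_abs [of k j] by (simp add: wt_def)
  then have "norm (\<i> * of_int (k $ j) * c k) \<le> wt k * (C * wt k ^ p * exp (- \<rho> * freq_abs k))"
    unfolding norm_mult by (intro mult_mono assms) auto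
  then show ?thesis by (simp add: mult_ac)
qed

text \<open>The second-order remainder of \<open>exp\<close> is bounded term by term by a summable
  multiple of \<open>(norm h)\<^sup>2\<close>, so the joint derivative comes straight from the
  series.\<close>

lemma trig_has_derivative:
  fixes c :: "int ^ 'n \<Rightarrow> complex"
  assumes c: "\<And>k. norm (c k) \<le> C * wt k ^ p * exp (- \<rho> * freq_abs k)" and \<theta>: "\<theta> \<in> ostrip \<rho>"
  shows "(trig c has_derivative (\<lambda>h. \<Sum>j\<in>UNIV. trig (\<lambda>k. \<i> * of_int (k $ j) * c k) \<theta> * h $ j)) (at \<theta>)"
proof -
  obtain \<sigma> where \<sigma>: "\<And>j. \<bar>Im (\<theta> $ j)\<bar> \<le> \<sigma>" "\<sigma> < \<rho>" using ostrip_Max [OF \<theta>] by blast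
  \<comment> \<open>Half of the available decay compensates the growth of the characters over
    \<open>norm h < r\<close>; the other half keeps the remainder summable.\<close>
  define r where "r = (\<rho> - \<sigma>) / 2"
  have r: "r > 0" using \<sigma> by (simp add: r_def)
  have C: "0 \<le> C"
    using order_trans [OF norm_ge_zero c [of 0]] by (simp add: wt_def zero_le_mult_iff freq_abs_eq)
  define L where "L k h = \<i> * (\<Sum>j\<in>UNIV. of_int (k $ j) * h $ j)" for k and h :: "complex ^ 'n"
  define D where "D h = (\<Sum>j\<in>UNIV. trig (\<lambda>k. \<i> * of_int (k $ j) * c k) \<theta> * h $ j)" for h
  have cj: "norm (\<i> * of_int (k $ j) * c k) \<le> C * wt k ^ Suc p * exp (- \<rho> * freq_abs k)" for k j by (rule trig_derivative_coeff_bound [OF c])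
  have Dsum: "((\<lambda>k. c k * char_fun k \<theta> * L k h) has_sum D h) UNIV" for h
  proof -
    have "((\<lambda>k. \<Sum>j\<in>UNIV. (\<i> * of_int (k $ j) * c k) * char_fun k \<theta> * h $ j) has_sum D h) UNIV"
      unfolding D_def by (intro has_sum_finite_sum has_sum_cmult_left trig_has_sum [OF cj \<theta>])
    then show ?thesis
      by (simp add: L_def sum_distrib_left mult_ac)
  qed
  define M where "M = infsum (\<lambda>k :: int ^ 'n. C * (wt k ^ (p + 2) * exp (- r * freq_abs k))) UNIV"
  have Msum: "(\<lambda>k :: int ^ 'n. C * (wt k ^ (p + 2) * exp (- r * freq_abs k))) summable_on UNIV"
    by (intro summable_on_cmult_right summable_on_wt_exp r)
  have M0: "0 \<le> M" unfolding M_def using C by (intro infsum_nonneg) auto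
  have est: "norm (trig c (\<theta> + h) - trig c \<theta> - D h) \<le> M * (norm h)\<^sup>2" if h: "norm h < r" for h
  proof -
    have \<theta>h: "\<theta> + h \<in> ostrip \<rho>"
    proof -
      have "\<bar>Im ((\<theta> + h) $ j)\<bar> < \<rho>" for j
      proof -
        have "\<bar>Im (h $ j)\<bar> \<le> norm h"
          by (meson Finite_Cartesian_Product.norm_nth_le abs_Im_le_cmod order_trans)
        then show ?thesis using \<sigma>(1) [of j] h \<sigma>(2) by (auto simp: r_def)
      qed
      then show ?thesis by (simp add: ostrip_def)
    qed
    have hs: "((\<lambda>k. c k * char_fun k (\<theta> + h) - c k * char_fun k \<theta> - c k * char_fun k \<theta> * L k h)
        has_sum (trig c (\<theta> + h) - trig c \<theta> - D h)) UNIV"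
      by (intro has_sum_diff trig_has_sum [OF c] \<theta>h \<theta> Dsum)
    have tb: "norm (c k * char_fun k (\<theta> + h) - c k * char_fun k \<theta> - c k * char_fun k \<theta> * L k h)
        \<le> C * (wt k ^ (p + 2) * exp (- r * freq_abs k)) * (norm h)\<^sup>2" for k
    proof -
      have Lb: "norm (L k h) \<le> freq_abs k * norm h"
        using norm_dot_le [of k h] by (simp add: L_def norm_mult)
      have "norm (exp (L k h) - 1 - L k h) \<le> exp \<bar>Re (L k h)\<bar> * (norm (L k h))\<^sup>2"
        using Taylor_exp [of "L k h" 1] by (simp add: algebra_simps numeral_2_eq_2)
      also have "\<dots> \<le> exp (r * freq_abs k) * (wt k * norm h)\<^sup>2"
      proof (intro mult_mono power_mono)
        have "\<bar>Re (L k h)\<bar> \<le> freq_abs k * norm h" using Lb abs_Re_le_cmod order_trans by blast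
        also have "\<dots> \<le> freq_abs k * r" using h by (intro mult_left_mono) auto
        finally show "exp \<bar>Re (L k h)\<bar> \<le> exp (r * freq_abs k)" by (simp add: mult.commute)
        show "norm (L k h) \<le> wt k * norm h"
          using Lb by (rule order_trans) (auto intro!: mult_right_mono simp: wt_def)
      qed auto
      finally have e: "norm (exp (L k h) - 1 - L k h) \<le> exp (r * freq_abs k) * (wt k * norm h)\<^sup>2" .
      have "c k * char_fun k (\<theta> + h) - c k * char_fun k \<theta> - c k * char_fun k \<theta> * L k h
          = (c k * char_fun k \<theta>) * (exp (L k h) - 1 - L k h)"
        unfolding char_fun_add by (simp add: char_fun_def [of k h] L_def algebra_simps)
      moreover have "norm ((c k * char_fun k \<theta>) * (exp (L k h) - 1 - L k h))
          \<le> (C * (wt k ^ p * exp (- (\<rho> - \<sigma>) * freq_abs k))) * (exp (r * freq_abs k) * (wt k * norm h)\<^sup>2)"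
        unfolding norm_mult [of "c k * char_fun k \<theta>"]
        by (rule mult_mono [OF trig_term_bound [of c k C p \<rho> \<theta> \<sigma>, OF c \<sigma>(1)] e]) (use C in auto)
      ultimately have "norm (c k * char_fun k (\<theta> + h) - c k * char_fun k \<theta> - c k * char_fun k \<theta> * L k h)
          \<le> (C * (wt k ^ p * exp (- (\<rho> - \<sigma>) * freq_abs k))) * (exp (r * freq_abs k) * (wt k * norm h)\<^sup>2)"
        by (simp only:)
      also have "\<dots> = C * (wt k ^ (p + 2) * (exp (- (\<rho> - \<sigma>) * freq_abs k) * exp (r * freq_abs k))) * (norm h)\<^sup>2"
        by (simp add: power_add power_mult_distrib power2_eq_square mult_ac)
      also have "exp (- (\<rho> - \<sigma>) * freq_abs k) * exp (r * freq_abs k) = exp (- r * freq_abs k)"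
      proof -
        have "- (\<rho> - \<sigma>) * freq_abs k + r * freq_abs k = - r * freq_abs k"
          by (simp add: r_def field_simps)
        then show ?thesis by (simp add: exp_add [symmetric])
      qed
      finally show ?thesis .
    qed
    have "norm (trig c (\<theta> + h) - trig c \<theta> - D h) \<le> M * (norm h)\<^sup>2"
      by (rule norm_infsum_le [OF hs _ tb])
        (unfold M_def, intro has_sum_cmult_left has_sum_infsum Msum)
    then show ?thesis .
  qed
  have lin: "bounded_linear D"
    unfolding D_def
    by (intro bounded_linear_sum bounded_linear_const_mult bounded_linear_vec_nth)
  have "((\<lambda>h. norm (trig c (\<theta> + h) - trig c \<theta> - D h) / norm h) \<longlongrightarrow> 0) (at 0)"
  proof (rule Lim_null_comparison)
    show "\<forall>\<^sub>F h in at 0. norm (norm (trig c (\<theta> + h) - trig c \<theta> - D h) / norm h) \<le> M * norm h"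
      unfolding eventually_at
    proof (intro exI [of _ r] conjI r ballI impI)
      fix h :: "complex ^ 'n" assume "h \<noteq> 0 \<and> dist h 0 < r"
      then show "norm (norm (trig c (\<theta> + h) - trig c \<theta> - D h) / norm h) \<le> M * norm h"
        using est [of h] by (simp add: divide_le_eq power2_eq_square mult.assoc)
    qed
    have "((\<lambda>h :: complex ^ 'n. M * norm h) \<longlongrightarrow> M * norm (0 :: complex ^ 'n)) (at 0)"
      by (intro tendsto_intros)
    then show "((\<lambda>h :: complex ^ 'n. M * norm h) \<longlongrightarrow> 0) (at 0)" by simp
  qed
  then show ?thesis
    using lin unfolding has_derivative_at D_def [abs_def] by blast
qed

section \<open>The constant coefficient equation along the flow\<close>

lemma bounded_linear_axis: "bounded_linear (axis j :: complex \<Rightarrow> complex ^ 'n)"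
proof (rule bounded_linear_intro [where K = 1])
  fix x :: complex
  have "norm (axis j x :: complex ^ 'n) \<le> (\<Sum>i\<in>UNIV. norm ((axis j x :: complex ^ 'n) $ i))"
    unfolding norm_vec_def by (rule L2_set_le_sum) auto
  also have "\<dots> = norm x" by (subst sum.remove [of _ j]) (auto simp: axis_def intro!: sum.neutral)
  finally show "norm (axis j x :: complex ^ 'n) \<le> norm x * 1" by simp
qed (simp_all add: vec_eq_iff axis_def)

lemma vec_upd_conv_axis:
  fixes \<theta> :: "complex ^ 'n"
  shows "vec_upd \<theta> j (\<theta> $ j + z) = \<theta> + axis j z"
  by (simp add: vec_eq_iff axis_def)

lemma slice_field_differentiable:
  fixes F :: "complex ^ 'n \<Rightarrow> complex"
  assumes "(F has_derivative (\<lambda>h. \<Sum>j\<in>UNIV. c j * h $ j)) (at (vec_upd \<theta> j z))"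
  shows "(\<lambda>z. F (vec_upd \<theta> j z)) field_differentiable at z"
proof -
  have "((\<lambda>z. vec_upd \<theta> j 0 + axis j z) has_derivative axis j) (at z)"
    by (intro has_derivative_add_const [OF bounded_linear_imp_has_derivative [OF bounded_linear_axis], THEN has_derivative_eq_rhs]
        has_derivative_eq_rhs [OF has_derivative_add [OF has_derivative_const bounded_linear_imp_has_derivative [OF bounded_linear_axis]]]) auto
  moreover have "vec_upd \<theta> j 0 + axis j z = vec_upd \<theta> j z" for z
    by (simp add: vec_eq_iff axis_def)
  ultimately have "((\<lambda>z. vec_upd \<theta> j z) has_derivative axis j) (at z)" by simp
  from has_derivative_compose [OF this assms]
  have "((\<lambda>z. F (vec_upd \<theta> j z)) has_derivative (\<lambda>h. \<Sum>i\<in>UNIV. c i * axis j h $ i)) (at z)" .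
  moreover have "(\<lambda>h. \<Sum>i\<in>UNIV. c i * axis j h $ i) = (*) (c j)"
    by (rule ext, subst sum.remove [of _ j]) (auto simp: axis_def intro!: sum.neutral)
  ultimately show ?thesis
    unfolding field_differentiable_def has_field_derivative_def by auto
qed

lemma hol_per_of_derivative:
  fixes F :: "complex ^ 'n \<Rightarrow> complex"
  assumes d: "\<And>\<theta>. \<theta> \<in> ostrip \<rho> \<Longrightarrow> \<exists>c. (F has_derivative (\<lambda>h. \<Sum>j\<in>UNIV. c j * h $ j)) (at \<theta>)"
    and per: "\<And>\<theta> j. \<theta> \<in> ostrip \<rho> \<Longrightarrow> F (\<theta> + axis j (2 * pi)) = F \<theta>"
  shows "hol_per \<rho> F"
  unfolding hol_per_def
proof (intro conjI ballI allI)
  show "continuous_on (ostrip \<rho>) F"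
  proof (intro continuous_at_imp_continuous_on ballI)
    fix \<theta> :: "complex ^ 'n" assume "\<theta> \<in> ostrip \<rho>"
    from d [OF this] show "isCont F \<theta>" by (elim exE) (rule has_derivative_continuous)
  qed
  fix \<theta> :: "complex ^ 'n" and j assume \<theta>: "\<theta> \<in> ostrip \<rho>"
  show "(\<lambda>z. F (vec_upd \<theta> j z)) holomorphic_on line_strip \<rho>"
    unfolding holomorphic_on_def
  proof
    fix z assume "z \<in> line_strip \<rho>"
    from d [OF vec_upd_in_ostrip [OF \<theta> this, of j]]
    obtain c where "(F has_derivative (\<lambda>h. \<Sum>j\<in>UNIV. c j * h $ j)) (at (vec_upd \<theta> j z))"
      by (elim exE)
    from slice_field_differentiable [OF this]
    show "(\<lambda>z. F (vec_upd \<theta> j z)) field_differentiable at z within line_strip \<rho>"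
      by (rule field_differentiable_at_within)
  qed
  show "F (vec_upd \<theta> j (\<theta> $ j + 2 * pi)) = F \<theta>"
    using per [OF \<theta>] by (simp add: vec_upd_conv_axis)
qed

lemma char_fun_periodic: "char_fun k (\<theta> + axis j (2 * pi)) = char_fun k \<theta>"
proof -
  have "(\<Sum>i\<in>UNIV. of_int (k $ i) * (axis j (2 * complex_of_real pi)) $ i) = of_int (k $ j) * (2 * pi)"
    by (subst sum.remove [of _ j]) (auto simp: axis_def intro!: sum.neutral)
  then have "char_fun k (axis j (2 * pi)) = 1"
    using exp_int_2pi [of "k $ j"] by (simp add: char_fun_def mult.assoc)
  then show ?thesis by (simp add: char_fun_add)
qed

lemma hol_per_trig:
  assumes c: "\<And>k. norm (c k) \<le> C * wt k ^ p * exp (- \<rho> * freq_abs k)"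
  shows "hol_per \<rho> (trig c)"
proof (rule hol_per_of_derivative)
  show "\<exists>d. (trig c has_derivative (\<lambda>h. \<Sum>j\<in>UNIV. d j * h $ j)) (at \<theta>)" if "\<theta> \<in> ostrip \<rho>" for \<theta>
    by (rule exI [where x = "\<lambda>j. trig (\<lambda>k. \<i> * of_int (k $ j) * c k) \<theta>"])
      (rule trig_has_derivative [OF c that])
  show "trig c (\<theta> + axis j (2 * pi)) = trig c \<theta>" for \<theta> j
    using char_fun_periodic [of _ \<theta> j] by (simp add: trig_def)
qed

lemma ostrip_subset_strip: "ostrip \<rho> \<subseteq> strip \<rho>"
  by (auto simp: ostrip_def strip_def less_imp_le)

lemma strip_subset_ostrip: "\<rho>' < \<rho> \<Longrightarrow> strip \<rho>' \<subseteq> ostrip \<rho>"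
  by (auto simp: ostrip_def strip_def intro: le_less_trans)

lemma hol_per_of_analytic:
  fixes F :: "complex ^ 'n \<Rightarrow> complex"
  assumes F: "analytic_nvar_on F (strip \<rho>)"
    and per: "\<forall>\<theta>\<in>strip \<rho>. \<forall>j. F (\<theta> + axis j (2 * complex_of_real pi)) = F \<theta>"
  shows "hol_per \<rho> F"
proof (rule hol_per_of_derivative)
  fix \<theta> :: "complex ^ 'n" assume "\<theta> \<in> ostrip \<rho>"
  then have \<theta>: "\<theta> \<in> strip \<rho>" using ostrip_subset_strip by blast
  then obtain c :: "complex ^ 'n" where "(F has_derivative (\<lambda>h. \<Sum>j\<in>UNIV. c $ j * h $ j)) (at \<theta>)"
    using F unfolding analytic_nvar_on_def by blast
  then show "\<exists>c. (F has_derivative (\<lambda>h. \<Sum>j\<in>UNIV. c j * h $ j)) (at \<theta>)" by blast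
  show "F (\<theta> + axis j (2 * pi)) = F \<theta>" for j using per \<theta> by simp
qed

lemma hol_per_eq_trig:
  assumes "hol_per \<rho> f" "\<And>\<theta>. \<theta> \<in> ostrip \<rho> \<Longrightarrow> norm (f \<theta>) \<le> B" "\<theta> \<in> ostrip \<rho>"
  shows "trig (fourier f) \<theta> = f \<theta>"
  unfolding trig_def by (rule infsumI) (rule fourier_has_sum [OF assms])

text \<open>The function agrees with its Fourier series, and that series is jointly complex
  differentiable.\<close>

lemma analytic_of_hol_per:
  fixes f :: "complex ^ 'n \<Rightarrow> complex"
  assumes f: "hol_per \<rho> f" and \<rho>: "0 \<le> \<rho>'" "\<rho>' < \<rho>"
  shows "analytic_nvar_on f (strip \<rho>')"
proof -
  \<comment> \<open>An intermediate width: below \<open>\<rho>\<close> the function is bounded, and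
    above \<open>\<rho>'\<close> the open strip is a neighbourhood of the closed one.\<close>
  define s where "s = (\<rho>' + \<rho>) / 2"
  have s: "0 < s" "\<rho>' < s" "s < \<rho>" using \<rho> by (auto simp: s_def)
  obtain B where B: "\<And>\<theta>. \<theta> \<in> ostrip s \<Longrightarrow> norm (f \<theta>) \<le> B" using hol_per_bounded [OF f s(3)] by blast
  have fs: "hol_per s f" using f s by (auto intro: hol_per_mono)
  have c: "norm (fourier f k) \<le> B * wt k ^ 0 * exp (- s * freq_abs k)" for k
    using fourier_bound [OF fs s(1) B] by simp
  have "\<exists>c :: complex ^ 'n. (f has_derivative (\<lambda>h. \<Sum>j\<in>UNIV. c $ j * h $ j)) (at \<theta>)" if \<theta>: "\<theta> \<in> ostrip s" for \<theta>
  proof -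
    have "(f has_derivative (\<lambda>h. \<Sum>j\<in>UNIV. trig (\<lambda>k. \<i> * of_int (k $ j) * fourier f k) \<theta> * h $ j)) (at \<theta>)"
      by (rule has_derivative_transform_within_open [OF trig_has_derivative [OF c \<theta>] open_ostrip \<theta>])
        (rule hol_per_eq_trig [OF fs B])
    then show ?thesis
      by (intro exI [of _ "\<chi> j. trig (\<lambda>k. \<i> * of_int (k $ j) * fourier f k) \<theta>"]) simp
  qed
  then show ?thesis
    unfolding analytic_nvar_on_def using open_ostrip strip_subset_ostrip [OF s(2)] by blast
qed

section \<open>Derivatives along the linear flow on the torus\<close>

definition line :: "real ^ 'n \<Rightarrow> real \<Rightarrow> complex ^ 'n" where
  "line \<omega> t = (\<chi> j. complex_of_real (\<omega> $ j * t))"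

lemma line_nth [simp]: "line \<omega> t $ j = complex_of_real (\<omega> $ j * t)"
  by (simp add: line_def)

lemma line_in_ostrip: "\<rho> > 0 \<Longrightarrow> line \<omega> t \<in> ostrip \<rho>"
  by (simp add: ostrip_def)

lemma analytic_quasi_periodic_of_hol_per:
  assumes f: "hol_per \<rho> f" and \<rho>: "0 \<le> \<rho>'" "\<rho>' < \<rho>" and g: "\<And>t. complex_of_real (g t) = f (line \<omega> t)"
  shows "analytic_quasi_periodic \<omega> \<rho>' g"
  unfolding analytic_quasi_periodic_def
proof (intro exI conjI ballI allI)
  show "analytic_nvar_on f (strip \<rho>')" by (rule analytic_of_hol_per [OF f \<rho>])
  show "f (\<theta> + axis j (2 * complex_of_real pi)) = f \<theta>" if "\<theta> \<in> strip \<rho>'" for \<theta> j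
    using hol_perD(3) [OF f, of \<theta> j] that strip_subset_ostrip [OF \<rho>(2)] by (auto simp: vec_upd_conv_axis)
  show "complex_of_real (g t) = f (\<chi> j. complex_of_real (\<omega> $ j * t))" for t
    using g by (simp add: line_def)
qed

definition dotp :: "int ^ 'n \<Rightarrow> real ^ 'n \<Rightarrow> real" where
  "dotp k \<omega> = (\<Sum>j\<in>UNIV. real_of_int (k $ j) * \<omega> $ j)"

text \<open>The chain rule combines the partial derivatives, coefficient by coefficient, into the
  single factor \<open>\<i> * dotp k \<omega>\<close>.\<close>

lemma trig_line_derivative:
  fixes c :: "int ^ 'n \<Rightarrow> complex"
  assumes c: "\<And>k. norm (c k) \<le> C * wt k ^ p * exp (- \<rho> * freq_abs k)" and \<rho>: "\<rho> > 0"
  shows "((\<lambda>t. trig c (line \<omega> t)) has_vector_derivative trig (\<lambda>k. \<i> * dotp k \<omega> * c k) (line \<omega> t)) (at t)"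
proof -
  let ?\<theta> = "line \<omega> t"
  have \<theta>: "?\<theta> \<in> ostrip \<rho>" by (rule line_in_ostrip [OF \<rho>])
  have l: "(line \<omega> has_derivative (\<lambda>h. line \<omega> h)) (at t)"
  proof (rule bounded_linear_imp_has_derivative, rule bounded_linear_intro [where K = "norm (line \<omega> 1)"])
    have "line \<omega> r = r *\<^sub>R line \<omega> 1" for r
      by (simp add: vec_eq_iff complex_eq_iff)
    then show "norm (line \<omega> x) \<le> norm x * norm (line \<omega> 1)" for x
      by (metis norm_scaleR order_refl real_norm_def)
  qed (simp_all add: vec_eq_iff complex_eq_iff algebra_simps)
  have cj: "norm (\<i> * of_int (k $ j) * c k) \<le> C * wt k ^ Suc p * exp (- \<rho> * freq_abs k)" for k j by (rule trig_derivative_coeff_bound [OF c])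
  let ?D = "\<Sum>j\<in>UNIV. trig (\<lambda>k. \<i> * of_int (k $ j) * c k) ?\<theta> * of_real (\<omega> $ j)"
  have "((\<lambda>k. \<Sum>j\<in>UNIV. (\<i> * of_int (k $ j) * c k) * char_fun k ?\<theta> * of_real (\<omega> $ j)) has_sum ?D) UNIV"
    by (intro has_sum_finite_sum has_sum_cmult_left trig_has_sum [OF cj \<theta>])
  then have "((\<lambda>k. (\<i> * dotp k \<omega> * c k) * char_fun k ?\<theta>) has_sum ?D) UNIV"
    by (simp add: dotp_def sum_distrib_left sum_distrib_right mult_ac)
  then have D: "trig (\<lambda>k. \<i> * dotp k \<omega> * c k) ?\<theta> = ?D"
    unfolding trig_def by (rule infsumI)
  have "((\<lambda>t. trig c (line \<omega> t)) has_derivative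
      (\<lambda>h. \<Sum>j\<in>UNIV. trig (\<lambda>k. \<i> * of_int (k $ j) * c k) ?\<theta> * line \<omega> h $ j)) (at t)"
    by (rule has_derivative_compose [OF l trig_has_derivative [OF c \<theta>]])
  then show ?thesis
    unfolding has_vector_derivative_def D
    by (simp add: scaleR_conv_of_real sum_distrib_left mult_ac)
qed

text \<open>Since \<open>inverse 0 = 0\<close>, the zero mode of \<open>f\<close> is dropped when \<open>\<nu> = 0\<close>.\<close>

definition sol :: "real ^ 'n \<Rightarrow> complex \<Rightarrow> (complex ^ 'n \<Rightarrow> complex) \<Rightarrow> complex ^ 'n \<Rightarrow> complex" where
  "sol \<omega> \<nu> f = trig (\<lambda>k. fourier f k * inverse (\<i> * dotp k \<omega> + \<nu>))"

lemma sol_coeff_bound: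
  assumes f: "hol_per \<rho> f" "\<rho> > 0" "\<And>\<theta>. \<theta> \<in> ostrip \<rho> \<Longrightarrow> norm (f \<theta>) \<le> B"
    and K: "\<And>k. norm (inverse (\<i> * dotp k \<omega> + \<nu>)) \<le> K * wt k ^ p"
  shows "norm (fourier f k * inverse (\<i> * dotp k \<omega> + \<nu>)) \<le> (B * K) * wt k ^ p * exp (- \<rho> * freq_abs k)"
proof -
  have "norm (fourier f k * inverse (\<i> * dotp k \<omega> + \<nu>)) \<le> (B * exp (- \<rho> * freq_abs k)) * (K * wt k ^ p)"
    unfolding norm_mult using fourier_bound [OF f] K by (intro mult_mono) (auto intro: order_trans [OF norm_ge_zero])
  then show ?thesis by (simp add: mult_ac)
qed

text \<open>Serves two purposes. With \<open>\<nu> = 2 * \<mu>\<close> it solves the linearised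
  equation, where no divisor vanishes; with \<open>\<nu> = 0\<close> it produces primitives along
  the flow, where only mode 0 has divisor 0 and the mean of \<open>f\<close> has to be
  subtracted.\<close>

lemma sol_flow_aux:
  assumes f: "hol_per \<rho> f" "\<rho> > 0" "\<And>\<theta>. \<theta> \<in> ostrip \<rho> \<Longrightarrow> norm (f \<theta>) \<le> B"
    and K: "\<And>k. norm (inverse (\<i> * dotp k \<omega> + \<nu>)) \<le> K * wt k ^ p"
    and res: "\<And>k. \<i> * dotp k \<omega> + \<nu> = 0 \<Longrightarrow> k = 0 \<and> \<nu> = 0"
  shows "((\<lambda>t. sol \<omega> \<nu> f (line \<omega> t)) has_vector_derivative
    f (line \<omega> t) - \<nu> * sol \<omega> \<nu> f (line \<omega> t) - (if \<nu> = 0 then fourier f 0 else 0)) (at t)"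
proof -
  let ?\<theta> = "line \<omega> t" and ?c = "\<lambda>k. fourier f k * inverse (\<i> * dotp k \<omega> + \<nu>)"
  have \<theta>: "?\<theta> \<in> ostrip \<rho>" by (rule line_in_ostrip [OF f(2)])
  note cb = sol_coeff_bound [OF f K]
  have s1: "((\<lambda>k. fourier f k * char_fun k ?\<theta>) has_sum f ?\<theta>) UNIV"
    by (rule fourier_has_sum [OF f(1,3) \<theta>])
  have s2: "((\<lambda>k. \<nu> * (?c k * char_fun k ?\<theta>)) has_sum \<nu> * sol \<omega> \<nu> f ?\<theta>) UNIV"
    unfolding sol_def by (intro has_sum_cmult_right trig_has_sum [OF cb \<theta>])
  have s3: "((\<lambda>k. if k = 0 then (if \<nu> = 0 then fourier f 0 else 0) else 0) has_sum (if \<nu> = 0 then fourier f 0 else 0)) UNIV"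
    by (rule has_sum_finite_neutralI [of "{0}"]) auto
  have eq: "fourier f k * char_fun k ?\<theta> - \<nu> * (?c k * char_fun k ?\<theta>)
      - (if k = 0 then (if \<nu> = 0 then fourier f 0 else 0) else 0) = (\<i> * dotp k \<omega> * ?c k) * char_fun k ?\<theta>" for k
  proof (cases "\<i> * dotp k \<omega> + \<nu> = 0")
    case True
    then have "k = 0" "\<nu> = 0" using res by auto
    then show ?thesis by (simp add: char_fun_def dotp_def)
  next
    case False
    then have "fourier f k = (\<i> * dotp k \<omega> + \<nu>) * ?c k" by simp
    moreover have "(if k = 0 then (if \<nu> = 0 then fourier f 0 else 0) else 0) = 0"
      using False by (auto simp: dotp_def)
    moreover have "F * X - \<nu> * (C * X) - Z = (\<i> * dotp k \<omega> * C) * X"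
      if "F = (\<i> * dotp k \<omega> + \<nu>) * C" "Z = 0" for F X C Z
      using that by (simp add: algebra_simps)
    ultimately show ?thesis by blast
  qed
  have "((\<lambda>k. (\<i> * dotp k \<omega> * ?c k) * char_fun k ?\<theta>) has_sum
      (f ?\<theta> - \<nu> * sol \<omega> \<nu> f ?\<theta> - (if \<nu> = 0 then fourier f 0 else 0))) UNIV"
    using has_sum_diff [OF has_sum_diff [OF s1 s2] s3] by (simp only: eq)
  then have "trig (\<lambda>k. \<i> * dotp k \<omega> * ?c k) ?\<theta> = f ?\<theta> - \<nu> * sol \<omega> \<nu> f ?\<theta> - (if \<nu> = 0 then fourier f 0 else 0)"
    unfolding trig_def by (rule infsumI)
  then show ?thesis
    using trig_line_derivative [OF cb f(2), of \<omega> t] by (simp add: sol_def)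
qed

text \<open>One constant bounds both the supremum and the Lipschitz constant in the parameter.
  \<open>X\<close> may be any set, since the parameters that survive an exclusion need not form an
  interval, and difference quotients take the place of derivatives.\<close>

definition bnd :: "real set \<Rightarrow> real \<Rightarrow> real \<Rightarrow> (real \<Rightarrow> complex ^ 'n \<Rightarrow> complex) \<Rightarrow> bool" where
  "bnd X \<rho> B f \<longleftrightarrow> (\<forall>x\<in>X. hol_per \<rho> (f x)) \<and> (\<forall>x\<in>X. \<forall>\<theta>\<in>ostrip \<rho>. norm (f x \<theta>) \<le> B) \<and>
     (\<forall>x\<in>X. \<forall>y\<in>X. \<forall>\<theta>\<in>ostrip \<rho>. norm (f x \<theta> - f y \<theta>) \<le> B * \<bar>x - y\<bar>)"

lemma bndD:
  assumes "bnd X \<rho> B f" "x \<in> X"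
  shows "hol_per \<rho> (f x)" and "\<theta> \<in> ostrip \<rho> \<Longrightarrow> norm (f x \<theta>) \<le> B"
    and "y \<in> X \<Longrightarrow> \<theta> \<in> ostrip \<rho> \<Longrightarrow> norm (f x \<theta> - f y \<theta>) \<le> B * \<bar>x - y\<bar>"
  using assms by (auto simp: bnd_def)

lemma bnd_mono:
  assumes "bnd X \<rho> B f" "X' \<subseteq> X" "\<rho>' \<le> \<rho>" "B \<le> B'"
  shows "bnd X' \<rho>' B' f"
proof -
  have sub: "ostrip \<rho>' \<subseteq> (ostrip \<rho> :: (complex ^ 'a) set)" by (rule ostrip_mono [OF assms(3)])
  show ?thesis unfolding bnd_def
  proof (intro conjI ballI)
    fix x assume x: "x \<in> X'"
    then have x': "x \<in> X" using assms by blast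
    show "hol_per \<rho>' (f x)" using bndD(1) [OF assms(1) x'] assms(3) by (rule hol_per_mono)
    fix \<theta> assume \<theta>: "\<theta> \<in> (ostrip \<rho>' :: (complex ^ 'a) set)"
    show "norm (f x \<theta>) \<le> B'" using bndD(2) [OF assms(1) x'] \<theta> sub assms(4) by (meson order_trans subsetD)
  next
    fix x y \<theta> assume x: "x \<in> X'" "y \<in> X'" and \<theta>: "\<theta> \<in> (ostrip \<rho>' :: (complex ^ 'a) set)"
    have "norm (f x \<theta> - f y \<theta>) \<le> B * \<bar>x - y\<bar>"
      using bndD(3) [OF assms(1)] x \<theta> sub assms(2) by blast
    also have "\<dots> \<le> B' * \<bar>x - y\<bar>" using assms(4) by (intro mult_right_mono) auto
    finally show "norm (f x \<theta> - f y \<theta>) \<le> B' * \<bar>x - y\<bar>" .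
  qed
qed

lemma bnd_const:
  assumes "\<And>x. x \<in> X \<Longrightarrow> norm (c x) \<le> B" "\<And>x y. x \<in> X \<Longrightarrow> y \<in> X \<Longrightarrow> norm (c x - c y) \<le> B * \<bar>x - y\<bar>"
  shows "bnd X \<rho> B (\<lambda>x \<theta>. c x)"
  using assms by (auto simp: bnd_def hol_per_const)

lemma bnd_fixed:
  assumes "hol_per \<rho> f" "\<And>\<theta>. \<theta> \<in> ostrip \<rho> \<Longrightarrow> norm (f \<theta>) \<le> B" "0 \<le> B"
  shows "bnd X \<rho> B (\<lambda>x. f)"
  using assms by (auto simp: bnd_def)

lemma bnd_add:
  assumes f: "bnd X \<rho> B f" and g: "bnd X \<rho> C g"
  shows "bnd X \<rho> (B + C) (\<lambda>x \<theta>. f x \<theta> + g x \<theta>)"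
  unfolding bnd_def
proof (intro conjI ballI)
  fix x assume x: "x \<in> X"
  show "hol_per \<rho> (\<lambda>\<theta>. f x \<theta> + g x \<theta>)" by (intro hol_per_add bndD(1) [OF f x] bndD(1) [OF g x])
  fix \<theta> assume \<theta>: "\<theta> \<in> (ostrip \<rho> :: (complex ^ 'a) set)"
  show "norm (f x \<theta> + g x \<theta>) \<le> B + C" by (intro norm_triangle_mono bndD(2) [OF f x \<theta>] bndD(2) [OF g x \<theta>])
next
  fix x y \<theta> assume x: "x \<in> X" "y \<in> X" and \<theta>: "\<theta> \<in> (ostrip \<rho> :: (complex ^ 'a) set)"
  have "norm ((f x \<theta> - f y \<theta>) + (g x \<theta> - g y \<theta>)) \<le> B * \<bar>x - y\<bar> + C * \<bar>x - y\<bar>"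
    by (intro norm_triangle_mono bndD(3) [OF f x \<theta>] bndD(3) [OF g x \<theta>])
  then show "norm (f x \<theta> + g x \<theta> - (f y \<theta> + g y \<theta>)) \<le> (B + C) * \<bar>x - y\<bar>"
    by (simp add: algebra_simps)
qed

text \<open>The factor 2 comes from the product rule for the Lipschitz part; the supremum part alone
  would give \<open>B * C\<close>.\<close>

lemma bnd_mult:
  assumes f: "bnd X \<rho> B f" and g: "bnd X \<rho> C g" and BC: "0 \<le> B" "0 \<le> C"
  shows "bnd X \<rho> (2 * B * C) (\<lambda>x \<theta>. f x \<theta> * g x \<theta>)"
  unfolding bnd_def
proof (intro conjI ballI)
  fix x assume x: "x \<in> X"
  show "hol_per \<rho> (\<lambda>\<theta>. f x \<theta> * g x \<theta>)" by (intro hol_per_mult bndD(1) [OF f x] bndD(1) [OF g x])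
  fix \<theta> assume \<theta>: "\<theta> \<in> (ostrip \<rho> :: (complex ^ 'a) set)"
  have "norm (f x \<theta> * g x \<theta>) \<le> B * C"
    unfolding norm_mult by (intro mult_mono bndD(2) [OF f x \<theta>] bndD(2) [OF g x \<theta>] BC) auto
  also have "\<dots> \<le> 2 * B * C" using BC by simp
  finally show "norm (f x \<theta> * g x \<theta>) \<le> 2 * B * C" .
next
  fix x y \<theta> assume x: "x \<in> X" "y \<in> X" and \<theta>: "\<theta> \<in> (ostrip \<rho> :: (complex ^ 'a) set)"
  have "f x \<theta> * g x \<theta> - f y \<theta> * g y \<theta> = (f x \<theta> - f y \<theta>) * g x \<theta> + f y \<theta> * (g x \<theta> - g y \<theta>)"
    by (simp add: algebra_simps)
  also have "norm \<dots> \<le> (B * \<bar>x - y\<bar>) * C + B * (C * \<bar>x - y\<bar>)"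
    by (intro norm_triangle_mono, unfold norm_mult)
      (intro mult_mono bndD [OF f] bndD [OF g] x \<theta> BC mult_nonneg_nonneg norm_ge_zero abs_ge_zero)+
  finally show "norm (f x \<theta> * g x \<theta> - f y \<theta> * g y \<theta>) \<le> 2 * B * C * \<bar>x - y\<bar>"
    by (simp add: algebra_simps)
qed

lemma norm_exp_diff_le:
  assumes "norm u \<le> B" "norm v \<le> B"
  shows "norm (exp u - exp v) \<le> exp B * norm (u - v :: complex)"
proof (rule field_differentiable_bound [where S = "cball 0 B" and f' = exp])
  show "norm (exp z) \<le> exp B" if "z \<in> cball 0 B" for z :: complex
    using that norm_exp [of z] by (auto intro: order_trans)
qed (use assms in \<open>auto intro!: derivative_eq_intros\<close>)

text \<open>One factor \<open>exp B\<close> is the mean value bound, the other absorbs the Lipschitz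
  constant through \<open>B \<le> exp B\<close>.\<close>

lemma bnd_exp:
  assumes f: "bnd X \<rho> B f" and B: "0 \<le> B"
  shows "bnd X \<rho> (exp (2 * B)) (\<lambda>x \<theta>. exp (f x \<theta>))"
  unfolding bnd_def
proof (intro conjI ballI)
  fix x assume x: "x \<in> X"
  show "hol_per \<rho> (\<lambda>\<theta>. exp (f x \<theta>))"
    by (rule hol_per_compose [where W = UNIV, OF bndD(1) [OF f x]]) (auto intro: holomorphic_intros)
  fix \<theta> assume \<theta>: "\<theta> \<in> (ostrip \<rho> :: (complex ^ 'a) set)"
  have "norm (exp (f x \<theta>)) \<le> exp (norm (f x \<theta>))" by (rule norm_exp)
  also have "\<dots> \<le> exp (2 * B)" using bndD(2) [OF f x \<theta>] B by simp
  finally show "norm (exp (f x \<theta>)) \<le> exp (2 * B)" .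
next
  fix x y \<theta> assume x: "x \<in> X" "y \<in> X" and \<theta>: "\<theta> \<in> (ostrip \<rho> :: (complex ^ 'a) set)"
  have "norm (exp (f x \<theta>) - exp (f y \<theta>)) \<le> exp B * norm (f x \<theta> - f y \<theta>)"
    by (intro norm_exp_diff_le bndD(2) [OF f] x \<theta>)
  also have "\<dots> \<le> exp B * (B * \<bar>x - y\<bar>)"
    by (intro mult_left_mono bndD(3) [OF f] x \<theta>) auto
  also have "\<dots> = (exp B * B) * \<bar>x - y\<bar>" by simp
  also have "\<dots> \<le> (exp B * exp B) * \<bar>x - y\<bar>"
    using order_trans [OF _ exp_ge_add_one_self [of B], of B] by (intro mult_right_mono mult_left_mono) auto
  also have "exp B * exp B = exp (2 * B)" by (simp add: exp_add [symmetric])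
  finally show "norm (exp (f x \<theta>) - exp (f y \<theta>)) \<le> exp (2 * B) * \<bar>x - y\<bar>" .
qed

lemma bnd_fourier:
  assumes f: "bnd X \<rho> B f" and \<rho>: "\<rho> > 0" and x: "x \<in> X"
  shows "norm (fourier (f x) k) \<le> B * exp (- \<rho> * freq_abs k)"
    and "y \<in> X \<Longrightarrow> norm (fourier (f x) k - fourier (f y) k) \<le> (B * \<bar>x - y\<bar>) * exp (- \<rho> * freq_abs k)"
proof -
  show "norm (fourier (f x) k) \<le> B * exp (- \<rho> * freq_abs k)"
    by (rule fourier_bound [OF bndD(1) [OF f x] \<rho> bndD(2) [OF f x]])
  assume y: "y \<in> X"
  have "fourier (f x) k - fourier (f y) k = fourier (\<lambda>\<theta>. f x \<theta> - f y \<theta>) k"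
    by (rule fourier_diff [symmetric, OF bndD(1) [OF f x] bndD(1) [OF f y] \<rho>])
  also have "norm \<dots> \<le> (B * \<bar>x - y\<bar>) * exp (- \<rho> * freq_abs k)"
    by (intro fourier_bound [where \<rho> = \<rho>] hol_per_diff bndD [OF f] x y \<rho>)
  finally show "norm (fourier (f x) k - fourier (f y) k) \<le> (B * \<bar>x - y\<bar>) * exp (- \<rho> * freq_abs k)" .
qed

lemma bnd_fourier_zero:
  assumes f: "bnd X \<rho> B f" and \<rho>: "\<rho> > 0"
  shows "bnd X \<rho>' B (\<lambda>x \<theta>. fourier (f x) 0)"
  using bnd_fourier [OF f \<rho>, where k = 0] by (intro bnd_const) (auto simp: freq_abs_eq)

text \<open>The numerator in \<open>trig_bound\<close> for growth of order \<open>2 * p\<close>. The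
  order is doubled because differencing \<open>inverse (\<i> * dotp k \<omega> + \<nu> x)\<close> in
  \<open>x\<close> squares the small divisor.\<close>

definition sol_const :: "'n::finite itself \<Rightarrow> nat \<Rightarrow> real" where
  "sol_const _ p = fact (2 * p + 2 * CARD('n)) * exp 1 * wt_sum TYPE('n)"

text \<open>\<open>K\<close> accounts for the size and variation of \<open>f\<close>, and
  \<open>L * K\<^sup>2\<close> for the variation of the divisors: two inverses differ by the
  difference of the divisors times both inverses.\<close>

lemma bnd_sol:
  fixes f :: "real \<Rightarrow> complex ^ 'n \<Rightarrow> complex"
  assumes f: "bnd X \<rho> B f" and B: "0 \<le> B" and \<sigma>: "0 < \<sigma>" "\<sigma> \<le> 1" "\<sigma> < \<rho>"
    and K: "\<And>k x. x \<in> X \<Longrightarrow> norm (inverse (\<i> * dotp k \<omega> + \<nu> x)) \<le> K * wt k ^ p"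
    and K0: "0 \<le> K" and L: "0 \<le> L" "\<And>x y. x \<in> X \<Longrightarrow> y \<in> X \<Longrightarrow> norm (\<nu> x - \<nu> y) \<le> L * \<bar>x - y\<bar>"
    and nz: "(\<forall>k. \<forall>x\<in>X. \<i> * dotp k \<omega> + \<nu> x \<noteq> 0) \<or> (\<forall>x\<in>X. \<nu> x = 0)"
  shows "bnd X (\<rho> - \<sigma>) (B * (K + L * K\<^sup>2) * (sol_const TYPE('n) p / \<sigma> ^ (2 * p + 2 * CARD('n))))
    (\<lambda>x. sol \<omega> (\<nu> x) (f x))"
proof -
  have \<rho>: "\<rho> > 0" using \<sigma> by linarith
  define K' where "K' = K + L * K\<^sup>2"
  have K': "K \<le> K'" using L K0 by (simp add: K'_def)
  define c where "c x k = fourier (f x) k * inverse (\<i> * dotp k \<omega> + \<nu> x)" for x k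
  have wtp: "wt k ^ p \<le> wt k ^ (2 * p)" for k :: "int ^ 'n" by (rule power_increasing) auto
  have c1: "norm (c x k) \<le> (B * K') * wt k ^ (2 * p) * exp (- \<rho> * freq_abs k)" if x: "x \<in> X" for x k
  proof -
    have "norm (c x k) \<le> (B * exp (- \<rho> * freq_abs k)) * (K * wt k ^ p)"
      unfolding c_def norm_mult
      by (intro mult_mono bnd_fourier(1) [OF f \<rho> x] K x) (use B in auto)
    also have "\<dots> \<le> (B * exp (- \<rho> * freq_abs k)) * (K' * wt k ^ (2 * p))"
      by (intro mult_left_mono mult_mono K' wtp) (use B K0 K' in auto)
    finally show ?thesis by (simp add: mult_ac)
  qed
  have c2: "norm (c x k - c y k) \<le> (B * K' * \<bar>x - y\<bar>) * wt k ^ (2 * p) * exp (- \<rho> * freq_abs k)"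
    if x: "x \<in> X" and y: "y \<in> X" for x y k
  proof -
    let ?dx = "inverse (\<i> * dotp k \<omega> + \<nu> x)" and ?dy = "inverse (\<i> * dotp k \<omega> + \<nu> y)"
    have dd: "?dx - ?dy = (\<nu> y - \<nu> x) * (?dx * ?dy)"
      using nz
    proof
      assume "\<forall>k. \<forall>x\<in>X. \<i> * dotp k \<omega> + \<nu> x \<noteq> 0"
      then have "\<i> * dotp k \<omega> + \<nu> x \<noteq> 0" "\<i> * dotp k \<omega> + \<nu> y \<noteq> 0" using x y by auto
      then show ?thesis by (simp add: field_simps)
    qed (use x y in simp)
    have "c x k - c y k = (fourier (f x) k - fourier (f y) k) * ?dx + fourier (f y) k * (?dx - ?dy)"
      by (simp add: c_def algebra_simps)
    also have "norm \<dots> \<le> ((B * \<bar>x - y\<bar>) * exp (- \<rho> * freq_abs k)) * (K * wt k ^ p)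
        + (B * exp (- \<rho> * freq_abs k)) * ((L * \<bar>x - y\<bar>) * ((K * wt k ^ p) * (K * wt k ^ p)))"
    proof (rule norm_triangle_mono)
      show "norm ((fourier (f x) k - fourier (f y) k) * ?dx) \<le> ((B * \<bar>x - y\<bar>) * exp (- \<rho> * freq_abs k)) * (K * wt k ^ p)"
        unfolding norm_mult by (intro mult_mono bnd_fourier(2) [OF f \<rho> x y] K x) (use B in auto)
      show "norm (fourier (f y) k * (?dx - ?dy)) \<le> (B * exp (- \<rho> * freq_abs k)) * ((L * \<bar>x - y\<bar>) * ((K * wt k ^ p) * (K * wt k ^ p)))"
        unfolding dd norm_mult
        by (intro mult_mono bnd_fourier(1) [OF f \<rho> y] K x y mult_nonneg_nonneg)
          (use B L K0 L(2) [OF y x] in \<open>auto simp: abs_minus_commute\<close>)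
    qed
    also have "\<dots> \<le> ((B * \<bar>x - y\<bar>) * exp (- \<rho> * freq_abs k)) * (K * wt k ^ (2 * p))
        + (B * exp (- \<rho> * freq_abs k)) * ((L * \<bar>x - y\<bar>) * (K\<^sup>2 * wt k ^ (2 * p)))"
    proof (rule add_mono)
      show "((B * \<bar>x - y\<bar>) * exp (- \<rho> * freq_abs k)) * (K * wt k ^ p)
          \<le> ((B * \<bar>x - y\<bar>) * exp (- \<rho> * freq_abs k)) * (K * wt k ^ (2 * p))"
        by (intro mult_left_mono wtp) (use B K0 in auto)
      have "(K * wt k ^ p) * (K * wt k ^ p) = K\<^sup>2 * wt k ^ (2 * p)"
        by (simp add: power2_eq_square mult_2 power_add)
      then show "(B * exp (- \<rho> * freq_abs k)) * ((L * \<bar>x - y\<bar>) * ((K * wt k ^ p) * (K * wt k ^ p)))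
          \<le> (B * exp (- \<rho> * freq_abs k)) * ((L * \<bar>x - y\<bar>) * (K\<^sup>2 * wt k ^ (2 * p)))" by simp
    qed
    also have "\<dots> = (B * K' * \<bar>x - y\<bar>) * wt k ^ (2 * p) * exp (- \<rho> * freq_abs k)"
      by (simp add: K'_def algebra_simps)
    finally show ?thesis .
  qed
  have sol: "sol \<omega> (\<nu> x) (f x) = trig (c x)" for x by (simp add: sol_def c_def [abs_def])
  show ?thesis
    unfolding bnd_def sol
  proof (intro conjI ballI)
    fix x assume x: "x \<in> X"
    show "hol_per (\<rho> - \<sigma>) (trig (c x))"
      by (rule hol_per_mono [OF hol_per_trig [OF c1 [OF x]]]) (use \<sigma> in auto)
    fix \<theta> assume \<theta>: "\<theta> \<in> (ostrip (\<rho> - \<sigma>) :: (complex ^ 'n) set)"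
    show "norm (trig (c x) \<theta>) \<le> B * (K + L * K\<^sup>2) * (sol_const TYPE('n) p / \<sigma> ^ (2 * p + 2 * CARD('n)))"
      using trig_bound [OF c1 [OF x] \<sigma>(1,2) \<theta>] by (simp add: sol_const_def K'_def)
  next
    fix x y \<theta> assume x: "x \<in> X" "y \<in> X" and \<theta>: "\<theta> \<in> (ostrip (\<rho> - \<sigma>) :: (complex ^ 'n) set)"
    have \<theta>': "\<theta> \<in> ostrip \<rho>" using \<theta> \<sigma> ostrip_mono [of "\<rho> - \<sigma>" \<rho>] by auto
    have "((\<lambda>k. (c x k - c y k) * char_fun k \<theta>) has_sum (trig (c x) \<theta> - trig (c y) \<theta>)) UNIV"
      using has_sum_diff [OF trig_has_sum [OF c1 [OF x(1)] \<theta>'] trig_has_sum [OF c1 [OF x(2)] \<theta>']]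
      by (simp add: left_diff_distrib)
    then have "trig (c x) \<theta> - trig (c y) \<theta> = trig (\<lambda>k. c x k - c y k) \<theta>"
      unfolding trig_def by (simp add: infsumI)
    then show "norm (trig (c x) \<theta> - trig (c y) \<theta>)
        \<le> B * (K + L * K\<^sup>2) * (sol_const TYPE('n) p / \<sigma> ^ (2 * p + 2 * CARD('n))) * \<bar>x - y\<bar>"
      using trig_bound [OF c2 [OF x] \<sigma>(1,2) \<theta>] by (simp add: sol_const_def K'_def mult_ac)
  qed
qed

section \<open>Newton iteration for the Riccati equation\<close>

lemma bnd_cmult:
  assumes f: "bnd X \<rho> B f" and c: "norm c * B \<le> B'"
  shows "bnd X \<rho> B' (\<lambda>x \<theta>. c * f x \<theta>)"
  unfolding bnd_def
proof (intro conjI ballI)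
  fix x assume x: "x \<in> X"
  show "hol_per \<rho> (\<lambda>\<theta>. c * f x \<theta>)" by (intro hol_per_mult hol_per_const bndD(1) [OF f x])
  fix \<theta> assume \<theta>: "\<theta> \<in> (ostrip \<rho> :: (complex ^ 'a) set)"
  show "norm (c * f x \<theta>) \<le> B'"
    unfolding norm_mult by (rule order_trans [OF mult_left_mono [OF bndD(2) [OF f x \<theta>]] c]) auto
next
  fix x y \<theta> assume x: "x \<in> X" "y \<in> X" and \<theta>: "\<theta> \<in> (ostrip \<rho> :: (complex ^ 'a) set)"
  have "norm (c * f x \<theta> - c * f y \<theta>) = norm c * norm (f x \<theta> - f y \<theta>)"
    by (simp add: right_diff_distrib [symmetric] norm_mult)
  also have "\<dots> \<le> norm c * (B * \<bar>x - y\<bar>)" by (intro mult_left_mono bndD(3) [OF f x \<theta>]) auto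
  also have "\<dots> \<le> B' * \<bar>x - y\<bar>" using c by (simp add: mult.assoc [symmetric] mult_right_mono)
  finally show "norm (c * f x \<theta> - c * f y \<theta>) \<le> B' * \<bar>x - y\<bar>" .
qed

definition newton_step :: "real ^ 'n \<Rightarrow> (complex ^ 'n \<Rightarrow> complex) \<Rightarrow> (complex ^ 'n \<Rightarrow> complex) \<Rightarrow> complex \<Rightarrow>
    complex ^ 'n \<Rightarrow> complex" where
  "newton_step \<omega> e M \<mu> =
     (\<lambda>\<theta>. sol \<omega> (2 * \<mu>) (\<lambda>\<theta>. - 1 * (e \<theta> * exp (2 * M \<theta>))) \<theta> * exp (- 2 * M \<theta>))"

text \<open>\<open>4 * (exp 4)\<^sup>2\<close> arises from two products, each doubling the constant,
  with the factors \<open>exp (2 * M)\<close> and \<open>exp (- 2 * M)\<close>; each of these is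
  bounded by \<open>exp 4\<close> because \<open>bnd_exp\<close> doubles the bound 2 of its
  exponent.\<close>

lemma newton_step_bnd:
  fixes e M :: "real \<Rightarrow> complex ^ 'n \<Rightarrow> complex"
  assumes e: "bnd X \<rho> E e" and M: "bnd X \<rho> 1 M" and E: "0 \<le> E"
    and \<sigma>: "0 < \<sigma>" "\<sigma> \<le> 1" "\<sigma> < \<rho>"
    and K: "\<And>k x. x \<in> X \<Longrightarrow> norm (inverse (\<i> * dotp k \<omega> + 2 * \<mu> x)) \<le> K * wt k ^ p"
    and K0: "0 \<le> K" and L: "0 \<le> L" "\<And>x y. x \<in> X \<Longrightarrow> y \<in> X \<Longrightarrow> norm (2 * \<mu> x - 2 * \<mu> y) \<le> L * \<bar>x - y\<bar>"
    and nz: "\<And>k x. x \<in> X \<Longrightarrow> \<i> * dotp k \<omega> + 2 * \<mu> x \<noteq> 0"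
    and D: "4 * (exp 4)\<^sup>2 * E * (K + L * K\<^sup>2) * (sol_const TYPE('n) p / \<sigma> ^ (2 * p + 2 * CARD('n))) \<le> D"
  shows "bnd X (\<rho> - \<sigma>) D (\<lambda>x. newton_step \<omega> (e x) (M x) (\<mu> x))"
proof -
  let ?S = "sol_const TYPE('n) p / \<sigma> ^ (2 * p + 2 * CARD('n))"
  have S0: "0 \<le> ?S" using \<sigma> wt_sum_nonneg [where 'n = 'n] by (simp add: sol_const_def)
  have M2: "bnd X \<rho> 2 (\<lambda>x \<theta>. 2 * M x \<theta>)" "bnd X \<rho> 2 (\<lambda>x \<theta>. - 2 * M x \<theta>)"
    by (rule bnd_cmult [OF M]; simp)+
  have ex: "bnd X \<rho> (exp 4) (\<lambda>x \<theta>. exp (2 * M x \<theta>))" "bnd X \<rho> (exp 4) (\<lambda>x \<theta>. exp (- 2 * M x \<theta>))"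
    using bnd_exp [OF M2(1)] bnd_exp [OF M2(2)] by simp_all
  have f: "bnd X \<rho> (2 * E * exp 4) (\<lambda>x \<theta>. - 1 * (e x \<theta> * exp (2 * M x \<theta>)))"
    by (rule bnd_cmult [OF bnd_mult [OF e ex(1) E]]) auto
  have c: "bnd X (\<rho> - \<sigma>) ((2 * E * exp 4) * (K + L * K\<^sup>2) * ?S)
      (\<lambda>x. sol \<omega> (2 * \<mu> x) (\<lambda>\<theta>. - 1 * (e x \<theta> * exp (2 * M x \<theta>))))"
    by (rule bnd_sol [OF f _ \<sigma> K K0 L]) (use E nz in auto)
  have "bnd X (\<rho> - \<sigma>) (2 * ((2 * E * exp 4) * (K + L * K\<^sup>2) * ?S) * exp 4)
      (\<lambda>x \<theta>. sol \<omega> (2 * \<mu> x) (\<lambda>\<theta>. - 1 * (e x \<theta> * exp (2 * M x \<theta>))) \<theta> * exp (- 2 * M x \<theta>))"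
  proof (rule bnd_mult [OF c bnd_mono [OF ex(2)]])
    show "0 \<le> (2 * E * exp 4) * (K + L * K\<^sup>2) * ?S"
      by (intro mult_nonneg_nonneg add_nonneg_nonneg S0) (use E K0 L in auto)
  qed (use \<sigma> in auto)
  then show ?thesis
    unfolding newton_step_def by (rule bnd_mono) (use \<sigma> D in \<open>auto simp: power2_eq_square mult_ac\<close>)
qed

text \<open>Differentiating \<open>exp (- 2 * M)\<close> contributes
  \<open>- 2 * (m - \<mu>)\<close>, which turns the constant coefficient \<open>2 * \<mu>\<close>
  into the variable coefficient \<open>2 * m\<close>.\<close>

lemma newton_step_flow:
  fixes e M m :: "complex ^ 'n \<Rightarrow> complex"
  assumes e: "hol_per \<rho> e" "\<And>\<theta>. \<theta> \<in> ostrip \<rho> \<Longrightarrow> norm (e \<theta>) \<le> E"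
    and M: "hol_per \<rho> M" "\<And>\<theta>. \<theta> \<in> ostrip \<rho> \<Longrightarrow> norm (M \<theta>) \<le> 1" and \<rho>: "\<rho> > 0"
    and K: "\<And>k. norm (inverse (\<i> * dotp k \<omega> + 2 * \<mu>)) \<le> K * wt k ^ p"
    and nz: "\<And>k. \<i> * dotp k \<omega> + 2 * \<mu> \<noteq> 0"
    and dM: "\<And>t. ((\<lambda>t. M (line \<omega> t)) has_vector_derivative m (line \<omega> t) - \<mu>) (at t)"
  shows "((\<lambda>t. newton_step \<omega> e M \<mu> (line \<omega> t)) has_vector_derivative
    - e (line \<omega> t) - 2 * m (line \<omega> t) * newton_step \<omega> e M \<mu> (line \<omega> t)) (at t)"
proof -
  let ?f = "\<lambda>\<theta>. - 1 * (e \<theta> * exp (2 * M \<theta>))"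
  \<comment> \<open>Mode 0 has divisor \<open>2 * \<mu>\<close>, so the mean is solved for along
    with the other modes.\<close>
  have "\<mu> \<noteq> 0" using nz [of 0] by (auto simp: dotp_def)
  have f: "hol_per \<rho> ?f"
    by (intro hol_per_mult hol_per_const e hol_per_compose [where g = exp and W = UNIV] M holomorphic_intros) auto
  have fb: "norm (?f \<theta>) \<le> E * exp 2" if "\<theta> \<in> ostrip \<rho>" for \<theta>
  proof -
    have "norm (exp (2 * M \<theta>)) \<le> exp 2"
      using norm_exp [of "2 * M \<theta>"] M(2) [OF that] by (auto simp: norm_mult intro: order_trans)
    then show ?thesis
      unfolding norm_mult using e(2) [OF that] by (auto intro!: mult_mono order_trans [OF norm_ge_zero e(2) [OF that]])
  qed
  have 1: "((\<lambda>t. sol \<omega> (2 * \<mu>) ?f (line \<omega> t)) has_vector_derivative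
      ?f (line \<omega> t) - 2 * \<mu> * sol \<omega> (2 * \<mu>) ?f (line \<omega> t)) (at t)"
    using sol_flow_aux [OF f \<rho> fb K, of t] nz \<open>\<mu> \<noteq> 0\<close> by auto
  have 2: "((\<lambda>t. exp (- 2 * M (line \<omega> t))) has_vector_derivative
      (- 2 * (m (line \<omega> t) - \<mu>)) * exp (- 2 * M (line \<omega> t))) (at t)"
  proof -
    have "((\<lambda>t. - 2 * M (line \<omega> t)) has_vector_derivative - 2 * (m (line \<omega> t) - \<mu>)) (at t)"
      by (rule has_vector_derivative_mult_right [OF dM])
    from field_vector_diff_chain_at [OF this DERIV_exp] show ?thesis
      by (simp add: o_def)
  qed
  have ee: "exp (2 * M (line \<omega> t)) * exp (- 2 * M (line \<omega> t)) = 1"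
    by (simp add: exp_add [symmetric])
  let ?u = "sol \<omega> (2 * \<mu>) ?f (line \<omega> t)" and ?x = "exp (- 2 * M (line \<omega> t))"
  have "?u * ((- 2 * (m (line \<omega> t) - \<mu>)) * ?x) + (?f (line \<omega> t) - 2 * \<mu> * ?u) * ?x
      = - e (line \<omega> t) * (exp (2 * M (line \<omega> t)) * ?x) - 2 * m (line \<omega> t) * (?u * ?x)"
    by (simp add: algebra_simps)
  then show ?thesis
    using has_vector_derivative_mult [OF 1 2] unfolding newton_step_def ee by simp
qed

section \<open>Limits of the iteration and estimates for the square root\<close>

lemma uniform_limit_geometric:
  fixes f :: "nat \<Rightarrow> 'a \<Rightarrow> 'b::banach"
  assumes "\<And>n x. x \<in> S \<Longrightarrow> norm (f (Suc n) x - f n x) \<le> C / 2 ^ n"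
  obtains g where "uniform_limit S f g sequentially"
proof -
  have "summable (\<lambda>n. C * (1 / 2) ^ n)" by (intro summable_mult summable_geometric) auto
  then have "summable (\<lambda>n. C / 2 ^ n)" by (simp only: power_divide power_one mult_1_right times_divide_eq_right)
  then have "uniform_limit S (\<lambda>n x. \<Sum>i<n. f (Suc i) x - f i x) (\<lambda>x. suminf (\<lambda>i. f (Suc i) x - f i x)) sequentially"
    using assms by (intro Weierstrass_m_test)
  moreover have "(\<Sum>i<n. f (Suc i) x - f i x) = f n x - f 0 x" for n x
    by (rule sum_lessThan_telescope [of "\<lambda>i. f i x" n])
  ultimately have "uniform_limit S (\<lambda>n x. f n x - f 0 x) (\<lambda>x. suminf (\<lambda>i. f (Suc i) x - f i x)) sequentially"
    by (simp only:)
  then have "uniform_limit S (\<lambda>n x. (f n x - f 0 x) + f 0 x) (\<lambda>x. suminf (\<lambda>i. f (Suc i) x - f i x) + f 0 x) sequentially"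
    by (intro uniform_limit_intros)
  then have "uniform_limit S f (\<lambda>x. suminf (\<lambda>i. f (Suc i) x - f i x) + f 0 x) sequentially" by simp
  then show ?thesis by (rule that)
qed

text \<open>Carries the two flow identities of the iteration over to the limit.\<close>

lemma has_vector_derivative_uniform_limit:
  fixes f :: "nat \<Rightarrow> real \<Rightarrow> 'b::banach"
  assumes f: "\<And>n t. (f n has_vector_derivative f' n t) (at t)"
    and lim': "uniform_limit UNIV f' g' sequentially" and lim: "\<And>t. (\<lambda>n. f n t) \<longlonglongrightarrow> g t"
  shows "(g has_vector_derivative g' t) (at t)"
proof -
  have "\<exists>h. \<forall>x\<in>UNIV. (\<lambda>n. f n x) \<longlonglongrightarrow> h x \<and> (h has_derivative (\<lambda>r. r *\<^sub>R g' x)) (at x within UNIV)"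
  proof (rule has_derivative_sequence)
    show "(f n has_derivative (\<lambda>r. r *\<^sub>R f' n x)) (at x within UNIV)" for n x
      using f by (simp add: has_vector_derivative_def)
    show "\<forall>\<^sub>F n in sequentially. \<forall>x\<in>UNIV. \<forall>h. norm (h *\<^sub>R f' n x - h *\<^sub>R g' x) \<le> e * norm h" if "e > 0" for e
    proof -
      have "\<forall>\<^sub>F n in sequentially. \<forall>x\<in>UNIV. dist (f' n x) (g' x) < e"
        using lim' that by (simp add: uniform_limit_iff)
      then show ?thesis
      proof eventually_elim
        case (elim n)
        show ?case
        proof (intro ballI allI)
          fix x h :: real
          have "norm (f' n x - g' x) \<le> e" using elim by (auto simp: dist_norm less_imp_le)
          then have "\<bar>h\<bar> * norm (f' n x - g' x) \<le> \<bar>h\<bar> * e" by (intro mult_left_mono) auto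
          then show "norm (h *\<^sub>R f' n x - h *\<^sub>R g' x) \<le> e * norm h"
            by (simp add: scaleR_right_diff_distrib [symmetric] mult.commute)
        qed
      qed
    qed
  qed (use lim in auto)
  then obtain h where h: "\<And>x. (\<lambda>n. f n x) \<longlonglongrightarrow> h x" "\<And>x. (h has_derivative (\<lambda>r. r *\<^sub>R g' x)) (at x)"
    by auto
  have "h = g" using h(1) lim LIMSEQ_unique by blast
  then show ?thesis using h(2) by (simp add: has_vector_derivative_def)
qed

lemma abs_sqrt_diff_le:
  assumes "1 \<le> x" "1 \<le> y"
  shows "\<bar>sqrt x - sqrt y\<bar> \<le> \<bar>x - y\<bar> / 2"
proof -
  have s: "1 \<le> sqrt x" "1 \<le> sqrt y" using assms by auto
  have "x - y = (sqrt x - sqrt y) * (sqrt x + sqrt y)"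
    using assms by (simp add: algebra_simps)
  then have "\<bar>x - y\<bar> = \<bar>sqrt x - sqrt y\<bar> * (sqrt x + sqrt y)"
    using s by (simp add: abs_mult)
  moreover have "\<bar>sqrt x - sqrt y\<bar> * 2 \<le> \<bar>sqrt x - sqrt y\<bar> * (sqrt x + sqrt y)"
    using s by (intro mult_left_mono) linarith+
  ultimately show ?thesis by simp
qed

text \<open>On \<open>{1..2}\<close> the two roots add up to at most 3. This bounds from below the
  speed at which the leading frequency moves with the parameter.\<close>

lemma sqrt_diff_ge:
  assumes "1 \<le> y" "y \<le> x" "x \<le> 2"
  shows "(x - y) / 3 \<le> sqrt x - sqrt y"
proof -
  have s: "sqrt x \<le> 3 / 2" "sqrt y \<le> 3 / 2"
    by (rule real_le_lsqrt; use assms in \<open>simp add: power2_eq_square\<close>)+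
  have s': "sqrt y \<le> sqrt x" using assms by simp
  have "x - y = (sqrt x - sqrt y) * (sqrt x + sqrt y)"
    using assms by (simp add: algebra_simps)
  also have "\<dots> \<le> (sqrt x - sqrt y) * 3" using s s' by (intro mult_left_mono) linarith+
  finally show ?thesis by simp
qed

text \<open>\<open>F\<close> is the potential on the torus; \<open>Bf\<close> and \<open>bf\<close>
  integrate minus its oscillating part once and twice. \<open>K1\<close> controls the inverses of
  the unshifted divisors, and \<open>w0\<close> sets the size demanded of the divisors shifted by
  \<open>2 * mu\<close>. One step loses a factor \<open>A * b ^ n / \<delta>\<close>: in
  \<open>b\<close>, the 4 comes from squared divisors whose lower bounds halve at each step, and
  \<open>2 ^ (2 * p + 2 * CARD('n))\<close> from width losses that halve. The bounds on
  \<open>h\<close> let the quadratic step close, keep \<open>pot n\<close> bounded by 1 and keep the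
  drift of the frequency within \<open>\<delta> * \<kappa> / 8\<close>; \<open>small\<close> makes
  the initial state meet these targets.\<close>

locale hill_kam =
  fixes F Bf bf :: "complex ^ 'n \<Rightarrow> complex" and \<omega> :: "real ^ 'n"
    and \<rho> \<kappa> w0 K1 C1 \<delta> A b h :: real and p :: nat
  assumes \<rho>: "0 < \<rho>" "\<rho> \<le> 1" and \<kappa>: "0 < \<kappa>" and w0: "0 < w0" and K1: "0 \<le> K1" and C1: "0 \<le> C1"
    and dio: "\<And>k. norm (inverse (\<i> * dotp k \<omega>)) \<le> K1 * wt k ^ p"
    and Bf: "hol_per \<rho> Bf" "\<And>\<theta>. \<theta> \<in> ostrip \<rho> \<Longrightarrow> norm (Bf \<theta>) \<le> C1"
      "\<And>t. ((\<lambda>t. Bf (line \<omega> t)) has_vector_derivative - (F (line \<omega> t) - (of_real \<kappa>)\<^sup>2)) (at t)"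
    and bf: "hol_per \<rho> bf" "\<And>\<theta>. \<theta> \<in> ostrip \<rho> \<Longrightarrow> norm (bf \<theta>) \<le> C1"
      "\<And>t. ((\<lambda>t. bf (line \<omega> t)) has_vector_derivative Bf (line \<omega> t)) (at t)"
    and dio0: "\<And>k. dotp k \<omega> = 0 \<Longrightarrow> k = 0"
    and \<delta>: "0 < \<delta>" "\<delta> \<le> 1"
    and b: "b = 4 * 2 ^ (2 * p + 2 * CARD('n))"
    and A: "1 \<le> A"
      "4 * (exp 4)\<^sup>2 * ((1 / w0 + 1 / \<kappa>) + 2 * \<kappa> * (1 / w0 + 1 / \<kappa>)\<^sup>2) * (sol_const TYPE('n) p * (8 / \<rho>) ^ (2 * p + 2 * CARD('n))) \<le> A"
      "K1 * (sol_const TYPE('n) p * (8 / \<rho>) ^ (2 * p + 2 * CARD('n))) \<le> A"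
    and h: "0 < h" "h \<le> 1 / (4 * b\<^sup>2)" "h \<le> 1 / 8" "h \<le> \<kappa> / 16"
    and small: "\<delta> * (12 * \<kappa> * C1 + 8 * C1\<^sup>2) \<le> h / A\<^sup>2" "\<delta> * (4 * C1) \<le> 1 / 2" "\<delta> * (4 * C1) \<le> \<kappa> / 4"
begin

text \<open>The state \<open>(e, M, \<mu>, m)\<close> satisfies \<open>M' = m - \<mu>\<close> and \<open>m' + m\<^sup>2 + \<delta>\<^sup>2 x F = e\<close> along the flow.  The
  first averaging step is built into its initial value, whose error is of order \<open>\<delta>\<^sup>3\<close>.\<close>

primrec st :: "nat \<Rightarrow> real \<Rightarrow> (complex ^ 'n \<Rightarrow> complex) \<times> (complex ^ 'n \<Rightarrow> complex) \<times> complex \<times> (complex ^ 'n \<Rightarrow> complex)" where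
  "st 0 x = ((\<lambda>\<theta>. of_real (\<delta> ^ 3) * (2 * \<i> * \<kappa> * (of_real (x * sqrt x) * Bf \<theta>) + \<delta> * (of_real (x\<^sup>2) * (Bf \<theta> * Bf \<theta>)))),
     (\<lambda>\<theta>. of_real (\<delta>\<^sup>2) * (of_real x * bf \<theta>)), \<i> * of_real (\<delta> * \<kappa> * sqrt x),
     (\<lambda>\<theta>. \<i> * of_real (\<delta> * \<kappa> * sqrt x) + of_real (\<delta>\<^sup>2) * (of_real x * Bf \<theta>)))"
| "st (Suc n) x = (case st n x of (e, M, \<mu>, m) \<Rightarrow> let d = newton_step \<omega> e M \<mu> in
     ((\<lambda>\<theta>. d \<theta> * d \<theta>), (\<lambda>\<theta>. M \<theta> + sol \<omega> 0 d \<theta>), \<mu> + fourier d 0, (\<lambda>\<theta>. m \<theta> + d \<theta>)))"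

definition "err n x = fst (st n x)"
definition "pot n x = fst (snd (st n x))"
definition "mu n x = fst (snd (snd (st n x)))"
definition "ric n x = snd (snd (snd (st n x)))"
definition "incr n x = newton_step \<omega> (err n x) (pot n x) (mu n x)"

lemma st_Suc:
  "err (Suc n) x = (\<lambda>\<theta>. incr n x \<theta> * incr n x \<theta>)"
  "pot (Suc n) x = (\<lambda>\<theta>. pot n x \<theta> + sol \<omega> 0 (incr n x) \<theta>)"
  "mu (Suc n) x = mu n x + fourier (incr n x) 0"
  "ric (Suc n) x = (\<lambda>\<theta>. ric n x \<theta> + incr n x \<theta>)"
  by (simp_all add: err_def pot_def mu_def ric_def incr_def Let_def split: prod.splits)

lemma st_0:
  "err 0 x = (\<lambda>\<theta>. of_real (\<delta> ^ 3) * (2 * \<i> * \<kappa> * (of_real (x * sqrt x) * Bf \<theta>) + \<delta> * (of_real (x\<^sup>2) * (Bf \<theta> * Bf \<theta>))))"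
  "pot 0 x = (\<lambda>\<theta>. of_real (\<delta>\<^sup>2) * (of_real x * bf \<theta>))"
  "mu 0 x = \<i> * of_real (\<delta> * \<kappa> * sqrt x)"
  "ric 0 x = (\<lambda>\<theta>. \<i> * of_real (\<delta> * \<kappa> * sqrt x) + of_real (\<delta>\<^sup>2) * (of_real x * Bf \<theta>))"
  by (simp_all add: err_def pot_def mu_def ric_def)

definition good :: "nat \<Rightarrow> real set" where
  "good n = {x \<in> {1..2}. \<forall>j<n. \<forall>k. k \<noteq> 0 \<longrightarrow> w0 / (2 ^ j * wt k ^ p) \<le> \<bar>dotp k \<omega> + 2 * Im (mu j x)\<bar>}"

text \<open>Falls from \<open>\<rho>\<close> towards \<open>\<rho> / 2\<close>. Step
  \<open>n\<close> may spend two shares of \<open>\<rho> / 2 ^ (n + 3)\<close>, one for the Newton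
  correction and one for its primitive.\<close>

definition width :: "nat \<Rightarrow> real" where "width n = \<rho> / 2 + \<rho> / 2 ^ (n + 1)"

text \<open>Geometric decay is enough, since the divisor losses also grow only geometrically. The
  powers of \<open>A\<close> and \<open>b\<close> are squared because the next error is the square
  of the increment.\<close>

definition err_size :: "nat \<Rightarrow> real" where "err_size n = \<delta>\<^sup>2 * h / (2 ^ n * A\<^sup>2 * b ^ (2 * n))"

text \<open>\<open>2 * h * (1 - 1 / 2 ^ n)\<close> is the sum of \<open>h / 2 ^ i\<close> over
  \<open>i < n\<close>. \<open>mu\<close> is treated as a function of \<open>\<theta>\<close> so
  that \<open>bnd\<close> also keeps its Lipschitz dependence on \<open>x\<close>, from which the
  monotonicity of the frequency follows.\<close>

definition kam_inv :: "nat \<Rightarrow> bool" where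
  "kam_inv n \<longleftrightarrow> bnd (good n) (width n) (err_size n) (err n) \<and>
     bnd (good n) (width n) (1 / 2 + 2 * h * (1 - 1 / 2 ^ n)) (pot n) \<and>
     bnd (good n) (width n) (2 * \<delta> * h * (1 - 1 / 2 ^ n)) (\<lambda>x (\<theta> :: complex ^ 'n). mu n x - mu 0 x) \<and>
     bnd (good n) (width n) (2 * \<delta> * h * (1 - 1 / 2 ^ n)) (\<lambda>x \<theta>. ric n x \<theta> - ric 0 x \<theta>) \<and>
     (\<forall>x\<in>good n. \<forall>t. ((\<lambda>t. pot n x (line \<omega> t)) has_vector_derivative ric n x (line \<omega> t) - mu n x) (at t)) \<and>
     (\<forall>x\<in>good n. \<forall>t. ((\<lambda>t. ric n x (line \<omega> t)) has_vector_derivative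
        err n x (line \<omega> t) - (ric n x (line \<omega> t))\<^sup>2 - of_real (\<delta>\<^sup>2 * x) * F (line \<omega> t)) (at t))"

section \<open>Inductive estimates for the iteration\<close>

lemma b_ge_1: "1 \<le> b"
proof -
  have "(1::real) \<le> 2 ^ (2 * p + 2 * CARD('n))" by simp
  then show ?thesis unfolding b by linarith
qed

lemma good_subset: "good n \<subseteq> {1..2}" and good_Suc: "good (Suc n) \<subseteq> good n"
  by (auto simp: good_def)

lemma width_bounds: "width n > \<rho> / 2" "width n \<le> \<rho>" "width n - 2 * (\<rho> / 2 ^ (n + 3)) = width (Suc n)"
  "0 < \<rho> / 2 ^ (n + 3)" "\<rho> / 2 ^ (n + 3) \<le> 1" "2 * (\<rho> / 2 ^ (n + 3)) < width n"
proof -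
  have p1: "(1::real) \<le> 2 ^ n" by simp
  have p: "\<rho> \<le> \<rho> * 2 ^ n" "0 < \<rho> * 2 ^ n" using \<rho> p1 by simp_all
  show "width n > \<rho> / 2" using \<rho> by (simp add: width_def)
  show "width n \<le> \<rho>" using \<rho> p by (simp add: width_def field_simps)
  show 3: "width n - 2 * (\<rho> / 2 ^ (n + 3)) = width (Suc n)" by (simp add: width_def power_add field_simps)
  show "0 < \<rho> / 2 ^ (n + 3)" using \<rho> by simp
  have "\<rho> \<le> 2 ^ (n + 3)" by (rule order_trans [OF \<rho>(2)]) simp
  then show "\<rho> / 2 ^ (n + 3) \<le> 1" by (simp add: divide_le_eq)
  show "2 * (\<rho> / 2 ^ (n + 3)) < width n"
    using 3 \<rho> by (simp add: width_def [of "Suc n"]) (smt (verit) divide_pos_pos zero_less_power)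
qed

lemma kam_inv_0: "kam_inv 0"
proof -
  \<comment> \<open>The constants 3, 4 and 2 here and below bound both the size and the Lipschitz
    constant of \<open>x * sqrt x\<close>, \<open>x\<^sup>2\<close> and \<open>x\<close> on
    \<open>{1..2}\<close>.\<close>
  have xs: "bnd (good 0) \<rho>' 3 (\<lambda>x \<theta>. complex_of_real (x * sqrt x))" for \<rho>'
  proof (rule bnd_const)
    have s: "sqrt x \<le> 3 / 2" if "x \<in> good 0" for x
      by (rule real_le_lsqrt) (use that good_subset [of 0] in \<open>auto simp: power2_eq_square\<close>)
    fix x assume x: "x \<in> good 0"
    then have x12: "1 \<le> x" "x \<le> 2" using good_subset [of 0] by auto
    have "x * sqrt x \<le> 2 * (3 / 2)" using s [OF x] x12 by (intro mult_mono) auto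
    then show "norm (complex_of_real (x * sqrt x)) \<le> 3" unfolding norm_of_real using x12 by (simp add: abs_mult)
    fix y assume y: "y \<in> good 0"
    then have y12: "1 \<le> y" "y \<le> 2" using good_subset [of 0] by auto
    have "x * sqrt x - y * sqrt y = (x - y) * sqrt x + y * (sqrt x - sqrt y)" by (simp add: algebra_simps)
    also have "\<bar>\<dots>\<bar> \<le> \<bar>(x - y) * sqrt x\<bar> + \<bar>y * (sqrt x - sqrt y)\<bar>" by (rule abs_triangle_ineq)
    also have "\<dots> \<le> \<bar>x - y\<bar> * (3 / 2) + 2 * (\<bar>x - y\<bar> / 2)"
      unfolding abs_mult using s [OF x] x12 y12 abs_sqrt_diff_le [of x y]
      by (intro add_mono mult_mono) auto
    finally have "\<bar>x * sqrt x - y * sqrt y\<bar> \<le> 3 * \<bar>x - y\<bar>" by linarith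
    then show "norm (complex_of_real (x * sqrt x) - complex_of_real (y * sqrt y)) \<le> 3 * \<bar>x - y\<bar>"
      by (metis norm_of_real of_real_diff)
  qed
  have xq: "bnd (good 0) \<rho>' 4 (\<lambda>x \<theta>. complex_of_real (x\<^sup>2))" for \<rho>'
  proof (rule bnd_const)
    fix x assume x: "x \<in> good 0"
    then have x12: "1 \<le> x" "x \<le> 2" using good_subset [of 0] by auto
    have "x\<^sup>2 \<le> 2\<^sup>2" using x12 by (intro power_mono) auto
    then show "norm (complex_of_real (x\<^sup>2)) \<le> 4" unfolding norm_of_real by simp
    fix y assume y: "y \<in> good 0"
    then have y12: "1 \<le> y" "y \<le> 2" using good_subset [of 0] by auto
    have "x\<^sup>2 - y\<^sup>2 = (x + y) * (x - y)" by (simp add: power2_eq_square algebra_simps)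
    also have "\<bar>\<dots>\<bar> \<le> 4 * \<bar>x - y\<bar>"
      unfolding abs_mult using x12 y12 by (intro mult_right_mono) auto
    finally show "norm (complex_of_real (x\<^sup>2) - complex_of_real (y\<^sup>2)) \<le> 4 * \<bar>x - y\<bar>"
      by (metis norm_of_real of_real_diff)
  qed
  have xl: "bnd (good 0) \<rho>' 2 (\<lambda>x \<theta>. complex_of_real x)" for \<rho>'
  proof (rule bnd_const)
    fix x assume x: "x \<in> good 0"
    then show "norm (complex_of_real x) \<le> 2" using good_subset [of 0] by auto
    show "norm (complex_of_real x - complex_of_real y) \<le> 2 * \<bar>x - y\<bar>" for y
      by (metis abs_ge_zero mult_right_mono norm_of_real of_real_diff one_le_numeral mult_1)
  qed
  have w0: "width 0 = \<rho>" by (simp add: width_def)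
  have B1: "bnd (good 0) \<rho> C1 (\<lambda>x. Bf)" by (rule bnd_fixed [OF Bf(1,2) C1])
  have b1: "bnd (good 0) \<rho> C1 (\<lambda>x. bf)" by (rule bnd_fixed [OF bf(1,2) C1])
  have e1: "bnd (good 0) \<rho> (12 * \<kappa> * C1) (\<lambda>x \<theta>. 2 * \<i> * \<kappa> * (of_real (x * sqrt x) * Bf \<theta>))"
    by (rule bnd_cmult [OF bnd_mult [OF xs B1]]) (use \<kappa> C1 in \<open>auto simp: norm_mult\<close>)
  have e2: "bnd (good 0) \<rho> (8 * C1\<^sup>2) (\<lambda>x \<theta>. \<delta> * (of_real (x\<^sup>2) * (Bf \<theta> * Bf \<theta>)))"
  proof -
    have BB: "bnd (good 0) \<rho> (C1\<^sup>2) (\<lambda>x \<theta>. Bf \<theta> * Bf \<theta>)"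
      using Bf(2) C1 by (intro bnd_fixed hol_per_mult Bf) (auto simp: norm_mult power2_eq_square intro!: mult_mono)
    have "\<delta> * (8 * C1\<^sup>2) \<le> 1 * (8 * C1\<^sup>2)" using \<delta> by (intro mult_right_mono) auto
    then show ?thesis
      by (intro bnd_cmult [OF bnd_mult [OF xq BB]]) (use \<delta> in auto)
  qed
  have e0: "bnd (good 0) \<rho> (err_size 0) (err 0)"
    unfolding st_0
  proof (rule bnd_cmult [OF bnd_add [OF e1 e2]])
    have "\<delta> ^ 3 * (12 * \<kappa> * C1 + 8 * C1\<^sup>2) = \<delta>\<^sup>2 * (\<delta> * (12 * \<kappa> * C1 + 8 * C1\<^sup>2))"
      by (simp add: power3_eq_cube power2_eq_square)
    also have "\<dots> \<le> \<delta>\<^sup>2 * (h / A\<^sup>2)" by (intro mult_left_mono small) auto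
    finally show "norm (complex_of_real (\<delta> ^ 3)) * (12 * \<kappa> * C1 + 8 * C1\<^sup>2) \<le> err_size 0"
      using \<delta> by (simp add: err_size_def norm_power)
  qed
  have p0: "bnd (good 0) \<rho> (1 / 2 + 2 * h * (1 - 1 / 2 ^ 0)) (pot 0)"
    unfolding st_0
  proof (rule bnd_cmult [OF bnd_mult [OF xl b1]])
    have "\<delta>\<^sup>2 * (2 * 2 * C1) \<le> \<delta> * (4 * C1)"
      using \<delta> C1 by (simp add: power2_eq_square mult_right_mono mult_left_le)
    then show "norm (complex_of_real (\<delta>\<^sup>2)) * (2 * 2 * C1) \<le> 1 / 2 + 2 * h * (1 - 1 / 2 ^ 0)"
      using small(2) \<delta> by (simp add: norm_power)
  qed (use C1 in auto)
  have z: "bnd (good 0) \<rho> 0 (\<lambda>x (\<theta> :: complex ^ 'n). 0)" by (rule bnd_const) auto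
  have dp: "((\<lambda>t. pot 0 x (line \<omega> t)) has_vector_derivative ric 0 x (line \<omega> t) - mu 0 x) (at t)" for x t
    unfolding st_0 using has_vector_derivative_mult_right [OF has_vector_derivative_mult_right [OF bf(3) [of t], of "of_real x"], of "of_real (\<delta>\<^sup>2)"]
    by simp
  have dr: "((\<lambda>t. ric 0 x (line \<omega> t)) has_vector_derivative
        err 0 x (line \<omega> t) - (ric 0 x (line \<omega> t))\<^sup>2 - of_real (\<delta>\<^sup>2 * x) * F (line \<omega> t)) (at t)"
    if "x \<in> good 0" for x t
  proof -
    have x: "0 \<le> x" using that good_subset [of 0] by auto
    let ?s = "complex_of_real (sqrt x)" and ?B = "Bf (line \<omega> t)" and ?F = "F (line \<omega> t)"
      and ?d = "complex_of_real \<delta>" and ?k = "complex_of_real \<kappa>"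
    have s: "complex_of_real x = ?s\<^sup>2" using x by (metis of_real_power real_sqrt_pow2)
    have "((\<lambda>t. ric 0 x (line \<omega> t)) has_vector_derivative of_real (\<delta>\<^sup>2) * (of_real x * (- (?F - ?k\<^sup>2)))) (at t)"
      unfolding st_0
      using has_vector_derivative_add [OF has_vector_derivative_const [of "\<i> * of_real (\<delta> * \<kappa> * sqrt x)" "at t"]
        has_vector_derivative_mult_right [OF has_vector_derivative_mult_right [OF Bf(3) [of t], of "of_real x"], of "of_real (\<delta>\<^sup>2)"]]
      by simp
    \<comment> \<open>Squaring \<open>ric 0\<close> gives
      \<open>- \<delta>\<^sup>2 * \<kappa>\<^sup>2 * x\<close>, which cancels the mean of the
      potential, while the derivative of \<open>Bf\<close> cancels its oscillating part. What is
      left is the cross term of order \<open>\<delta> ^ 3\<close> and a square of order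
      \<open>\<delta> ^ 4\<close>.\<close>
    moreover have "of_real (\<delta>\<^sup>2) * (of_real x * (- (?F - ?k\<^sup>2)))
      = err 0 x (line \<omega> t) - (ric 0 x (line \<omega> t))\<^sup>2 - of_real (\<delta>\<^sup>2 * x) * ?F"
    proof -
      have i2: "\<i>\<^sup>2 = - 1" by simp
      have "?d\<^sup>2 * (?s\<^sup>2 * (- (?F - ?k\<^sup>2))) = ?d ^ 3 * (2 * \<i> * ?k * (?s ^ 3 * ?B) + ?d * (?s ^ 4 * (?B * ?B)))
          - (\<i> * (?d * ?k * ?s) + ?d\<^sup>2 * (?s\<^sup>2 * ?B))\<^sup>2 - ?d\<^sup>2 * ?s\<^sup>2 * ?F"
        using i2 by algebra
      moreover have "complex_of_real (x * sqrt x) = ?s ^ 3" "complex_of_real (x\<^sup>2) = ?s ^ 4"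
        using s by (simp_all add: power2_eq_square power3_eq_cube power4_eq_xxxx)
      ultimately show ?thesis unfolding st_0 by (simp add: s)
    qed
    ultimately show ?thesis by simp
  qed
  show ?thesis
    unfolding kam_inv_def using e0 p0 z dp dr by (simp add: w0)
qed

text \<open>\<open>mu n\<close> differs from \<open>\<i> * \<delta> * \<kappa> * sqrt x\<close> by a
  drift whose size and Lipschitz constant are at most \<open>\<delta> * \<kappa> / 8\<close>. The
  square root has slope at least 1/3 here, and 1/3 - 1/8 exceeds 1/8.\<close>

lemma mu_bounds:
  assumes "kam_inv n" "x \<in> good n"
  shows "\<delta> * \<kappa> / 2 \<le> Im (mu n x)"
    and "y \<in> good n \<Longrightarrow> norm (mu n x - mu n y) \<le> \<delta> * \<kappa> * \<bar>x - y\<bar>"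
    and "Im (mu n x) \<le> 2 * (\<delta> * \<kappa>)"
    and "y \<in> good n \<Longrightarrow> y \<le> x \<Longrightarrow> \<delta> * \<kappa> * (x - y) / 8 \<le> Im (mu n x) - Im (mu n y)"
proof -
  let ?z = "2 * \<delta> * h * (1 - 1 / 2 ^ n)"
  have b: "bnd (good n) (width n) ?z (\<lambda>x (\<theta> :: complex ^ 'n). mu n x - mu 0 x)"
    using assms(1) by (simp add: kam_inv_def)
  have z: "?z \<le> \<delta> * \<kappa> / 8"
  proof -
    have "?z \<le> 2 * \<delta> * h * 1" using \<delta> h by (intro mult_left_mono) auto
    also have "\<dots> \<le> 2 * \<delta> * (\<kappa> / 16)" using \<delta> h by simp
    finally show ?thesis by simp
  qed
  have in0: "(0 :: complex ^ 'n) \<in> ostrip (width n)"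
    using width_bounds(1) [of n] \<rho> by (simp add: ostrip_def)
  have x: "1 \<le> x" "x \<le> 2" using assms(2) good_subset [of n] by auto
  have n1: "norm (mu n x - mu 0 x) \<le> \<delta> * \<kappa> / 8"
    using bndD(2) [OF b assms(2) in0] z by linarith
  have i1: "\<bar>Im (mu n x) - \<delta> * \<kappa> * sqrt x\<bar> \<le> \<delta> * \<kappa> / 8"
    using order_trans [OF abs_Im_le_cmod n1] by (simp add: st_0)
  have s: "1 \<le> sqrt x" "sqrt x \<le> 3 / 2"
    using x by simp (rule real_le_lsqrt, use x in \<open>simp_all add: power2_eq_square\<close>)
  have ds: "\<delta> * \<kappa> * 1 \<le> \<delta> * \<kappa> * sqrt x" "\<delta> * \<kappa> * sqrt x \<le> \<delta> * \<kappa> * (3 / 2)"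
    using s \<delta> \<kappa> by (intro mult_left_mono; simp)+
  have dk: "0 < \<delta> * \<kappa>" using \<delta> \<kappa> by simp
  show "\<delta> * \<kappa> / 2 \<le> Im (mu n x)" using i1 ds dk by linarith
  show "Im (mu n x) \<le> 2 * (\<delta> * \<kappa>)" using i1 ds dk by linarith
  {
    assume y: "y \<in> good n"
    then have y12: "1 \<le> y" "y \<le> 2" using good_subset [of n] by auto
    have n2: "norm ((mu n x - mu 0 x) - (mu n y - mu 0 y)) \<le> \<delta> * \<kappa> / 8 * \<bar>x - y\<bar>"
      using bndD(3) [OF b assms(2) y in0] z by (meson abs_ge_zero mult_right_mono order_trans)
    have n0: "norm (mu 0 x - mu 0 y) \<le> \<delta> * \<kappa> * (\<bar>x - y\<bar> / 2)"
    proof -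
      have "mu 0 x - mu 0 y = \<i> * of_real (\<delta> * \<kappa> * (sqrt x - sqrt y))"
        by (simp add: st_0 algebra_simps)
      then have "norm (mu 0 x - mu 0 y) = \<delta> * \<kappa> * \<bar>sqrt x - sqrt y\<bar>"
        using \<delta> \<kappa> by (simp only: norm_mult norm_of_real) (simp add: abs_mult)
      also have "\<dots> \<le> \<delta> * \<kappa> * (\<bar>x - y\<bar> / 2)"
        using abs_sqrt_diff_le [of x y] x y12 dk by (intro mult_left_mono) auto
      finally show ?thesis .
    qed
    have "mu n x - mu n y = ((mu n x - mu 0 x) - (mu n y - mu 0 y)) + (mu 0 x - mu 0 y)" by simp
    also have "norm \<dots> \<le> \<delta> * \<kappa> / 8 * \<bar>x - y\<bar> + \<delta> * \<kappa> * (\<bar>x - y\<bar> / 2)"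
      by (intro norm_triangle_mono n2 n0)
    also have "\<dots> \<le> \<delta> * \<kappa> * \<bar>x - y\<bar>"
      using dk mult_nonneg_nonneg [of "\<delta> * \<kappa>" "\<bar>x - y\<bar>"] by (simp add: field_simps)
    finally show "norm (mu n x - mu n y) \<le> \<delta> * \<kappa> * \<bar>x - y\<bar>" .
    assume yx: "y \<le> x"
    have "\<bar>(Im (mu n x) - \<delta> * \<kappa> * sqrt x) - (Im (mu n y) - \<delta> * \<kappa> * sqrt y)\<bar> \<le> \<delta> * \<kappa> / 8 * (x - y)"
      using order_trans [OF abs_Im_le_cmod n2] yx by (simp add: st_0)
    moreover have "\<delta> * \<kappa> * ((x - y) / 3) \<le> \<delta> * \<kappa> * (sqrt x - sqrt y)"
      using sqrt_diff_ge [of y x] x y12 yx dk by (intro mult_left_mono) auto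
    moreover have "0 \<le> \<delta> * \<kappa> * (x - y)" using dk yx by simp
    ultimately show "\<delta> * \<kappa> * (x - y) / 8 \<le> Im (mu n x) - Im (mu n y)"
      by (simp add: right_diff_distrib)
  }
qed

text \<open>This is \<open>err_size n\<close> times the loss \<open>A * b ^ n / \<delta>\<close> of
  one Newton step.\<close>

definition incr_size :: "nat \<Rightarrow> real" where "incr_size n = \<delta> * h / (2 ^ n * A * b ^ n)"

text \<open>The last bound closes the induction: squaring gains a factor \<open>h\<close>, which by
  \<open>4 * h * b\<^sup>2 \<le> 1\<close> pays for two more powers of \<open>b\<close>, one more of
  2, and the 2 from \<open>bnd_mult\<close>.\<close>

lemma incr_size_bounds: "0 \<le> incr_size n" "incr_size n \<le> \<delta> * h / 2 ^ n" "incr_size n * (A * b ^ n) = \<delta> * h / 2 ^ n" "2 * incr_size n * incr_size n \<le> err_size (Suc n)"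
proof -
  have Ab: "1 \<le> A * b ^ n" using A(1) b_ge_1 by (simp add: mult_ge1_I)
  show D0: "0 \<le> incr_size n" using \<delta> h A b_ge_1 by (simp add: incr_size_def)
  show eq: "incr_size n * (A * b ^ n) = \<delta> * h / 2 ^ n"
    using A b_ge_1 by (simp add: incr_size_def)
  show "incr_size n \<le> \<delta> * h / 2 ^ n"
    using mult_left_mono [OF Ab D0] unfolding eq by simp
  have b0: "0 < b" "0 < A" using b_ge_1 A by auto
  \<comment> \<open>Cleared of common factors, the last claim is
    \<open>4 * h * b\<^sup>2 \<le> 2 ^ n\<close>; the rest restores the denominators.\<close>
  have "4 * h * b\<^sup>2 * 2 ^ n \<le> 1 * 4 ^ n"
  proof (rule mult_mono)
    show "4 * h * b\<^sup>2 \<le> 1" using h(2) b0 by (simp add: field_simps)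
    show "(2::real) ^ n \<le> 4 ^ n" by (rule power_mono) auto
  qed auto
  then have "4 * h * b\<^sup>2 * 2 ^ n \<le> 2 ^ n * 2 ^ n" by (simp add: power_mult_distrib [symmetric])
  then have "4 * h * b\<^sup>2 \<le> 2 ^ n" by simp
  then have "\<delta>\<^sup>2 * h * (4 * h * b\<^sup>2) \<le> \<delta>\<^sup>2 * h * 2 ^ n" using h by (intro mult_left_mono) auto
  then have "2 * (\<delta> * h) * (\<delta> * h) * (2 * b\<^sup>2) \<le> \<delta>\<^sup>2 * h * 2 ^ n" by (simp add: power2_eq_square mult_ac)
  then have "2 * (\<delta> * h) * (\<delta> * h) \<le> \<delta>\<^sup>2 * h * 2 ^ n / (2 * b\<^sup>2)"
    using b0 by (simp add: pos_le_divide_eq)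
  then have "2 * (\<delta> * h) * (\<delta> * h) / ((2 ^ n * A * b ^ n) * (2 ^ n * A * b ^ n))
      \<le> \<delta>\<^sup>2 * h * 2 ^ n / (2 * b\<^sup>2) / ((2 ^ n * A * b ^ n) * (2 ^ n * A * b ^ n))"
    using b0 by (intro divide_right_mono) auto
  also have "\<dots> = err_size (Suc n)"
  proof -
    have "b ^ (2 * Suc n) = b ^ n * b ^ n * b\<^sup>2"
      unfolding power_add [symmetric] by (rule arg_cong [where f = "(^) b"]) simp
    then have e: "err_size (Suc n) = \<delta>\<^sup>2 * h / (2 * 2 ^ n * A\<^sup>2 * (b ^ n * b ^ n * b\<^sup>2))"
      by (simp add: err_size_def)
    have "\<delta>\<^sup>2 * h * T / (2 * b\<^sup>2) / ((T * A * \<beta>) * (T * A * \<beta>)) = \<delta>\<^sup>2 * h / (2 * T * A\<^sup>2 * (\<beta> * \<beta> * b\<^sup>2))"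
      if "T > 0" for T \<beta> :: real
    proof -
      have "2 * b\<^sup>2 * ((T * A * \<beta>) * (T * A * \<beta>)) = (2 * T * A\<^sup>2 * (\<beta> * \<beta> * b\<^sup>2)) * T"
        by (simp add: power2_eq_square)
      moreover have "T \<noteq> 0" using that by simp
      ultimately show ?thesis
        unfolding divide_divide_eq_left by (metis mult_divide_mult_cancel_right)
    qed
    then show ?thesis unfolding e using b0 by (simp add: power2_eq_square [of A])
  qed
  finally show "2 * incr_size n * incr_size n \<le> err_size (Suc n)" by (simp add: incr_size_def mult_ac)
qed

text \<open>Separates the part independent of the step, which goes into \<open>A\<close>, from the
  part that grows geometrically, which goes into \<open>b ^ n\<close>.\<close>

lemma width_power:
  "sol_const TYPE('n) p / (\<rho> / 2 ^ (n + 3)) ^ (2 * p + 2 * CARD('n))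
    = (sol_const TYPE('n) p * (8 / \<rho>) ^ (2 * p + 2 * CARD('n))) * (2 ^ (2 * p + 2 * CARD('n))) ^ n"
proof -
  have "(\<rho> / 2 ^ (n + 3)) ^ N = 1 / ((8 / \<rho>) ^ N * (2 ^ N) ^ n)" for N
    using \<rho> by (simp add: power_add power_divide power_mult_distrib power_mult [symmetric] mult.commute)
  then show ?thesis by simp
qed

lemma sol_const_nonneg: "0 \<le> sol_const TYPE('n) p"
  using wt_sum_nonneg [where 'n = 'n] by (simp add: sol_const_def)

lemma incr_bnd:
  assumes inv: "kam_inv n"
  shows "bnd (good (Suc n)) (width n - \<rho> / 2 ^ (n + 3)) (incr_size n) (incr n)"
    and "x \<in> good (Suc n) \<Longrightarrow> \<i> * dotp k \<omega> + 2 * mu n x \<noteq> 0"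
    and "\<exists>K. \<forall>x\<in>good (Suc n). \<forall>k. norm (inverse (\<i> * dotp k \<omega> + 2 * mu n x)) \<le> K * wt k ^ p"
proof -
  let ?X = "good (Suc n)" and ?\<sigma> = "\<rho> / 2 ^ (n + 3)" and ?N = "2 * p + 2 * CARD('n)"
  \<comment> \<open>Both kinds of divisors are covered: \<open>1 / w0\<close> serves the modes
    \<open>k \<noteq> 0\<close> and \<open>1 / \<kappa>\<close> mode 0. The factor
    \<open>1 / \<delta>\<close> in \<open>K\<close> is due to mode 0, where the divisor is of order
    \<open>\<delta> * \<kappa>\<close>.\<close>
  define K0 where "K0 = 1 / w0 + 1 / \<kappa>"
  have K0: "0 < K0" "1 / w0 \<le> K0" "1 / \<kappa> \<le> K0" using w0 \<kappa> by (auto simp: K0_def add_pos_pos)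
  define K where "K = 2 ^ n * K0 / \<delta>"
  have Kpos: "0 \<le> K" using K0 \<delta> by (simp add: K_def)
  have two: "(1::real) \<le> 2 ^ n" by simp
  have wtp: "1 \<le> wt k ^ p" for k :: "int ^ 'n" by simp
  have low: "inverse (K * wt k ^ p) \<le> norm (\<i> * dotp k \<omega> + 2 * mu n x)" if x: "x \<in> ?X" for x k
  proof (cases "k = 0")
    case True
    have xn: "x \<in> good n" using x good_Suc by blast
    have "K * wt k ^ p \<ge> 1 * K0 / \<delta> * 1"
      unfolding K_def using K0 \<delta> two by (intro mult_mono divide_right_mono mult_right_mono wtp) auto
    moreover have "1 / \<kappa> / \<delta> \<le> K0 / \<delta>" using K0(3) \<delta> by (intro divide_right_mono) auto
    ultimately have "1 / (\<delta> * \<kappa>) \<le> K * wt k ^ p" by (simp add: mult.commute)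
    moreover have dk: "0 < \<delta> * \<kappa>" using \<delta> \<kappa> by simp
    ultimately have "inverse (K * wt k ^ p) \<le> \<delta> * \<kappa>"
      using le_imp_inverse_le [of "1 / (\<delta> * \<kappa>)" "K * wt k ^ p"] by simp
    also have "\<dots> \<le> 2 * Im (mu n x)" using mu_bounds(1) [OF inv xn] by simp
    also have "\<dots> \<le> norm (2 * mu n x)" using abs_Im_le_cmod [of "2 * mu n x"] by simp
    finally show ?thesis using True by (simp add: dotp_def)
  next
    case False
    have "w0 / (2 ^ n * wt k ^ p) \<le> \<bar>dotp k \<omega> + 2 * Im (mu n x)\<bar>"
      using x False by (auto simp: good_def)
    also have "\<dots> = \<bar>Im (\<i> * dotp k \<omega> + 2 * mu n x)\<bar>" by simp
    also have "\<dots> \<le> norm (\<i> * dotp k \<omega> + 2 * mu n x)" by (rule abs_Im_le_cmod)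
    finally have 1: "w0 / (2 ^ n * wt k ^ p) \<le> norm (\<i> * dotp k \<omega> + 2 * mu n x)" .
    have "2 ^ n * wt k ^ p / w0 \<le> K * wt k ^ p"
    proof -
      have "1 / w0 * 1 \<le> K0 * (1 / \<delta>)" using K0 w0 \<delta> by (intro mult_mono) auto
      then have "(2 ^ n * wt k ^ p) * (1 / w0) \<le> (2 ^ n * wt k ^ p) * (K0 / \<delta>)"
        by (intro mult_left_mono) auto
      then show ?thesis by (simp add: K_def mult_ac)
    qed
    then have "inverse (K * wt k ^ p) \<le> inverse (2 ^ n * wt k ^ p / w0)"
      using w0 by (intro le_imp_inverse_le) auto
    then show ?thesis using 1 by simp
  qed
  have Kw: "0 < K * wt k ^ p" for k :: "int ^ 'n" using K0 \<delta> by (simp add: K_def)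
  show nz: "\<i> * dotp k \<omega> + 2 * mu n x \<noteq> 0" if "x \<in> ?X" for x k
  proof
    assume "\<i> * dotp k \<omega> + 2 * mu n x = 0"
    then have "inverse (K * wt k ^ p) \<le> 0" using low [OF that, of k] by (simp only: norm_zero)
    then show False using positive_imp_inverse_positive [OF Kw [of k]] by linarith
  qed
  have Kb: "norm (inverse (\<i> * dotp k \<omega> + 2 * mu n x)) \<le> K * wt k ^ p" if "x \<in> ?X" for x k
  proof -
    have "inverse (norm (\<i> * dotp k \<omega> + 2 * mu n x)) \<le> inverse (inverse (K * wt k ^ p))"
      by (intro le_imp_inverse_le low [OF that] positive_imp_inverse_positive Kw)
    then show ?thesis by (simp add: norm_inverse)
  qed
  then show "\<exists>K. \<forall>x\<in>?X. \<forall>k. norm (inverse (\<i> * dotp k \<omega> + 2 * mu n x)) \<le> K * wt k ^ p" by blast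
  have e: "bnd ?X (width n) (err_size n) (err n)" and M: "bnd ?X (width n) 1 (pot n)"
  proof -
    show "bnd ?X (width n) (err_size n) (err n)"
      using inv good_Suc [of n] unfolding kam_inv_def by (blast intro: bnd_mono order_refl)
    have "2 * h * (1 - 1 / 2 ^ n) \<le> 2 * h * 1" using h by (intro mult_left_mono) auto
    then have "1 / 2 + 2 * h * (1 - 1 / 2 ^ n) \<le> 1" using h by linarith
    then show "bnd ?X (width n) 1 (pot n)"
      using inv good_Suc [of n] unfolding kam_inv_def by (blast intro: bnd_mono order_refl)
  qed
  have E0: "0 \<le> err_size n" using h A b_ge_1 by (simp add: err_size_def)
  have L: "norm (2 * mu n x - 2 * mu n y) \<le> (2 * \<delta> * \<kappa>) * \<bar>x - y\<bar>" if "x \<in> ?X" "y \<in> ?X" for x y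
  proof -
    have "norm (2 * (mu n x - mu n y)) \<le> 2 * (\<delta> * \<kappa> * \<bar>x - y\<bar>)"
      unfolding norm_mult using mu_bounds(2) [OF inv] that good_Suc [of n] by fastforce
    then show ?thesis by (simp add: right_diff_distrib mult.assoc)
  qed
  \<comment> \<open>The Lipschitz constant \<open>2 * \<delta> * \<kappa>\<close> of the divisors
    cancels one of the two factors \<open>1 / \<delta>\<close> in \<open>K\<^sup>2\<close>, so the
    parameter estimate loses no more powers of \<open>\<delta>\<close> than the supremum
    estimate.\<close>
  have KL: "K + (2 * \<delta> * \<kappa>) * K\<^sup>2 \<le> 4 ^ n * (K0 + 2 * \<kappa> * K0\<^sup>2) / \<delta>"
  proof -
    have "(2::real) ^ n \<le> 4 ^ n" by (rule power_mono) auto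
    then have "K \<le> 4 ^ n * K0 / \<delta>"
      unfolding K_def using K0 \<delta> by (intro divide_right_mono mult_right_mono) auto
    moreover have "(2 * \<delta> * \<kappa>) * K\<^sup>2 = 4 ^ n * (2 * \<kappa> * K0\<^sup>2) / \<delta>"
      using \<delta> by (simp add: K_def power2_eq_square power_mult_distrib [symmetric] field_simps)
    ultimately show ?thesis by (simp add: distrib_left add_divide_distrib)
  qed
  have "4 * (exp 4)\<^sup>2 * err_size n * (K + (2 * \<delta> * \<kappa>) * K\<^sup>2) * (sol_const TYPE('n) p / ?\<sigma> ^ ?N)
      \<le> 4 * (exp 4)\<^sup>2 * err_size n * (4 ^ n * (K0 + 2 * \<kappa> * K0\<^sup>2) / \<delta>) * (sol_const TYPE('n) p / ?\<sigma> ^ ?N)"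
    using E0 sol_const_nonneg \<rho> by (intro mult_right_mono mult_left_mono KL) auto
  also have "\<dots> = (4 * (exp 4)\<^sup>2 * (K0 + 2 * \<kappa> * K0\<^sup>2) * (sol_const TYPE('n) p * (8 / \<rho>) ^ ?N)) * (err_size n / \<delta> * (4 ^ n * (2 ^ ?N) ^ n))"
    unfolding width_power by (simp add: mult_ac)
  also have "\<dots> \<le> A * (err_size n / \<delta> * (4 ^ n * (2 ^ ?N) ^ n))"
    using A(2) E0 \<delta> unfolding K0_def by (intro mult_right_mono) auto
  also have "4 ^ n * (2 ^ ?N) ^ n = b ^ n" unfolding b by (simp only: power_mult_distrib)
  also have "A * (err_size n / \<delta> * b ^ n) = incr_size n"
  proof -
    have "A * (d * d * h / (T * (A * A) * (\<beta> * \<beta>)) / d * \<beta>) = d * h / (T * A * \<beta>)"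
      if "0 < T" "0 < \<beta>" "0 < d" for T \<beta> d :: real
      using that A(1) by simp
    moreover have "b ^ (2 * n) = b ^ n * b ^ n"
      unfolding power_add [symmetric] by (rule arg_cong [where f = "(^) b"]) simp
    ultimately show ?thesis
      using \<delta> b_ge_1 unfolding err_size_def incr_size_def power2_eq_square by simp
  qed
  finally show "bnd ?X (width n - ?\<sigma>) (incr_size n) (incr n)"
    unfolding incr_def
    by (intro newton_step_bnd [OF e M E0 width_bounds(4,5) _ Kb Kpos _ L nz])
      (use width_bounds(4,6) [of n] \<delta> \<kappa> in auto)
qed

text \<open>Here the divisors are \<open>dotp k \<omega>\<close> without the shift, so the loss is
  \<open>A * b ^ n\<close> with no \<open>1 / \<delta>\<close>; the denominator of
  \<open>incr_size n\<close> compensates it. This is where the second share of the width is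
  spent.\<close>

lemma pot_incr_bnd:
  assumes inv: "kam_inv n"
  shows "bnd (good (Suc n)) (width (Suc n)) (h / 2 ^ n) (\<lambda>x. sol \<omega> 0 (incr n x))"
proof -
  let ?X = "good (Suc n)" and ?\<sigma> = "\<rho> / 2 ^ (n + 3)" and ?N = "2 * p + 2 * CARD('n)"
  have a: "bnd ?X (width n - ?\<sigma> - ?\<sigma>) (incr_size n * (K1 + 0 * K1\<^sup>2) * (sol_const TYPE('n) p / ?\<sigma> ^ ?N))
      (\<lambda>x. sol \<omega> 0 (incr n x))"
    by (rule bnd_sol [OF incr_bnd(1) [OF inv] incr_size_bounds(1) width_bounds(4,5)])
      (use dio K1 width_bounds(6) [of n] in auto)
  have b: "incr_size n * (K1 + 0 * K1\<^sup>2) * (sol_const TYPE('n) p / ?\<sigma> ^ ?N) \<le> h / 2 ^ n"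
  proof -
    have "incr_size n * (K1 + 0 * K1\<^sup>2) * (sol_const TYPE('n) p / ?\<sigma> ^ ?N)
        = incr_size n * ((K1 * (sol_const TYPE('n) p * (8 / \<rho>) ^ ?N)) * (2 ^ ?N) ^ n)"
      unfolding width_power by (simp add: mult_ac)
    also have "\<dots> \<le> incr_size n * (A * b ^ n)"
    proof (intro mult_left_mono mult_mono A(3) incr_size_bounds(1) power_mono)
      show "2 ^ ?N \<le> b" unfolding b by simp
    qed (use A in auto)
    also have "\<dots> \<le> h / 2 ^ n"
      unfolding incr_size_bounds(3) using \<delta> h by (intro divide_right_mono) (auto intro: mult_left_le_one_le)
    finally show ?thesis .
  qed
  show ?thesis
    by (rule bnd_mono [OF a _ _ b]) (use width_bounds(3) [of n] in auto)
qed

lemma kam_step: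
  assumes inv: "kam_inv n"
  shows "kam_inv (Suc n)"
proof -
  let ?X = "good (Suc n)" and ?\<sigma> = "\<rho> / 2 ^ (n + 3)" and ?\<rho>' = "width (Suc n)"
  have w: "?\<rho>' \<le> width n" "?\<rho>' \<le> width n - ?\<sigma>" using width_bounds(3,4) [of n] by linarith+
  have d: "bnd ?X ?\<rho>' (incr_size n) (incr n)"
    by (rule bnd_mono [OF incr_bnd(1) [OF inv]]) (use w in auto)
  have d': "bnd ?X ?\<rho>' (\<delta> * h / 2 ^ n) (incr n)"
    by (rule bnd_mono [OF d]) (use incr_size_bounds in auto)
  have dpos: "0 < width n - ?\<sigma>" using width_bounds(4,6) [of n] by linarith
  have I: "bnd ?X ?\<rho>' B f" if "bnd (good n) (width n) B f" for B and f :: "real \<Rightarrow> complex ^ 'n \<Rightarrow> complex"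
    by (rule bnd_mono [OF that good_Suc w(1)]) simp
  have tel: "1 / 2 + 2 * h * (1 - 1 / 2 ^ n) + h / 2 ^ n = 1 / 2 + 2 * h * (1 - 1 / 2 ^ Suc n)"
    "2 * \<delta> * h * (1 - 1 / 2 ^ n) + \<delta> * h / 2 ^ n = 2 * \<delta> * h * (1 - 1 / 2 ^ Suc n)"
    by (simp_all add: field_simps)
  have 1: "bnd ?X ?\<rho>' (err_size (Suc n)) (err (Suc n))"
    unfolding st_Suc
    by (rule bnd_mono [OF bnd_mult [OF d d]]) (use incr_size_bounds [of n] in auto)
  have 2: "bnd ?X ?\<rho>' (1 / 2 + 2 * h * (1 - 1 / 2 ^ Suc n)) (pot (Suc n))"
    using bnd_add [OF I pot_incr_bnd [OF inv], of "1 / 2 + 2 * h * (1 - 1 / 2 ^ n)" "pot n"] inv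
    unfolding st_Suc tel kam_inv_def by blast
  have 3: "bnd ?X ?\<rho>' (2 * \<delta> * h * (1 - 1 / 2 ^ Suc n)) (\<lambda>x (\<theta> :: complex ^ 'n). mu (Suc n) x - mu 0 x)"
  proof -
    have "bnd ?X ?\<rho>' (\<delta> * h / 2 ^ n) (\<lambda>x (\<theta> :: complex ^ 'n). fourier (incr n x) 0)"
      using bnd_mono [OF bnd_fourier_zero [OF incr_bnd(1) [OF inv] dpos], of ?X ?\<rho>' ?\<rho>' "\<delta> * h / 2 ^ n"] incr_size_bounds(2) by auto
    from bnd_add [OF I this, of "2 * \<delta> * h * (1 - 1 / 2 ^ n)" "\<lambda>x \<theta>. mu n x - mu 0 x"] inv
    have "bnd ?X ?\<rho>' (2 * \<delta> * h * (1 - 1 / 2 ^ Suc n)) (\<lambda>x (\<theta> :: complex ^ 'n). mu n x - mu 0 x + fourier (incr n x) 0)"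
      unfolding tel kam_inv_def by blast
    then show ?thesis unfolding st_Suc by (simp add: algebra_simps)
  qed
  have 4: "bnd ?X ?\<rho>' (2 * \<delta> * h * (1 - 1 / 2 ^ Suc n)) (\<lambda>x \<theta>. ric (Suc n) x \<theta> - ric 0 x \<theta>)"
  proof -
    from bnd_add [OF I d', of "2 * \<delta> * h * (1 - 1 / 2 ^ n)" "\<lambda>x \<theta>. ric n x \<theta> - ric 0 x \<theta>"] inv
    have "bnd ?X ?\<rho>' (2 * \<delta> * h * (1 - 1 / 2 ^ Suc n)) (\<lambda>x \<theta>. ric n x \<theta> - ric 0 x \<theta> + incr n x \<theta>)"
      unfolding tel kam_inv_def by blast
    then show ?thesis unfolding st_Suc by (simp add: algebra_simps)
  qed
  have 5: "((\<lambda>t. pot (Suc n) x (line \<omega> t)) has_vector_derivative ric (Suc n) x (line \<omega> t) - mu (Suc n) x) (at t)"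
    if x: "x \<in> ?X" for x t
  proof -
    have x': "x \<in> good n" using x good_Suc by blast
    have a: "((\<lambda>t. pot n x (line \<omega> t)) has_vector_derivative ric n x (line \<omega> t) - mu n x) (at t)"
      using inv x' by (simp add: kam_inv_def)
    \<comment> \<open>The primitive drops the mean of the increment, and \<open>mu (Suc n)\<close>
      picks it up, so \<open>pot\<close> remains a primitive of \<open>ric - mu\<close>.\<close>
    have "((\<lambda>t. sol \<omega> 0 (incr n x) (line \<omega> t)) has_vector_derivative
        incr n x (line \<omega> t) - 0 * sol \<omega> 0 (incr n x) (line \<omega> t) - (if (0::complex) = 0 then fourier (incr n x) 0 else 0)) (at t)"
      by (rule sol_flow_aux [OF bndD(1) [OF incr_bnd(1) [OF inv] x] dpos bndD(2) [OF incr_bnd(1) [OF inv] x], where p = p and K = K1])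
        (use dio dio0 in auto)
    from has_vector_derivative_add [OF a this] show ?thesis
      unfolding st_Suc by (simp add: algebra_simps)
  qed
  have 6: "((\<lambda>t. ric (Suc n) x (line \<omega> t)) has_vector_derivative
        err (Suc n) x (line \<omega> t) - (ric (Suc n) x (line \<omega> t))\<^sup>2 - of_real (\<delta>\<^sup>2 * x) * F (line \<omega> t)) (at t)"
    if x: "x \<in> ?X" for x t
  proof -
    have x': "x \<in> good n" using x good_Suc by blast
    obtain K where K: "\<And>k. norm (inverse (\<i> * dotp k \<omega> + 2 * mu n x)) \<le> K * wt k ^ p"
      using incr_bnd(3) [OF inv] x by blast
    have e: "bnd (good n) (width n) (err_size n) (err n)" using inv by (simp add: kam_inv_def)
    have "2 * h * (1 - 1 / 2 ^ n) \<le> 2 * h * 1" using h by (intro mult_left_mono) auto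
    then have "1 / 2 + 2 * h * (1 - 1 / 2 ^ n) \<le> 1" using h by linarith
    then have M: "bnd (good n) (width n) 1 (pot n)"
      using inv unfolding kam_inv_def by (blast intro: bnd_mono order_refl)
    have a: "((\<lambda>t. ric n x (line \<omega> t)) has_vector_derivative
        err n x (line \<omega> t) - (ric n x (line \<omega> t))\<^sup>2 - of_real (\<delta>\<^sup>2 * x) * F (line \<omega> t)) (at t)"
      using inv x' by (simp add: kam_inv_def)
    have wpos: "0 < width n" using width_bounds(1) [of n] \<rho> by linarith
    \<comment> \<open>The correction contributes \<open>- e - 2 * m * d\<close>; together with
      \<open>e - m\<^sup>2\<close> this is \<open>d\<^sup>2 - (m + d)\<^sup>2\<close>.\<close>
    have b: "((\<lambda>t. incr n x (line \<omega> t)) has_vector_derivative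
        - err n x (line \<omega> t) - 2 * ric n x (line \<omega> t) * incr n x (line \<omega> t)) (at t)"
      unfolding incr_def
      by (rule newton_step_flow [OF bndD(1,2) [OF e x'] bndD(1,2) [OF M x'] wpos K incr_bnd(2) [OF inv x]])
        (use inv x' in \<open>auto simp: kam_inv_def\<close>)
    from has_vector_derivative_add [OF a b] show ?thesis
      unfolding st_Suc by (rule has_vector_derivative_eq_rhs) (simp add: algebra_simps power2_eq_square)
  qed
  show ?thesis unfolding kam_inv_def using 1 2 3 4 5 6 by blast
qed

lemma kam_inv_all: "kam_inv n"
  by (induction n) (auto intro: kam_inv_0 kam_step)

end

section \<open>The limit and the excluded parameters\<close>

lemma uniform_limit_line:
  assumes "uniform_limit (ostrip \<rho>) f g F" "\<rho> > 0"
  shows "uniform_limit UNIV (\<lambda>n t. f n (line \<omega> t)) (\<lambda>t. g (line \<omega> t)) F"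
proof (rule uniform_limitI)
  fix e :: real assume "e > 0"
  then have "\<forall>\<^sub>F n in F. \<forall>x\<in>ostrip \<rho>. dist (f n x) (g x) < e"
    using assms(1) by (simp add: uniform_limit_iff)
  then show "\<forall>\<^sub>F n in F. \<forall>t\<in>UNIV. dist (f n (line \<omega> t)) (g (line \<omega> t)) < e"
    by eventually_elim (use line_in_ostrip [OF assms(2)] in blast)
qed

context hill_kam
begin

lemma width_gt: "\<rho> / 2 \<le> width n"
  using width_bounds(1) [of n] by linarith

lemma kam_limit:
  assumes x: "\<And>n. x \<in> good n"
  shows "\<exists>M m \<mu>. hol_per (\<rho> / 2) M \<and> hol_per (\<rho> / 2) m \<and>
    (\<forall>\<theta>\<in>ostrip (\<rho> / 2). norm (m \<theta> - \<i> * of_real (\<delta> * \<kappa> * sqrt x)) \<le> \<delta> * \<kappa> / 2) \<and>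
    (\<forall>t. ((\<lambda>t. M (line \<omega> t)) has_vector_derivative m (line \<omega> t) - \<mu>) (at t)) \<and>
    (\<forall>t. ((\<lambda>t. m (line \<omega> t)) has_vector_derivative
       - (m (line \<omega> t))\<^sup>2 - of_real (\<delta>\<^sup>2 * x) * F (line \<omega> t)) (at t))"
proof -
  let ?S = "ostrip (\<rho> / 2) :: (complex ^ 'n) set"
  have \<rho>2: "0 < \<rho> / 2" using \<rho> by simp
  have sub: "?S \<subseteq> ostrip (width n)" for n by (rule ostrip_mono [OF width_gt])
  note inv = kam_inv_all [unfolded kam_inv_def]
  have hp: "hol_per (\<rho> / 2) (f x)" if "bnd (good n) (width n) B f" for n B and f :: "real \<Rightarrow> complex ^ 'n \<Rightarrow> complex"
    by (rule hol_per_mono [OF bndD(1) [OF that x] width_gt])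
  have incr: "norm (incr n x \<theta>) \<le> \<delta> * h / 2 ^ n" if "\<theta> \<in> ?S" for n \<theta>
  proof -
    have "width (Suc n) \<le> width n - \<rho> / 2 ^ (n + 3)" using width_bounds(3,4) [of n] by linarith
    then have "\<theta> \<in> ostrip (width n - \<rho> / 2 ^ (n + 3))"
      using that sub [of "Suc n"] ostrip_mono by blast
    from bndD(2) [OF incr_bnd(1) [OF kam_inv_all] x this] incr_size_bounds(2) [of n] show ?thesis by linarith
  qed
  have pot: "norm (sol \<omega> 0 (incr n x) \<theta>) \<le> h / 2 ^ n" if "\<theta> \<in> ?S" for n \<theta>
    using bndD(2) [OF pot_incr_bnd [OF kam_inv_all] x] sub that by blast
  obtain M where M: "uniform_limit ?S (\<lambda>n. pot n x) M sequentially"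
    by (rule uniform_limit_geometric [of ?S "\<lambda>n. pot n x" h]) (use pot in \<open>auto simp: st_Suc\<close>)
  obtain m where m: "uniform_limit ?S (\<lambda>n. ric n x) m sequentially"
    by (rule uniform_limit_geometric [of ?S "\<lambda>n. ric n x" "\<delta> * h"]) (use incr in \<open>auto simp: st_Suc\<close>)
  have f0: "norm (fourier (incr n x) 0) \<le> \<delta> * h / 2 ^ n" for n
  proof -
    have pos: "0 < width n - \<rho> / 2 ^ (n + 3)" using width_bounds(4,6) [of n] by linarith
    have "norm (fourier (incr n x) 0) \<le> incr_size n * exp (- (width n - \<rho> / 2 ^ (n + 3)) * freq_abs (0 :: int ^ 'n))"
      by (rule bnd_fourier(1) [OF incr_bnd(1) [OF kam_inv_all] pos x])
    then show ?thesis using incr_size_bounds(2) [of n] by (simp add: freq_abs_eq)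
  qed
  \<comment> \<open>The numbers \<open>mu n x\<close> are viewed as constant functions so that the
    convergence lemma for functions applies.\<close>
  obtain \<mu>' where \<mu>': "uniform_limit (UNIV :: real set) (\<lambda>n _. mu n x) \<mu>' sequentially"
    by (rule uniform_limit_geometric [of UNIV "\<lambda>n _. mu n x" "\<delta> * h"]) (use f0 in \<open>auto simp: st_Suc\<close>)
  have \<mu>'c: "\<mu>' t = \<mu>' 0" for t
    using tendsto_uniform_limitI [OF \<mu>', of t] tendsto_uniform_limitI [OF \<mu>', of 0] LIMSEQ_unique by auto
  then have \<mu>: "uniform_limit (UNIV :: real set) (\<lambda>n _. mu n x) (\<lambda>_. \<mu>' 0) sequentially"
    using \<mu>' by (metis ext)
  have err0: "uniform_limit ?S (\<lambda>n. err n x) (\<lambda>\<theta>. 0) sequentially"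
  proof (rule uniform_limitI)
    fix e :: real assume e: "e > 0"
    have "(\<lambda>n. \<delta>\<^sup>2 * h * (1 / 2) ^ n) \<longlonglongrightarrow> \<delta>\<^sup>2 * h * 0"
      by (intro tendsto_intros) auto
    then have "\<forall>\<^sub>F n in sequentially. \<delta>\<^sup>2 * h * (1 / 2) ^ n < e"
      using order_tendstoD(2) e by fastforce
    then show "\<forall>\<^sub>F n in sequentially. \<forall>\<theta>\<in>?S. dist (err n x \<theta>) 0 < e"
    proof eventually_elim
      case (elim n)
      have "err_size n \<le> \<delta>\<^sup>2 * h * (1 / 2) ^ n"
      proof -
        have "1 \<le> A\<^sup>2 * b ^ (2 * n)" using A(1) b_ge_1 by (simp add: mult_ge1_I)
        then have "(\<delta>\<^sup>2 * h / 2 ^ n) / (A\<^sup>2 * b ^ (2 * n)) \<le> (\<delta>\<^sup>2 * h / 2 ^ n) / 1"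
          using h by (intro divide_left_mono) auto
        then show ?thesis by (simp add: err_size_def power_divide mult.assoc)
      qed
      moreover have "norm (err n x \<theta>) \<le> err_size n" if "\<theta> \<in> ?S" for \<theta>
        using bndD(2) [of "good n" "width n" "err_size n" "err n" x \<theta>] inv [of n] x sub [of n] that by blast
      ultimately show ?case using elim by fastforce
    qed
  qed
  have hM: "hol_per (\<rho> / 2) M"
    by (rule hol_per_uniform_limit [OF _ M]) (use inv hp in blast)
  \<comment> \<open>Half of the bound comes from the drift of the iterates, at most
    \<open>2 * \<delta> * h\<close>, and half from the averaging correction in
    \<open>ric 0\<close>.\<close>
  have b: "norm (ric n x \<theta> - \<i> * of_real (\<delta> * \<kappa> * sqrt x)) \<le> \<delta> * \<kappa> / 4" if \<theta>: "\<theta> \<in> ?S" for n \<theta>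
  proof -
    have \<theta>\<rho>: "\<theta> \<in> ostrip \<rho>" using \<theta> \<rho> ostrip_mono [of "\<rho> / 2" \<rho>] by auto
    have x2: "0 \<le> x" "x \<le> 2" using x [of 0] good_subset [of 0] by auto
    have "norm (ric n x \<theta> - ric 0 x \<theta>) \<le> 2 * \<delta> * h * (1 - 1 / 2 ^ n)"
      using bndD(2) [of "good n" "width n" _ "\<lambda>x \<theta>. ric n x \<theta> - ric 0 x \<theta>" x \<theta>] inv [of n] x sub [of n] \<theta> by blast
    also have "\<dots> \<le> 2 * \<delta> * h * 1" using \<delta> h by (intro mult_left_mono) auto
    also have "\<dots> \<le> 2 * \<delta> * (\<kappa> / 16)" using \<delta> h by simp
    finally have 1: "norm (ric n x \<theta> - ric 0 x \<theta>) \<le> \<delta> * \<kappa> / 8" by simp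
    have "norm (ric 0 x \<theta> - \<i> * of_real (\<delta> * \<kappa> * sqrt x)) = \<delta>\<^sup>2 * (x * norm (Bf \<theta>))"
      using x2 by (simp add: st_0 norm_mult norm_power)
    also have "\<dots> \<le> \<delta>\<^sup>2 * (2 * C1)"
      using x2 Bf(2) [OF \<theta>\<rho>] by (intro mult_left_mono mult_mono) auto
    also have "\<dots> = \<delta> * (\<delta> * (4 * C1)) / 2" by (simp add: power2_eq_square)
    also have "\<dots> \<le> \<delta> * (\<kappa> / 4) / 2" using small(3) \<delta> by (intro divide_right_mono mult_left_mono) auto
    finally have 2: "norm (ric 0 x \<theta> - \<i> * of_real (\<delta> * \<kappa> * sqrt x)) \<le> \<delta> * \<kappa> / 8" by simp
    show ?thesis
      using norm_triangle_ineq [of "ric n x \<theta> - ric 0 x \<theta>" "ric 0 x \<theta> - \<i> * of_real (\<delta> * \<kappa> * sqrt x)"] 1 2 by simp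
  qed
  \<comment> \<open>The invariant speaks of the difference to \<open>ric 0\<close> only, so
    holomorphy of \<open>ric 0\<close> is supplied separately.\<close>
  have hm0: "hol_per (\<rho> / 2) (ric 0 x)"
    unfolding st_0
    by (intro hol_per_add hol_per_mult hol_per_const hol_per_mono [OF Bf(1)]) (use \<rho> in auto)
  have hmn: "hol_per (\<rho> / 2) (ric n x)" for n
  proof -
    have "hol_per (\<rho> / 2) (\<lambda>\<theta>. ric n x \<theta> - ric 0 x \<theta>)"
      using inv [of n] hp [of n _ "\<lambda>x \<theta>. ric n x \<theta> - ric 0 x \<theta>"] by blast
    from hol_per_add [OF this hm0] show ?thesis by simp
  qed
  have hm: "hol_per (\<rho> / 2) m" by (rule hol_per_uniform_limit [OF hmn m])
  have mb: "norm (m \<theta> - \<i> * of_real (\<delta> * \<kappa> * sqrt x)) \<le> \<delta> * \<kappa> / 4" if \<theta>: "\<theta> \<in> ?S" for \<theta>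
  proof (rule LIMSEQ_le_const2)
    show "(\<lambda>n. norm (ric n x \<theta> - \<i> * of_real (\<delta> * \<kappa> * sqrt x))) \<longlonglongrightarrow> norm (m \<theta> - \<i> * of_real (\<delta> * \<kappa> * sqrt x))"
      by (intro tendsto_intros tendsto_uniform_limitI [OF m \<theta>])
  qed (use b [OF \<theta>] in auto)
  have dk: "0 < \<delta> * \<kappa>" using \<delta> \<kappa> by simp
  have mL: "uniform_limit UNIV (\<lambda>n t. ric n x (line \<omega> t)) (\<lambda>t. m (line \<omega> t)) sequentially"
    by (rule uniform_limit_line [OF m \<rho>2])
  have dM: "((\<lambda>t. M (line \<omega> t)) has_vector_derivative m (line \<omega> t) - \<mu>' 0) (at t)" for t
  proof (rule has_vector_derivative_uniform_limit)
    show "((\<lambda>t. pot n x (line \<omega> t)) has_vector_derivative ric n x (line \<omega> t) - mu n x) (at t)" for n t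
      using inv [of n] x by blast
    show "uniform_limit UNIV (\<lambda>n t. ric n x (line \<omega> t) - mu n x) (\<lambda>t. m (line \<omega> t) - \<mu>' 0) sequentially"
      by (intro uniform_limit_intros mL \<mu>)
    show "(\<lambda>n. pot n x (line \<omega> t)) \<longlonglongrightarrow> M (line \<omega> t)" for t
      by (rule tendsto_uniform_limitI [OF M line_in_ostrip [OF \<rho>2]])
  qed
  \<comment> \<open>Boundedness makes the squares converge uniformly along the flow.\<close>
  have bdm: "bounded ((\<lambda>t. m (line \<omega> t)) ` UNIV)"
  proof (rule boundedI)
    fix z assume "z \<in> (\<lambda>t. m (line \<omega> t)) ` UNIV"
    then obtain t where "z = m (line \<omega> t)" by blast
    then have "norm (z - \<i> * of_real (\<delta> * \<kappa> * sqrt x)) \<le> \<delta> * \<kappa> / 4"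
      using mb [OF line_in_ostrip [OF \<rho>2]] by simp
    then show "norm z \<le> \<delta> * \<kappa> / 4 + norm (\<i> * complex_of_real (\<delta> * \<kappa> * sqrt x))"
      using norm_triangle_ineq2 [of z "\<i> * of_real (\<delta> * \<kappa> * sqrt x)"] by linarith
  qed
  have dm: "((\<lambda>t. m (line \<omega> t)) has_vector_derivative
       - (m (line \<omega> t))\<^sup>2 - of_real (\<delta>\<^sup>2 * x) * F (line \<omega> t)) (at t)" for t
  proof (rule has_vector_derivative_uniform_limit)
    show "((\<lambda>t. ric n x (line \<omega> t)) has_vector_derivative
        err n x (line \<omega> t) - (ric n x (line \<omega> t))\<^sup>2 - of_real (\<delta>\<^sup>2 * x) * F (line \<omega> t)) (at t)" for n t
      using inv [of n] x by blast
    have "uniform_limit UNIV (\<lambda>n t. err n x (line \<omega> t) - ric n x (line \<omega> t) * ric n x (line \<omega> t)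
          - of_real (\<delta>\<^sup>2 * x) * F (line \<omega> t))
        (\<lambda>t. 0 - m (line \<omega> t) * m (line \<omega> t) - of_real (\<delta>\<^sup>2 * x) * F (line \<omega> t)) sequentially"
      by (intro uniform_limit_minus uniform_limit_const uniform_lim_mult mL bdm uniform_limit_line [OF err0 \<rho>2])
    then show "uniform_limit UNIV (\<lambda>n t. err n x (line \<omega> t) - (ric n x (line \<omega> t))\<^sup>2
          - of_real (\<delta>\<^sup>2 * x) * F (line \<omega> t))
        (\<lambda>t. - (m (line \<omega> t))\<^sup>2 - of_real (\<delta>\<^sup>2 * x) * F (line \<omega> t)) sequentially"
      by (simp add: power2_eq_square)
    show "(\<lambda>n. ric n x (line \<omega> t)) \<longlonglongrightarrow> m (line \<omega> t)" for t
      by (rule tendsto_uniform_limitI [OF m line_in_ostrip [OF \<rho>2]])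
  qed
  have "norm (m \<theta> - \<i> * of_real (\<delta> * \<kappa> * sqrt x)) \<le> \<delta> * \<kappa> / 2" if "\<theta> \<in> ?S" for \<theta>
    using mb [OF that] dk by linarith
  then show ?thesis using hM hm dM dm by blast
qed

text \<open>A resonance at \<open>k\<close> forces \<open>\<bar>dotp k \<omega>\<bar>\<close> to be
  of order \<open>\<delta>\<close>, up to a fraction of its Diophantine bound, hence
  \<open>wt k powr \<tau>\<close> to be at least of order \<open>1 / \<delta>\<close>. Three such
  factors are kept in \<open>wt k ^ p\<close> and yield \<open>\<delta> ^ 3\<close>; dividing by the
  speed \<open>\<delta> * \<kappa> / 8\<close> of the frequency leaves
  \<open>\<delta>\<^sup>2\<close>. The other \<open>2 * CARD('n)\<close> powers make the sum over
  \<open>k\<close> converge.\<close>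

lemma resonance_width:
  assumes dph: "\<And>k. k \<noteq> 0 \<Longrightarrow> 2 * w0 / freq_abs k powr \<tau> \<le> \<bar>dotp k \<omega>\<bar>"
    and \<tau>: "0 < \<tau>" "2 * real CARD('n) + 3 * \<tau> \<le> real p" and k: "k \<noteq> 0"
    and x: "x \<in> good n" "\<bar>dotp k \<omega> + 2 * Im (mu n x)\<bar> < w0 / (2 ^ n * wt k ^ p)"
    and y: "y \<in> good n" "\<bar>dotp k \<omega> + 2 * Im (mu n y)\<bar> < w0 / (2 ^ n * wt k ^ p)"
  shows "\<bar>x - y\<bar> \<le> (8 * w0 * (4 / w0) ^ 3 * \<kappa>\<^sup>2) * \<delta>\<^sup>2 * ((1 / 2) ^ n * inverse (wt k ^ (2 * CARD('n))))"
proof -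
  have dk: "0 < \<delta> * \<kappa>" using \<delta> \<kappa> by simp
  note Fk = freq_abs_ge_1 [OF k]
  define T where "T = wt k powr \<tau>"
  have T: "1 \<le> T" using \<tau> by (simp add: T_def ge_one_powr_ge_zero)
  have ft: "freq_abs k powr \<tau> \<le> T" "0 < freq_abs k powr \<tau>"
    unfolding T_def using Fk \<tau> by (auto intro!: powr_mono2 simp: wt_def)
  have wp: "wt k ^ (2 * CARD('n)) * T ^ 3 \<le> wt k ^ p"
  proof -
    have "wt k ^ (2 * CARD('n)) * T ^ 3 = wt k powr (2 * real CARD('n) + 3 * \<tau>)"
    proof -
      have "T ^ 3 = wt k powr (\<tau> + \<tau> + \<tau>)"
        unfolding T_def power3_eq_cube powr_add ..
      moreover have "wt k ^ (2 * CARD('n)) = wt k powr (2 * real CARD('n))"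
        using powr_realpow [of "wt k" "2 * CARD('n)"] by simp
      ultimately show ?thesis by (simp add: powr_add [symmetric])
    qed
    also have "\<dots> \<le> wt k powr real p" using \<tau> by (intro powr_mono) auto
    also have "\<dots> = wt k ^ p" by (simp add: powr_realpow)
    finally show ?thesis .
  qed
  have Tp: "T \<le> wt k ^ p"
  proof -
    have "T * 1 \<le> T * T\<^sup>2" using T by (intro mult_left_mono one_le_power) auto
    then have "T \<le> 1 * T ^ 3" by (simp add: power3_eq_cube power2_eq_square)
    also have "\<dots> \<le> wt k ^ (2 * CARD('n)) * T ^ 3" using T by (intro mult_right_mono one_le_power) auto
    finally show ?thesis using wp by linarith
  qed
  \<comment> \<open>The constant in the Diophantine bound is twice that of the resonance threshold,
    so after subtraction \<open>w0 / T\<close> is left for comparison with the frequency.\<close>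
  have "2 * w0 / T \<le> 2 * w0 / freq_abs k powr \<tau>" using ft w0 T by (intro divide_left_mono) auto
  also have "\<dots> \<le> \<bar>dotp k \<omega>\<bar>" by (rule dph [OF k])
  also have "\<dots> \<le> 2 * \<bar>Im (mu n x)\<bar> + w0 / (2 ^ n * wt k ^ p)" using x(2) by linarith
  also have "\<dots> \<le> 4 * (\<delta> * \<kappa>) + w0 / T"
  proof (rule add_mono)
    show "2 * \<bar>Im (mu n x)\<bar> \<le> 4 * (\<delta> * \<kappa>)"
      using mu_bounds(1,3) [OF kam_inv_all x(1)] dk by linarith
    have "1 * T \<le> 2 ^ n * wt k ^ p" using Tp T by (intro mult_mono) auto
    then show "w0 / (2 ^ n * wt k ^ p) \<le> w0 / T" using w0 T by (intro divide_left_mono) auto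
  qed
  finally have "w0 / T \<le> 4 * (\<delta> * \<kappa>)" by simp
  then have "1 / T \<le> 4 * (\<delta> * \<kappa>) / w0" using w0 by (simp add: field_simps)
  then have T3: "1 / T ^ 3 \<le> (4 * (\<delta> * \<kappa>) / w0) ^ 3"
    using T power_mono [of "1 / T" "4 * (\<delta> * \<kappa>) / w0" 3] by (simp add: power_divide)
  have ip: "inverse (wt k ^ p) \<le> inverse (wt k ^ (2 * CARD('n))) * (1 / T ^ 3)"
    using le_imp_inverse_le [OF wp] T by (simp add: inverse_eq_divide)
  have main: "\<bar>x - y\<bar> \<le> 8 * w0 / (\<delta> * \<kappa>) * ((1 / 2) ^ n * inverse (wt k ^ p))"
  proof -
    have *: "\<delta> * \<kappa> * (u - v) / 8 \<le> w0 / (2 ^ n * wt k ^ p)"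
      if "u \<in> good n" "v \<in> good n" "v \<le> u" "\<bar>dotp k \<omega> + 2 * Im (mu n u)\<bar> < w0 / (2 ^ n * wt k ^ p)"
        "\<bar>dotp k \<omega> + 2 * Im (mu n v)\<bar> < w0 / (2 ^ n * wt k ^ p)" for u v
      using mu_bounds(4) [OF kam_inv_all that(1,2,3)] that(4,5) by linarith
    have "\<delta> * \<kappa> * \<bar>x - y\<bar> / 8 \<le> w0 / (2 ^ n * wt k ^ p)"
      using * [OF x(1) y(1) _ x(2) y(2)] * [OF y(1) x(1) _ y(2) x(2)] by (cases "y \<le> x") auto
    then have "8 / (\<delta> * \<kappa>) * (\<delta> * \<kappa> * \<bar>x - y\<bar> / 8) \<le> 8 / (\<delta> * \<kappa>) * (w0 / (2 ^ n * wt k ^ p))"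
      using dk by (intro mult_left_mono) auto
    moreover have "8 / (\<delta> * \<kappa>) * (\<delta> * \<kappa> * \<bar>x - y\<bar> / 8) = \<bar>x - y\<bar>"
      using \<delta> \<kappa> by simp
    ultimately have "\<bar>x - y\<bar> \<le> 8 / (\<delta> * \<kappa>) * (w0 / (2 ^ n * wt k ^ p))" by simp
    then show ?thesis by (simp add: inverse_eq_divide power_divide)
  qed
  also have "\<dots> \<le> 8 * w0 / (\<delta> * \<kappa>) * ((1 / 2) ^ n * (inverse (wt k ^ (2 * CARD('n))) * (4 * (\<delta> * \<kappa>) / w0) ^ 3))"
    using w0 dk T3 by (intro mult_left_mono order_trans [OF ip]) auto
  also have "\<dots> = (8 * w0 * (4 / w0) ^ 3 * \<kappa>\<^sup>2) * \<delta>\<^sup>2 * ((1 / 2) ^ n * inverse (wt k ^ (2 * CARD('n))))"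
  proof -
    have "8 * w0 / (\<delta> * \<kappa>) * (4 * (\<delta> * \<kappa>) / w0) ^ 3 = (8 * w0 * (4 / w0) ^ 3 * \<kappa>\<^sup>2) * \<delta>\<^sup>2"
      using \<delta> \<kappa> w0 by (simp add: power3_eq_cube power2_eq_square)
    then show ?thesis by (simp add: mult_ac)
  qed
  finally show ?thesis .
qed

text \<open>The resonant sets are enclosed in balls, which are measurable whatever the shape of the
  sets. The factor 4 is the 2 in the length \<open>2 * r\<close> of a ball times the sum 2 of the
  powers of 1/2.\<close>

lemma kam_measure:
  assumes dph: "\<And>k. k \<noteq> 0 \<Longrightarrow> 2 * w0 / freq_abs k powr \<tau> \<le> \<bar>dotp k \<omega>\<bar>"
    and \<tau>: "0 < \<tau>" "2 * real CARD('n) + 3 * \<tau> \<le> real p"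
  shows "\<exists>G\<in>lmeasurable. measure lebesgue G \<le> (4 * (8 * w0 * (4 / w0) ^ 3 * \<kappa>\<^sup>2) * wt_sum TYPE('n)) * \<delta>\<^sup>2 \<and>
    (\<forall>x\<in>{1..2} - G. \<forall>n. x \<in> good n)"
proof -
  define c where "c = (8 * w0 * (4 / w0) ^ 3 * \<kappa>\<^sup>2) * \<delta>\<^sup>2"
  have c0: "0 \<le> c" using w0 by (simp add: c_def)
  define r where "r n k = c * ((1 / 2) ^ n * inverse (wt (k :: int ^ 'n) ^ (2 * CARD('n))))" for n k
  have r0: "0 \<le> r n k" for n k using c0 by (simp add: r_def)
  define Z where "Z n k = {x \<in> good n. k \<noteq> 0 \<and> \<bar>dotp k \<omega> + 2 * Im (mu n x)\<bar> < w0 / (2 ^ n * wt k ^ p)}" for n and k :: "int ^ 'n"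
  \<comment> \<open>The centre can be any resonant point, since \<open>resonance_width\<close>
    compares any two of them.\<close>
  define I where "I = (\<lambda>(n, k). if Z n k = {} then {} else cball (SOME x. x \<in> Z n k) (r n k))"
  have ZI: "Z n k \<subseteq> I (n, k)" for n k
  proof
    fix y assume y: "y \<in> Z n k"
    define x where "x = (SOME x. x \<in> Z n k)"
    have x: "x \<in> Z n k" unfolding x_def by (rule someI [where P = "\<lambda>x. x \<in> Z n k", OF y])
    have "\<bar>x - y\<bar> \<le> r n k"
      unfolding r_def c_def
      by (rule resonance_width [OF dph \<tau>]) (use x y in \<open>auto simp: Z_def\<close>)
    then show "y \<in> I (n, k)" using y by (auto simp: I_def dist_real_def x_def [symmetric])
  qed
  have Im: "I i \<in> lmeasurable" "measure lebesgue (I i) \<le> 2 * r (fst i) (snd i)" for i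
    using r0 [of "fst i" "snd i"]
    by (auto simp: I_def case_prod_beta cball_eq_atLeastAtMost)
  \<comment> \<open>A bound common to all finite subfamilies carries over to the countable
    union.\<close>
  have bound: "measure lebesgue (\<Union>i\<in>I'. I i) \<le> (4 * (8 * w0 * (4 / w0) ^ 3 * \<kappa>\<^sup>2) * wt_sum TYPE('n)) * \<delta>\<^sup>2"
    if fin: "finite I'" for I'
  proof -
    have "measure lebesgue (\<Union>i\<in>I'. I i) \<le> (\<Sum>i\<in>I'. measure lebesgue (I i))"
      by (intro measure_UNION_le fin) (use Im(1) in auto)
    also have "\<dots> \<le> (\<Sum>i\<in>I'. 2 * r (fst i) (snd i))" by (intro sum_mono Im)
    also have "\<dots> \<le> (\<Sum>i\<in>fst ` I' \<times> snd ` I'. 2 * r (fst i) (snd i))"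
      by (rule sum_mono2) (use fin r0 in \<open>auto intro: rev_image_eqI\<close>)
    also have "\<dots> = (\<Sum>n\<in>fst ` I'. \<Sum>k\<in>snd ` I'. 2 * r n k)"
      by (simp add: sum.cartesian_product case_prod_beta)
    also have "\<dots> = (\<Sum>n\<in>fst ` I'. \<Sum>k\<in>snd ` I'. 2 * c * ((1 / 2) ^ n * inverse (wt k ^ (2 * CARD('n)))))"
      unfolding r_def by (intro sum.cong refl) simp
    also have "\<dots> = 2 * c * (\<Sum>n\<in>fst ` I'. \<Sum>k\<in>snd ` I'. (1 / 2) ^ n * inverse (wt k ^ (2 * CARD('n))))"
      by (simp only: sum_distrib_left)
    also have "\<dots> = 2 * c * ((\<Sum>n\<in>fst ` I'. (1 / 2) ^ n) * (\<Sum>k\<in>snd ` I'. inverse (wt k ^ (2 * CARD('n)))))"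
      by (simp only: sum_product)
    also have "\<dots> \<le> 2 * c * (2 * wt_sum TYPE('n))"
    proof (intro mult_left_mono mult_mono)
      have "(\<Sum>n\<in>fst ` I'. (1 / 2 :: real) ^ n) \<le> (\<Sum>n. (1 / 2) ^ n)"
        by (intro sum_le_suminf summable_geometric) (use fin in auto)
      then show "(\<Sum>n\<in>fst ` I'. (1 / 2 :: real) ^ n) \<le> 2" by (simp add: suminf_geometric)
      show "(\<Sum>k\<in>snd ` I'. inverse (wt k ^ (2 * CARD('n)))) \<le> wt_sum TYPE('n)"
        unfolding wt_sum_def by (intro finite_sum_le_infsum summable_on_inverse_wt) (use fin in auto)
    qed (use c0 in \<open>auto intro!: sum_nonneg\<close>)
    finally show ?thesis by (simp add: c_def mult_ac)
  qed
  show ?thesis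
  proof (intro bexI conjI ballI allI)
    show "(\<Union>i\<in>UNIV. I i) \<in> lmeasurable"
      by (rule fmeasurable_UN_bound [OF _ _ bound]) (use Im in auto)
    show "measure lebesgue (\<Union>i\<in>UNIV. I i) \<le> (4 * (8 * w0 * (4 / w0) ^ 3 * \<kappa>\<^sup>2) * wt_sum TYPE('n)) * \<delta>\<^sup>2"
      by (rule measure_UN_bound [OF _ _ bound]) (use Im in auto)
    fix x n assume x: "x \<in> {1..2} - (\<Union>i\<in>UNIV. I i)"
    show "x \<in> good n"
    proof (induction n)
      case 0
      then show ?case using x by (simp add: good_def)
    next
      case (Suc n)
      have "x \<notin> Z n k" for k using x ZI by blast
      then have "w0 / (2 ^ n * wt k ^ p) \<le> \<bar>dotp k \<omega> + 2 * Im (mu n x)\<bar>" if "k \<noteq> 0" for k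
        using Suc that by (auto simp: Z_def not_less)
      then show ?case using Suc by (auto simp: good_def less_Suc_eq)
    qed
  qed
qed

end

section \<open>From the Riccati equation to reducibility\<close>

lemma has_vector_derivative_vec2_iff:
  fixes z :: "real \<Rightarrow> real ^ 2"
  shows "(z has_vector_derivative v) (at t) \<longleftrightarrow>
    ((\<lambda>t. z t $ 1) has_real_derivative v $ 1) (at t) \<and> ((\<lambda>t. z t $ 2) has_real_derivative v $ 2) (at t)"
proof
  assume "(z has_vector_derivative v) (at t)"
  from bounded_linear.has_vector_derivative [OF bounded_linear_vec_nth this]
  show "((\<lambda>t. z t $ 1) has_real_derivative v $ 1) (at t) \<and> ((\<lambda>t. z t $ 2) has_real_derivative v $ 2) (at t)"
    by (simp add: has_real_derivative_iff_has_vector_derivative)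
next
  assume d: "((\<lambda>t. z t $ 1) has_real_derivative v $ 1) (at t) \<and> ((\<lambda>t. z t $ 2) has_real_derivative v $ 2) (at t)"
  have e: "u = u $ 1 *\<^sub>R (axis 1 1 :: real ^ 2) + u $ 2 *\<^sub>R (axis 2 1 :: real ^ 2)" for u :: "real ^ 2"
    by (simp add: vec_eq_iff forall_2 axis_def)
  have c: "((\<lambda>t. f t *\<^sub>R u) has_vector_derivative f' *\<^sub>R u) (at t)"
    if "(f has_real_derivative f') (at t)" for f f' and u :: "real ^ 2"
    using bounded_linear.has_vector_derivative [OF bounded_linear_scaleR_left that [unfolded has_real_derivative_iff_has_vector_derivative]] .
  have "((\<lambda>t. z t $ 1 *\<^sub>R (axis 1 1 :: real ^ 2) + z t $ 2 *\<^sub>R (axis 2 1 :: real ^ 2)) has_vector_derivative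
      (v $ 1 *\<^sub>R (axis 1 1 :: real ^ 2) + v $ 2 *\<^sub>R (axis 2 1 :: real ^ 2))) (at t)"
    by (rule has_vector_derivative_add [OF c [OF conjunct1 [OF d]] c [OF conjunct2 [OF d]]])
  then show "(z has_vector_derivative v) (at t)" by (simp only: e [symmetric])
qed

lemma linear_solution_hill_iff:
  "linear_solution (\<lambda>t. hill_A + \<epsilon> *\<^sub>R hill_Q a t) z \<longleftrightarrow>
    (\<forall>t. ((\<lambda>t. z t $ 1) has_real_derivative z t $ 2) (at t) \<and>
      ((\<lambda>t. z t $ 2) has_real_derivative - (\<epsilon> * a t * z t $ 1)) (at t))"
proof -
  have "((hill_A + \<epsilon> *\<^sub>R hill_Q a t) *v u) $ 1 = u $ 2" "((hill_A + \<epsilon> *\<^sub>R hill_Q a t) *v u) $ 2 = - (\<epsilon> * a t * u $ 1)"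
    for t u by (simp_all add: matrix_vector_mult_def sum_2 hill_A_def hill_Q_def)
  then show ?thesis unfolding linear_solution_def has_vector_derivative_vec2_iff by (simp only:)
qed

lemma linear_solution_rotation_iff:
  "linear_solution (\<lambda>t. r *\<^sub>R J) w \<longleftrightarrow>
    (\<forall>t. ((\<lambda>t. w t $ 1) has_real_derivative r * w t $ 2) (at t) \<and>
      ((\<lambda>t. w t $ 2) has_real_derivative - (r * w t $ 1)) (at t))"
proof -
  have "((r *\<^sub>R J) *v u) $ 1 = r * u $ 2" "((r *\<^sub>R J) *v u) $ 2 = - (r * u $ 1)"
    for u by (simp_all add: matrix_vector_mult_def sum_2 J_def)
  then show ?thesis unfolding linear_solution_def has_vector_derivative_vec2_iff by (simp only:)
qed

lemma hamiltonian_matrix_rotation: "hamiltonian_matrix (r *\<^sub>R J)"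
proof -
  have "transpose (mat r :: real ^ 2 ^ 2) = mat r" by (simp add: transpose_mat)
  moreover have "r *\<^sub>R J = J ** mat r"
    by (simp add: vec_eq_iff forall_2 J_def matrix_matrix_mult_def sum_2 mat_def)
  ultimately show ?thesis unfolding hamiltonian_matrix_def by blast
qed

text \<open>For 2 by 2 matrices, conjugating \<open>J\<close> by a matrix and its transpose
  multiplies it by the determinant.\<close>

lemma symplectic_transformation_of_det:
  assumes "\<And>t. P t * S t - Q t * R t = (1::real)"
  shows "symplectic_transformation (\<lambda>t. vector [vector [P t, Q t], vector [R t, S t]])"
  unfolding symplectic_transformation_def
proof
  fix t
  \<comment> \<open>The matrix entries appear with factors in different orders, so the determinant
    identity is prepared in each of them.\<close>
  have d: "P t * S t - R t * Q t = 1" "R t * Q t - P t * S t = - 1" "Q t * R t - S t * P t = - 1" "S t * P t - Q t * R t = 1"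
    using assms [of t] by (simp_all only: mult.commute [of "S t"] mult.commute [of "R t"])
  show "transpose (vector [vector [P t, Q t], vector [R t, S t]]) ** J ** vector [vector [P t, Q t], vector [R t, S t]] = J"
    by (simp add: vec_eq_iff forall_2 J_def matrix_matrix_mult_def sum_2 transpose_def) (use d in simp)
qed

text \<open>The columns of the transformation matrix, rotated by the angle \<open>r t\<close>, are solutions of
  Hill's equation.\<close>

lemma floquet_conjugation:
  fixes P Q R S a :: "real \<Rightarrow> real"
  assumes P: "\<And>t. (P has_real_derivative R t + r * Q t) (at t)"
    and Q: "\<And>t. (Q has_real_derivative S t - r * P t) (at t)"
    and R: "\<And>t. (R has_real_derivative - (\<epsilon> * a t * P t) + r * S t) (at t)"
    and S: "\<And>t. (S has_real_derivative - (\<epsilon> * a t * Q t) - r * R t) (at t)"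
    and det: "\<And>t. P t * S t - Q t * R t = 1"
  shows "linear_solution (\<lambda>t. hill_A + \<epsilon> *\<^sub>R hill_Q a t) (\<lambda>t. vector [vector [P t, Q t], vector [R t, S t]] *v w t)
    \<longleftrightarrow> linear_solution (\<lambda>t. r *\<^sub>R J) w"
proof -
  have z: "(vector [vector [P t, Q t], vector [R t, S t]] *v w t) $ (1::2) = P t * w t $ 1 + Q t * w t $ 2"
    "(vector [vector [P t, Q t], vector [R t, S t]] *v w t) $ (2::2) = R t * w t $ 1 + S t * w t $ 2" for t
    by (simp_all add: matrix_vector_mult_def sum_2)
  show ?thesis
  proof
    assume L: "linear_solution (\<lambda>t. r *\<^sub>R J) w"
    show "linear_solution (\<lambda>t. hill_A + \<epsilon> *\<^sub>R hill_Q a t) (\<lambda>t. vector [vector [P t, Q t], vector [R t, S t]] *v w t)"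
      unfolding linear_solution_hill_iff z
    proof (intro allI conjI)
      fix t
      have w: "((\<lambda>t. w t $ 1) has_real_derivative r * w t $ 2) (at t)"
        "((\<lambda>t. w t $ 2) has_real_derivative - (r * w t $ 1)) (at t)"
        using L by (auto simp: linear_solution_rotation_iff)
      show "((\<lambda>t. P t * w t $ 1 + Q t * w t $ 2) has_real_derivative R t * w t $ 1 + S t * w t $ 2) (at t)"
        by (rule DERIV_cong [OF DERIV_add [OF DERIV_mult [OF P w(1)] DERIV_mult [OF Q w(2)]]])
          (simp add: algebra_simps)
      show "((\<lambda>t. R t * w t $ 1 + S t * w t $ 2) has_real_derivative
          - (\<epsilon> * a t * (P t * w t $ 1 + Q t * w t $ 2))) (at t)"
        by (rule DERIV_cong [OF DERIV_add [OF DERIV_mult [OF R w(1)] DERIV_mult [OF S w(2)]]])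
          (simp add: algebra_simps)
    qed
  next
    assume L: "linear_solution (\<lambda>t. hill_A + \<epsilon> *\<^sub>R hill_Q a t) (\<lambda>t. vector [vector [P t, Q t], vector [R t, S t]] *v w t)"
    define z1 z2 where "z1 t = P t * w t $ 1 + Q t * w t $ 2" and "z2 t = R t * w t $ 1 + S t * w t $ 2" for t
    have dz: "(z1 has_real_derivative z2 t) (at t)" "(z2 has_real_derivative - (\<epsilon> * a t * z1 t)) (at t)" for t
      using L by (auto simp: linear_solution_hill_iff z z1_def [abs_def] z2_def [abs_def])
    \<comment> \<open>Recovering \<open>w\<close> is multiplication by the adjugate, which is the
      inverse because the determinant is 1.\<close>
    have w1: "w t $ 1 = S t * z1 t - Q t * z2 t" and w2: "w t $ 2 = P t * z2 t - R t * z1 t" for t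
    proof -
      have "S t * z1 t - Q t * z2 t = (P t * S t - Q t * R t) * w t $ 1" by (simp add: z1_def z2_def algebra_simps)
      then show "w t $ 1 = S t * z1 t - Q t * z2 t" using det by simp
      have "P t * z2 t - R t * z1 t = (P t * S t - Q t * R t) * w t $ 2" by (simp add: z1_def z2_def algebra_simps)
      then show "w t $ 2 = P t * z2 t - R t * z1 t" using det by simp
    qed
    show "linear_solution (\<lambda>t. r *\<^sub>R J) w"
      unfolding linear_solution_rotation_iff w1 w2
    proof (intro allI conjI)
      fix t
      show "((\<lambda>t. S t * z1 t - Q t * z2 t) has_real_derivative r * (P t * z2 t - R t * z1 t)) (at t)"
        by (rule DERIV_cong [OF DERIV_diff [OF DERIV_mult [OF S dz(1)] DERIV_mult [OF Q dz(2)]]])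
          (simp add: algebra_simps)
      show "((\<lambda>t. P t * z2 t - R t * z1 t) has_real_derivative - (r * (S t * z1 t - Q t * z2 t))) (at t)"
        by (rule DERIV_cong [OF DERIV_diff [OF DERIV_mult [OF P dz(2)] DERIV_mult [OF R dz(1)]]])
          (simp add: algebra_simps)
    qed
  qed
qed

lemma vec_cnj_line [simp]: "vec_cnj (line \<omega> t) = line \<omega> t"
  by (simp add: vec_eq_iff)

lemma vec_cnj_in_ostrip: "\<theta> \<in> ostrip \<rho> \<Longrightarrow> vec_cnj \<theta> \<in> ostrip \<rho>"
  by (simp add: ostrip_def)

text \<open>The explicit formula is exported because positivity of the real part is later needed on
  the whole complex strip, not only along the flow.\<close>

lemma hol_per_Im:
  assumes "hol_per \<rho> f"
  shows "\<exists>g. hol_per \<rho> g \<and> (\<forall>t. g (line \<omega> t) = of_real (Im (f (line \<omega> t)))) \<and>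
    (\<forall>\<theta>. g \<theta> = (f \<theta> - cnj (f (vec_cnj \<theta>))) / (2 * \<i>))"
proof (intro exI conjI allI)
  show "hol_per \<rho> (\<lambda>\<theta>. (f \<theta> - cnj (f (vec_cnj \<theta>))) / (2 * \<i>))"
    using hol_per_mult [OF hol_per_diff [OF assms hol_per_cnj [OF assms]] hol_per_const [of \<rho> "inverse (2 * \<i>)"]]
    by (simp only: divide_inverse)
  show "(f (line \<omega> t) - cnj (f (vec_cnj (line \<omega> t)))) / (2 * \<i>) = of_real (Im (f (line \<omega> t)))" for t
    unfolding vec_cnj_line complex_diff_cnj by simp (simp add: complex_eq_iff)
qed (rule refl)

lemma hol_per_Re:
  assumes "hol_per \<rho> f"
  shows "\<exists>g. hol_per \<rho> g \<and> (\<forall>t. g (line \<omega> t) = of_real (Re (f (line \<omega> t))))"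
proof (intro exI conjI allI)
  show "hol_per \<rho> (\<lambda>\<theta>. (f \<theta> + cnj (f (vec_cnj \<theta>))) / 2)"
    using hol_per_mult [OF hol_per_add [OF assms hol_per_cnj [OF assms]] hol_per_const [of \<rho> "inverse 2"]]
    by (simp only: divide_inverse)
  show "(f (line \<omega> t) + cnj (f (vec_cnj (line \<omega> t)))) / 2 = of_real (Re (f (line \<omega> t)))" for t
    unfolding vec_cnj_line complex_add_cnj by simp
qed

text \<open>With \<open>al\<close> and \<open>b\<close> the real and imaginary part of
  \<open>m\<close>, the Riccati equation gives \<open>b' = - 2 * al * b\<close>, so
  \<open>p = 1 / sqrt b\<close> satisfies \<open>p' = al * p\<close> and can serve as modulus of the
  Floquet solution: \<open>p * exp (\<i> * (hh + r * t))\<close> has logarithmic derivative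
  \<open>al + \<i> * b\<close>. Its real and imaginary parts have Wronskian
  \<open>p\<^sup>2 * b = 1\<close>, and splitting off the rotation by \<open>r * t\<close> leaves a
  quasi-periodic symplectic matrix.\<close>

lemma reducible_of_riccati:
  fixes M m :: "complex ^ 'n \<Rightarrow> complex" and a :: "real \<Rightarrow> real"
  assumes M: "hol_per \<rho> M" and m: "hol_per \<rho> m" and \<rho>: "\<rho> > 0" and c: "c > 0"
    and mb: "\<And>\<theta>. \<theta> \<in> ostrip \<rho> \<Longrightarrow> norm (m \<theta> - \<i> * of_real (2 * c)) \<le> c"
    and dM: "\<And>t. ((\<lambda>t. M (line \<omega> t)) has_vector_derivative m (line \<omega> t) - \<mu>) (at t)"
    and dm: "\<And>t. ((\<lambda>t. m (line \<omega> t)) has_vector_derivative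
       - (m (line \<omega> t))\<^sup>2 - of_real (\<epsilon> * a t)) (at t)"
  shows "reducible \<omega> (\<lambda>t. hill_A + \<epsilon> *\<^sub>R hill_Q a t)"
proof -
  obtain bH where bH: "hol_per \<rho> bH" "\<And>t. bH (line \<omega> t) = of_real (Im (m (line \<omega> t)))"
    "\<And>\<theta>. bH \<theta> = (m \<theta> - cnj (m (vec_cnj \<theta>))) / (2 * \<i>)"
    using hol_per_Im [OF m, of \<omega>] by blast
  obtain hH where hH: "hol_per \<rho> hH" "\<And>t. hH (line \<omega> t) = of_real (Im (M (line \<omega> t)))"
    using hol_per_Im [OF M, of \<omega>] by blast
  obtain aH where aH: "hol_per \<rho> aH" "\<And>t. aH (line \<omega> t) = of_real (Re (m (line \<omega> t)))"
    using hol_per_Re [OF m, of \<omega>] by blast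
  \<comment> \<open>\<open>bH\<close> stays within distance \<open>c\<close> of
    \<open>2 * c\<close>, hence in the right half plane, where the principal square root is
    holomorphic.\<close>
  have bpos: "Re (bH \<theta>) > 0" if \<theta>: "\<theta> \<in> ostrip \<rho>" for \<theta>
  proof -
    let ?u = "m \<theta> - \<i> * of_real (2 * c)" and ?v = "m (vec_cnj \<theta>) - \<i> * of_real (2 * c)"
    have "bH \<theta> - of_real (2 * c) = (?u - cnj ?v) / (2 * \<i>)"
      by (simp add: bH(3) field_simps)
    also have "norm \<dots> \<le> (c + c) / 2"
    proof -
      have "norm (?u - cnj ?v) \<le> norm ?u + norm ?v"
        using norm_triangle_ineq4 [of ?u "cnj ?v"] by (simp only: complex_mod_cnj)
      also have "\<dots> \<le> c + c" by (intro add_mono mb \<theta> vec_cnj_in_ostrip)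
      finally show ?thesis by (simp add: norm_divide norm_mult)
    qed
    finally have "\<bar>Re (bH \<theta> - of_real (2 * c))\<bar> \<le> c" using abs_Re_le_cmod order_trans by fastforce
    then show ?thesis using c by simp
  qed
  define b al p hh where "b t = Im (m (line \<omega> t))" and "al t = Re (m (line \<omega> t))"
    and "p t = 1 / sqrt (b t)" and "hh t = Im (M (line \<omega> t))" for t
  have b0: "b t > 0" for t
    using bpos [OF line_in_ostrip [OF \<rho>, of \<omega> t]] bH(2) [of t] by (simp add: b_def)
  define pH where "pH \<theta> = inverse (csqrt (bH \<theta>))" for \<theta>
  have pH: "hol_per \<rho> pH" "pH (line \<omega> t) = of_real (p t)" for t
  proof -
    have "(\<lambda>z. inverse (csqrt z)) holomorphic_on {z. Re z > 0}"
      by (intro holomorphic_intros) (auto simp: complex_nonpos_Reals_iff)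
    from hol_per_compose [OF bH(1) this] show "hol_per \<rho> pH"
      using bpos by (simp add: pH_def [abs_def])
    show "pH (line \<omega> t) = of_real (p t)"
      using b0 [of t] by (simp add: pH_def bH(2) p_def b_def csqrt_of_real_nonneg divide_inverse)
  qed
  have cosH: "hol_per \<rho> (\<lambda>\<theta>. cos (hH \<theta>))" and sinH: "hol_per \<rho> (\<lambda>\<theta>. sin (hH \<theta>))"
    by (rule hol_per_compose [where W = UNIV, OF hH(1)]; auto intro: holomorphic_intros)+
  \<comment> \<open>The phase of the Floquet solution is \<open>hh t + r * t\<close>, with
    quasi-periodic part \<open>hh\<close>.\<close>
  define r where "r = Im \<mu>"
  define P Q R S where "P t = p t * cos (hh t)" and "Q t = p t * sin (hh t)"
    and "R t = p t * (al t * cos (hh t) - b t * sin (hh t))"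
    and "S t = p t * (al t * sin (hh t) + b t * cos (hh t))" for t
  define PH QH RH SH where "PH \<theta> = pH \<theta> * cos (hH \<theta>)" and "QH \<theta> = pH \<theta> * sin (hH \<theta>)"
    and "RH \<theta> = pH \<theta> * (aH \<theta> * cos (hH \<theta>) - bH \<theta> * sin (hH \<theta>))"
    and "SH \<theta> = pH \<theta> * (aH \<theta> * sin (hH \<theta>) + bH \<theta> * cos (hH \<theta>))" for \<theta>
  have hol: "hol_per \<rho> PH" "hol_per \<rho> QH" "hol_per \<rho> RH" "hol_per \<rho> SH"
    unfolding PH_def [abs_def] QH_def [abs_def] RH_def [abs_def] SH_def [abs_def]
    by (intro hol_per_mult hol_per_add hol_per_diff pH(1) aH(1) bH(1) cosH sinH)+
  have val: "complex_of_real (P t) = PH (line \<omega> t)" "complex_of_real (Q t) = QH (line \<omega> t)"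
      "complex_of_real (R t) = RH (line \<omega> t)" "complex_of_real (S t) = SH (line \<omega> t)" for t
    unfolding P_def Q_def R_def S_def PH_def QH_def RH_def SH_def
    by (simp_all add: pH(2) aH(2) bH(2) hH(2) b_def al_def hh_def cos_of_real sin_of_real)
  have q: "analytic_quasi_periodic \<omega> (\<rho> / 2) f" if "hol_per \<rho> g" "\<And>t. complex_of_real (f t) = g (line \<omega> t)" for f g
    by (rule analytic_quasi_periodic_of_hol_per [OF that(1) _ _ that(2)]) (use \<rho> in auto)
  have Im_d: "((\<lambda>t. Im (f t)) has_real_derivative Im d) (at t)" and Re_d: "((\<lambda>t. Re (f t)) has_real_derivative Re d) (at t)"
    if "(f has_vector_derivative d) (at t)" for f d t
    using bounded_linear.has_vector_derivative [OF bounded_linear_Im that]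
      bounded_linear.has_vector_derivative [OF bounded_linear_Re that]
    by (simp_all add: has_real_derivative_iff_has_vector_derivative)
  have db: "(b has_real_derivative - 2 * al t * b t) (at t)" for t
    using Im_d [OF dm [of t]] by (simp add: b_def [abs_def] al_def power2_eq_square mult_ac)
  have dal: "(al has_real_derivative (b t)\<^sup>2 - (al t)\<^sup>2 - \<epsilon> * a t) (at t)" for t
    using Re_d [OF dm [of t]] by (simp add: b_def al_def [abs_def] power2_eq_square algebra_simps)
  have dh: "(hh has_real_derivative b t - r) (at t)" for t
    using Im_d [OF dM [of t]] by (simp add: b_def hh_def [abs_def] r_def)
  have dp: "(p has_real_derivative al t * p t) (at t)" for t
  proof -
    have s0: "sqrt (b t) > 0" using b0 by simp
    have ss: "sqrt (b t) * sqrt (b t) = b t" using b0 [of t] by simp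
    have ds: "((\<lambda>t. sqrt (b t)) has_real_derivative inverse (sqrt (b t)) / 2 * (- 2 * al t * b t)) (at t)"
      by (rule DERIV_chain2 [OF DERIV_real_sqrt [OF b0] db])
    have d1: "((\<lambda>t. inverse (sqrt (b t))) has_real_derivative
        - (inverse (sqrt (b t)) * (inverse (sqrt (b t)) / 2 * (- 2 * al t * b t)) * inverse (sqrt (b t)))) (at t)"
      by (rule DERIV_inverse' [OF ds]) (use s0 in auto)
    have e1: "- (inverse (sqrt (b t)) * (inverse (sqrt (b t)) / 2 * (- 2 * al t * b t)) * inverse (sqrt (b t))) = al t * p t"
    proof -
      have "- (i * (i / 2 * (- 2 * al t * (s * s))) * i) = al t * i" if "s * i = 1" for i s :: real
      proof -
        have "- (i * (i / 2 * (- 2 * al t * (s * s))) * i) = al t * i * ((s * i) * (s * i))"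
          by (simp add: mult_ac)
        then show ?thesis using that by simp
      qed
      moreover have "sqrt (b t) * inverse (sqrt (b t)) = 1" using s0 by (intro right_inverse) simp
      ultimately have "- (inverse (sqrt (b t)) * (inverse (sqrt (b t)) / 2 * (- 2 * al t * (sqrt (b t) * sqrt (b t)))) * inverse (sqrt (b t)))
          = al t * inverse (sqrt (b t))" by blast
      then show ?thesis unfolding ss p_def by (simp only: divide_inverse mult_1)
    qed
    have "p = (\<lambda>t. inverse (sqrt (b t)))" by (simp add: fun_eq_iff p_def divide_inverse)
    with DERIV_cong [OF d1 e1] show ?thesis by metis
  qed
  have dcos: "((\<lambda>t. cos (hh t)) has_real_derivative - sin (hh t) * (b t - r)) (at t)"
    and dsin: "((\<lambda>t. sin (hh t)) has_real_derivative cos (hh t) * (b t - r)) (at t)" for t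
    using DERIV_chain2 [OF DERIV_cos dh] DERIV_chain2 [OF DERIV_sin dh] by auto
  have dP: "(P has_real_derivative R t + r * Q t) (at t)" for t
    unfolding P_def [abs_def]
    by (rule DERIV_cong [OF DERIV_mult [OF dp dcos]]) (simp add: R_def Q_def algebra_simps)
  have dQ: "(Q has_real_derivative S t - r * P t) (at t)" for t
    unfolding Q_def [abs_def]
    by (rule DERIV_cong [OF DERIV_mult [OF dp dsin]]) (simp add: S_def P_def algebra_simps)
  have dR: "(R has_real_derivative - (\<epsilon> * a t * P t) + r * S t) (at t)" for t
    unfolding R_def [abs_def]
    by (rule DERIV_cong [OF DERIV_mult [OF dp DERIV_diff [OF DERIV_mult [OF dal dcos] DERIV_mult [OF db dsin]]]])
      (simp add: S_def P_def algebra_simps power2_eq_square)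
  have dS: "(S has_real_derivative - (\<epsilon> * a t * Q t) - r * R t) (at t)" for t
    unfolding S_def [abs_def]
    by (rule DERIV_cong [OF DERIV_mult [OF dp DERIV_add [OF DERIV_mult [OF dal dsin] DERIV_mult [OF db dcos]]]])
      (simp add: R_def Q_def algebra_simps power2_eq_square)
  have det: "P t * S t - Q t * R t = 1" for t
  proof -
    have "P t * S t - Q t * R t = (p t)\<^sup>2 * b t * ((cos (hh t))\<^sup>2 + (sin (hh t))\<^sup>2)"
    proof -
      have "x * C * (x * (u * s + v * C)) - x * s * (x * (u * C - v * s)) = x\<^sup>2 * v * (C\<^sup>2 + s\<^sup>2)" for x C s u v :: real
        by (simp add: power2_eq_square algebra_simps)
      then show ?thesis unfolding P_def Q_def R_def S_def .
    qed
    also have "\<dots> = 1" using b0 [of t] by (simp add: p_def power_divide)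
    finally show ?thesis .
  qed
  show ?thesis
    unfolding reducible_def
  proof (intro exI conjI allI)
    let ?\<psi> = "\<lambda>t. vector [vector [P t, Q t], vector [R t, S t]] :: real ^ 2 ^ 2"
    show "\<rho> / 2 > 0" using \<rho> by simp
    show "analytic_quasi_periodic \<omega> (\<rho> / 2) (\<lambda>t. ?\<psi> t $ i $ j)" for i j
      using exhaust_2 [of i] exhaust_2 [of j]
        q [OF hol(1) val(1)] q [OF hol(2) val(2)] q [OF hol(3) val(3)] q [OF hol(4) val(4)] by auto
    show "symplectic_transformation ?\<psi>" by (rule symplectic_transformation_of_det [OF det])
    show "hamiltonian_matrix (r *\<^sub>R J)" by (rule hamiltonian_matrix_rotation)
    show "linear_solution (\<lambda>t. hill_A + \<epsilon> *\<^sub>R hill_Q a t) (\<lambda>t. ?\<psi> t *v w t) = linear_solution (\<lambda>t. r *\<^sub>R J) w" for w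
      by (rule floquet_conjugation [OF dP dQ dR dS det])
  qed
qed

section \<open>Cantor sets of parameters\<close>

text \<open>A compact subset of \<open>A\<close> that avoids an open neighbourhood of the rationals
  contains no interval, and both removals can be made small in measure. Keeping the points where the
  set has locally positive measure removes a null set and leaves no isolated point.\<close>

lemma cantor_subset:
  fixes A :: "real set"
  assumes A: "A \<in> lmeasurable" "bounded A" and c: "0 \<le> c" "c < measure lebesgue A"
  obtains E where "E \<subseteq> A" "cantor_set E" "c < measure lebesgue E"
proof -
  \<comment> \<open>A third, because less than \<open>e\<close> is lost with the neighbourhood
    \<open>V\<close> and less than \<open>e\<close> in passing to the compact
    \<open>K\<close>.\<close>
  define e where "e = (measure lebesgue A - c) / 3"
  have e: "e > 0" using c by (simp add: e_def)
  have "negligible (\<rat> :: real set)"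
    using null_sets_completionI [OF countable_imp_null_set_lborel [OF countable_rat]]
    by (simp add: negligible_iff_null_sets)
  then have Q: "(\<rat> :: real set) \<in> lmeasurable" "measure lebesgue (\<rat> :: real set) = 0"
    by (auto simp: negligible_iff_measure)
  obtain V :: "real set" where V0: "open V" "\<rat> \<subseteq> V" "V - \<rat> \<in> lmeasurable" "emeasure lebesgue (V - \<rat>) < ennreal e"
    by (rule sets_lebesgue_outer_open [OF fmeasurableD [OF Q(1)] e]) (rule that; assumption)
  have V: "open V" "\<rat> \<subseteq> V" "V \<in> lmeasurable" "measure lebesgue V < e"
  proof -
    have eq: "V = (V - \<rat>) \<union> \<rat>" using V0(2) by blast
    show "V \<in> lmeasurable" by (subst eq) (intro fmeasurable.Un V0(3) Q(1))
    have "measure lebesgue V \<le> measure lebesgue (V - \<rat>) + measure lebesgue (\<rat> :: real set)"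
      by (subst eq, rule measure_Un_le) (use V0 Q in \<open>auto intro: fmeasurableD\<close>)
    moreover have "measure lebesgue (V - \<rat>) < e"
      using V0(4) unfolding emeasure_eq_measure2 [OF V0(3)] by (simp add: ennreal_less_iff)
    ultimately show "measure lebesgue V < e" using Q(2) by linarith
  qed (use V0 in auto)
  have AV: "A - V \<in> lmeasurable" using A V by (intro fmeasurable_Diff) auto
  obtain K where K: "closed K" "K \<subseteq> A - V" "(A - V) - K \<in> lmeasurable" "emeasure lebesgue ((A - V) - K) < ennreal e"
    by (rule sets_lebesgue_inner_closed [OF fmeasurableD [OF AV] e]) (rule that; assumption)
  have cK: "compact K" using K A(2) by (meson Diff_subset bounded_subset compact_eq_bounded_closed order_trans)
  have Km: "K \<in> lmeasurable" using cK by (rule lmeasurable_compact)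
  have "measure lebesgue A \<le> measure lebesgue V + (measure lebesgue ((A - V) - K) + measure lebesgue K)"
  proof -
    have "measure lebesgue A \<le> measure lebesgue (V \<union> (((A - V) - K) \<union> K))"
      by (rule measure_mono_fmeasurable) (use A V K Km in \<open>auto intro!: fmeasurable.Un\<close>)
    also have "\<dots> \<le> measure lebesgue V + measure lebesgue (((A - V) - K) \<union> K)"
      by (rule measure_Un_le [OF fmeasurableD [OF V(3)] fmeasurableD [OF fmeasurable.Un [OF K(3) Km]]])
    also have "measure lebesgue (((A - V) - K) \<union> K) \<le> measure lebesgue ((A - V) - K) + measure lebesgue K"
      by (rule measure_Un_le [OF fmeasurableD [OF K(3)] fmeasurableD [OF Km]])
    finally show ?thesis by simp
  qed
  moreover have "measure lebesgue ((A - V) - K) < e"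
  proof -
    have "emeasure lebesgue ((A - V) - K) = ennreal (measure lebesgue ((A - V) - K))"
      using K(3) by (rule emeasure_eq_measure2)
    then show ?thesis using K(4) by (simp add: ennreal_less_iff)
  qed
  moreover have "measure lebesgue A = c + 3 * e" unfolding e_def by (simp add: field_simps)
  ultimately have mK: "c < measure lebesgue K" using V(4) Q(2) e by linarith
  define N where "N = {(x, d). d > 0 \<and> measure lebesgue (K \<inter> ball x d) = 0}"
  define E where "E = {x \<in> K. \<forall>d>0. measure lebesgue (K \<inter> ball x d) \<noteq> 0}"
  have Kb: "K \<inter> ball x d \<in> lmeasurable" for x d
    using Km by (simp add: fmeasurable.Int)
  \<comment> \<open>With half the radius, every point of \<open>ball x (d / 2)\<close> is itself the
    centre of a ball of radius \<open>d / 2\<close> that meets \<open>K\<close> in a null set; so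
    \<open>K - E\<close> is relatively open in \<open>K\<close>.\<close>
  have E_eq: "E = K - (\<Union>(x, d)\<in>N. ball x (d / 2))"
  proof (intro set_eqI iffI)
    fix y assume y: "y \<in> E"
    have "y \<notin> ball x (d / 2)" if "(x, d) \<in> N" for x d
    proof
      assume yx: "y \<in> ball x (d / 2)"
      have "ball y (d / 2) \<subseteq> ball x d"
        using yx by (auto simp: dist_real_def abs_if split: if_splits)
      then have le: "measure lebesgue (K \<inter> ball y (d / 2)) \<le> measure lebesgue (K \<inter> ball x d)"
        by (intro measure_mono_fmeasurable fmeasurableD Kb) auto
      have z: "measure lebesgue (K \<inter> ball x d) = 0" using that by (simp add: N_def)
      have "measure lebesgue (K \<inter> ball y (d / 2)) = 0"
        by (rule antisym [OF order_trans [OF le eq_refl [OF z]] measure_nonneg])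
      moreover have "d / 2 > 0" using that by (simp add: N_def)
      ultimately show False using y by (auto simp: E_def)
    qed
    then show "y \<in> K - (\<Union>(x, d)\<in>N. ball x (d / 2))" using y by (auto simp: E_def)
  next
    fix y assume y: "y \<in> K - (\<Union>(x, d)\<in>N. ball x (d / 2))"
    have "measure lebesgue (K \<inter> ball y d) \<noteq> 0" if "d > 0" for d
    proof
      assume "measure lebesgue (K \<inter> ball y d) = 0"
      then have "(y, d) \<in> N" using that by (simp add: N_def)
      then have "y \<in> (\<Union>(x, d)\<in>N. ball x (d / 2))" using that by force
      then show False using y by blast
    qed
    then show "y \<in> E" using y by (auto simp: E_def)
  qed
  have oU: "open (\<Union>(x, d)\<in>N. ball x (d / 2))" by (intro open_UN) auto
  have cE: "compact E" unfolding E_eq using cK oU by (rule compact_diff)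
  have neg: "negligible (K - E)"
  proof -
    have op: "open S" if "S \<in> (\<lambda>(x, d). ball x (d / 2)) ` N" for S using that by auto
    \<comment> \<open>Lindelof's theorem reduces the union of balls to a countable one, whose trace
      on \<open>K\<close> is negligible.\<close>
    obtain F' where F': "F' \<subseteq> (\<lambda>(x, d). ball x (d / 2)) ` N" "countable F'" "\<Union>F' = \<Union>((\<lambda>(x, d). ball x (d / 2)) ` N)"
      by (rule Lindelof [of "(\<lambda>(x, d). ball x (d / 2)) ` N"]) (erule op, (rule that; assumption))
    have "K - E \<subseteq> (\<Union>B\<in>F'. K \<inter> B)" using F'(3) unfolding E_eq by blast
    moreover have "negligible (\<Union>B\<in>F'. K \<inter> B)"
    proof (rule negligible_countable_Union)
      show "countable ((\<lambda>B. K \<inter> B) ` F')" using F'(2) by simp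
      fix S assume "S \<in> (\<lambda>B. K \<inter> B) ` F'"
      then obtain x d where xd: "(x, d) \<in> N" "S = K \<inter> ball x (d / 2)" using F'(1) by auto
      have "negligible (K \<inter> ball x d)" using xd Kb by (simp add: N_def negligible_iff_measure)
      then show "negligible S" unfolding xd(2)
        by (rule negligible_subset) (use xd in \<open>auto simp: N_def\<close>)
    qed
    ultimately show ?thesis by (rule negligible_subset [rotated])
  qed
  have mE: "measure lebesgue E = measure lebesgue K"
  proof (rule measure_negligible_symdiff [OF Km])
    have "K - E \<union> (E - K) = K - E" by (auto simp: E_def)
    then show "negligible (K - E \<union> (E - K))" using neg by simp
  qed
  have lim: "x islimpt E" if x: "x \<in> E" for x
    unfolding islimpt_def
  proof (intro allI impI)
    fix T assume T: "x \<in> T" "open T"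
    then obtain d where d: "d > 0" "ball x d \<subseteq> T" using open_contains_ball by blast
    show "\<exists>y\<in>E. y \<in> T \<and> y \<noteq> x"
    proof (rule ccontr)
      assume "\<not> ?thesis"
      \<comment> \<open>If \<open>x\<close> were isolated in \<open>E\<close>, then \<open>K\<close>
        near \<open>x\<close> would be covered by a null set and one point.\<close>
      then have "K \<inter> ball x d \<subseteq> (K - E) \<union> {x}" using d by auto
      then have "negligible (K \<inter> ball x d)"
        using neg by (meson negligible_Un negligible_sing negligible_subset)
      then have "measure lebesgue (K \<inter> ball x d) = 0" by (simp add: negligible_imp_measure0)
      then show False using x d by (auto simp: E_def)
    qed
  qed
  have EQ: "E \<inter> \<rat> = {}" using K(2) V(2) by (auto simp: E_def)
  have cc: "connected_component_set E x = {x}" if x: "x \<in> E" for x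
  proof -
    have "y = x" if y: "y \<in> connected_component_set E x" for y
    proof (rule ccontr)
      assume "y \<noteq> x"
      have conn: "connected (connected_component_set E x)" by (rule connected_connected_component)
      have xin: "x \<in> connected_component_set E x" using x by simp
      have "{min x y..max x y} \<subseteq> connected_component_set E x"
        using connected_contains_Icc [OF conn xin y] connected_contains_Icc [OF conn y xin]
        by (cases "x \<le> y") (auto simp: min_def max_def)
      then have sub: "{min x y..max x y} \<subseteq> E" using connected_component_subset by blast
      have "min x y < max x y" using \<open>y \<noteq> x\<close> by auto
      then obtain q where "q \<in> \<rat>" "min x y < q" "q < max x y" using Rats_dense_in_real by blast
      moreover from this have "q \<in> {min x y..max x y}" by simp
      ultimately show False using sub EQ by blast
    qed
    then show ?thesis using x by auto
  qed
  have "E \<noteq> {}" using mE mK c(1) by auto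
  then have "cantor_set E" using cE lim cc by (simp add: cantor_set_def)
  moreover have "E \<subseteq> A" using K(2) by (auto simp: E_def)
  ultimately show ?thesis using that mE mK by simp
qed

text \<open>The function minus \<open>c0\<close> has a bounded primitive, so its mean over
  \<open>{- T..T}\<close> is \<open>c0\<close> up to \<open>B / T\<close>.\<close>

lemma fourier_zero_eq_average:
  fixes F :: "complex ^ 'n \<Rightarrow> complex"
  assumes F: "\<And>t. complex_of_real (a t) = F (line \<omega> t)"
    and S: "\<And>t. ((\<lambda>t. S (line \<omega> t)) has_vector_derivative F (line \<omega> t) - c0) (at t)"
    and B: "\<And>t. norm (S (line \<omega> t)) \<le> B" and avg: "has_average a abar"
  shows "c0 = of_real abar"
proof -
  have eq: "complex_of_real (1 / (2 * T) * integral {- T..T} a) = c0 + (S (line \<omega> T) - S (line \<omega> (- T))) / of_real (2 * T)"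
    if T: "T > 0" for T
  proof -
    let ?I = "(S (line \<omega> T) + of_real T * c0) - (S (line \<omega> (- T)) + of_real (- T) * c0)"
    have "((\<lambda>t. complex_of_real (a t)) has_integral ?I) {- T..T}"
    proof (rule fundamental_theorem_of_calculus)
      fix t
      have "((\<lambda>t. of_real t * c0) has_vector_derivative c0) (at t)"
        using has_vector_derivative_mult_left [OF has_vector_derivative_of_real [OF DERIV_ident]] by simp
      from has_vector_derivative_add [OF S this]
      show "((\<lambda>t. S (line \<omega> t) + of_real t * c0) has_vector_derivative complex_of_real (a t)) (at t within {- T..T})"
        by (rule has_vector_derivative_at_within [OF has_vector_derivative_eq_rhs]) (simp add: F)
    qed (use T in simp)
    note I = this
    from has_integral_Re [OF I] have "(a has_integral Re ?I) {- T..T}" unfolding Re_complex_of_real .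
    then have "integral {- T..T} a = Re ?I" by (rule integral_unique)
    moreover have "Im ?I = 0"
    proof -
      have "((\<lambda>t. 0) has_integral Im ?I) {- T..T}"
        using has_integral_Im [OF I] unfolding Im_complex_of_real .
      then show ?thesis by (rule has_integral_unique [OF _ has_integral_0])
    qed
    ultimately have "complex_of_real (integral {- T..T} a) = ?I" by (simp add: complex_eq_iff)
    then have "complex_of_real (1 / (2 * T) * integral {- T..T} a) = ?I / of_real (2 * T)" by simp
    also have "\<dots> = c0 + (S (line \<omega> T) - S (line \<omega> (- T))) / of_real (2 * T)"
      using T by (simp add: field_simps)
    finally show ?thesis .
  qed
  have B0: "0 \<le> B" using order_trans [OF norm_ge_zero B] .
  have l0: "((\<lambda>T. (S (line \<omega> T) - S (line \<omega> (- T))) / of_real (2 * T)) \<longlongrightarrow> 0) at_top"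
  proof (rule Lim_null_comparison)
    show "\<forall>\<^sub>F T in at_top. norm ((S (line \<omega> T) - S (line \<omega> (- T))) / of_real (2 * T)) \<le> B / T"
      using eventually_gt_at_top [of 0]
    proof eventually_elim
      case (elim T)
      have "norm (S (line \<omega> T) - S (line \<omega> (- T))) \<le> B + B"
        using norm_triangle_ineq4 B by (meson add_mono order_trans)
      then show ?case using elim by (simp add: norm_divide field_simps)
    qed
    show "((\<lambda>T. B / T) \<longlongrightarrow> 0) at_top"
      by (intro real_tendsto_divide_at_top [OF tendsto_const] filterlim_ident)
  qed
  have "((\<lambda>T. c0 + (S (line \<omega> T) - S (line \<omega> (- T))) / of_real (2 * T)) \<longlongrightarrow> c0 + 0) at_top"
    by (intro tendsto_intros l0)
  moreover have "((\<lambda>T. complex_of_real (1 / (2 * T) * integral {- T..T} a)) \<longlongrightarrow> of_real abar) at_top"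
    using avg unfolding has_average_def by (rule tendsto_of_real)
  moreover have "\<forall>\<^sub>F T in at_top. complex_of_real (1 / (2 * T) * integral {- T..T} a) = c0 + (S (line \<omega> T) - S (line \<omega> (- T))) / of_real (2 * T)"
    using eventually_gt_at_top [of "0::real"] by eventually_elim (rule eq)
  ultimately have "((\<lambda>T. complex_of_real (1 / (2 * T) * integral {- T..T} a)) \<longlongrightarrow> c0) at_top"
    by (subst tendsto_cong) auto
  then show ?thesis
    using \<open>((\<lambda>T. complex_of_real (1 / (2 * T) * integral {- T..T} a)) \<longlongrightarrow> of_real abar) at_top\<close>
    by (intro tendsto_unique) auto
qed

text \<open>Fixes the constants of the iteration. \<open>C\<close> and \<open>d0\<close> depend on
  the equation but not on \<open>\<delta>\<close>, which is what the limit of small parameters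
  requires.\<close>

lemma reducible_outside_small_set:
  fixes a :: "real \<Rightarrow> real" and \<omega> :: "real ^ 'n" and \<rho> abar \<alpha> \<tau> :: real
  assumes "\<rho> > 0" and a: "analytic_quasi_periodic \<omega> \<rho> a"
    and avg: "has_average a abar" and "abar > 0"
    and \<alpha>: "\<alpha> > 0" and \<tau>: "\<tau> > 0" and dio: "diophantine \<omega> \<alpha> \<tau>"
  shows "\<exists>C d0. 0 \<le> C \<and> 0 < d0 \<and> (\<forall>\<delta>. 0 < \<delta> \<and> \<delta> < d0 \<longrightarrow>
    (\<exists>G\<in>lmeasurable. measure lebesgue G \<le> C * \<delta>\<^sup>2 \<and>
      (\<forall>x\<in>{1..2} - G. reducible \<omega> (\<lambda>t. hill_A + (\<delta>\<^sup>2 * x) *\<^sub>R hill_Q a t))))"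
proof -
  obtain F where F: "analytic_nvar_on F (strip \<rho>)"
    "\<forall>\<theta>\<in>strip \<rho>. \<forall>j. F (\<theta> + axis j (2 * complex_of_real pi)) = F \<theta>"
    "\<And>t. complex_of_real (a t) = F (line \<omega> t)"
    using a unfolding analytic_quasi_periodic_def line_def by blast
  \<comment> \<open>Strictly inside the given strip, where \<open>F\<close> is bounded, and at most
    1 as the estimates of width losses require.\<close>
  define \<rho>0 where "\<rho>0 = min \<rho> 1 / 2"
  have \<rho>0: "0 < \<rho>0" "\<rho>0 < \<rho>" "\<rho>0 \<le> 1" using \<open>\<rho> > 0\<close> by (auto simp: \<rho>0_def min_def)
  have hF': "hol_per \<rho> F" by (rule hol_per_of_analytic [OF F(1,2)])
  obtain B0' where B0': "\<And>\<theta>. \<theta> \<in> ostrip \<rho>0 \<Longrightarrow> norm (F \<theta>) \<le> B0'"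
    using hol_per_bounded [OF hF' \<rho>0(2)] by blast
  define B0 where "B0 = max B0' 0"
  have B0: "\<And>\<theta>. \<theta> \<in> ostrip \<rho>0 \<Longrightarrow> norm (F \<theta>) \<le> B0" "0 \<le> B0"
    using B0' by (auto simp: B0_def le_max_iff_disj)
  have hF: "hol_per \<rho>0 F" using hF' \<rho>0 by (auto intro: hol_per_mono)
  \<comment> \<open>Leaves room for \<open>2 * CARD('n)\<close> powers for summability and three
    factors \<open>wt k powr \<tau>\<close> for the measure estimate.\<close>
  define p where "p = nat \<lceil>2 * real CARD('n) + 3 * \<tau>\<rceil>"
  have p: "2 * real CARD('n) + 3 * \<tau> \<le> real p" unfolding p_def by linarith
  have dot: "\<alpha> / freq_abs k powr \<tau> \<le> \<bar>dotp k \<omega>\<bar>" if "k \<noteq> 0" for k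
    using dio that unfolding diophantine_def dotp_def freq_abs_def by blast
  have dio0: "k = 0" if "dotp k \<omega> = 0" for k
  proof (rule ccontr)
    assume k: "k \<noteq> 0"
    have "0 < \<alpha> / freq_abs k powr \<tau>" using \<alpha> freq_abs_ge_1 [OF k] by simp
    then show False using dot [OF k] that by simp
  qed
  have K1: "norm (inverse (\<i> * dotp k \<omega>)) \<le> 1 / \<alpha> * wt k ^ p" for k
  proof (cases "k = 0")
    case True
    then show ?thesis using \<alpha> by (simp add: dotp_def)
  next
    case False
    have f0: "0 < freq_abs k powr \<tau>" using freq_abs_ge_1 [OF False] by simp
    have "freq_abs k powr \<tau> \<le> wt k powr \<tau>"
      using \<tau> by (intro powr_mono2) (auto simp: wt_def)
    also have "\<dots> \<le> wt k powr real p" using p \<tau> by (intro powr_mono) auto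
    also have "\<dots> = wt k ^ p" by (simp add: powr_realpow)
    finally have fw: "freq_abs k powr \<tau> \<le> wt k ^ p" .
    have "inverse \<bar>dotp k \<omega>\<bar> \<le> inverse (\<alpha> / freq_abs k powr \<tau>)"
      using dot [OF False] \<alpha> f0 by (intro le_imp_inverse_le) auto
    also have "\<dots> = 1 / \<alpha> * freq_abs k powr \<tau>" by simp
    also have "\<dots> \<le> 1 / \<alpha> * wt k ^ p" using fw \<alpha> by (intro mult_left_mono) auto
    finally show ?thesis by (simp add: norm_inverse norm_mult)
  qed
  define s1 where "s1 = sol_const TYPE('n) p / (\<rho>0 / 4) ^ (2 * p + 2 * CARD('n))"
  have sc0: "0 \<le> sol_const TYPE('n) p" using wt_sum_nonneg [where 'n = 'n] by (simp add: sol_const_def)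
  have s1: "0 \<le> s1" using sc0 \<rho>0 by (simp add: s1_def)
  \<comment> \<open>A single function is treated as a family over one parameter, so that
    \<open>bnd_sol\<close> applies.\<close>
  have bF: "bnd {0} \<rho>0 B0 (\<lambda>x. F)" by (rule bnd_fixed [OF hF B0])
  have bs: "bnd {0} (\<rho>0 - \<rho>0 / 4) (B0 * (1 / \<alpha> + 0 * (1 / \<alpha>)\<^sup>2) * s1) (\<lambda>x. sol \<omega> 0 F)"
    unfolding s1_def
    by (rule bnd_sol [OF bF B0(2), where \<nu> = "\<lambda>x. 0"]) (use \<rho>0 K1 \<alpha> in auto)
  define B1 where "B1 = B0 * (1 / \<alpha>) * s1"
  have B1: "0 \<le> B1" using B0 \<alpha> s1 by (simp add: B1_def)
  define S where "S = sol \<omega> 0 F"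
  have hS: "hol_per (\<rho>0 - \<rho>0 / 4) S" "\<And>\<theta>. \<theta> \<in> ostrip (\<rho>0 - \<rho>0 / 4) \<Longrightarrow> norm (S \<theta>) \<le> B1"
    using bndD(1,2) [OF bs] by (auto simp: S_def B1_def)
  have dS: "((\<lambda>t. S (line \<omega> t)) has_vector_derivative F (line \<omega> t) - fourier F 0) (at t)" for t
    using sol_flow_aux [OF hF \<rho>0(1) B0(1), of \<omega> 0 "1 / \<alpha>" p t] K1 dio0 by (auto simp: S_def)
  have pos: "0 < \<rho>0 - \<rho>0 / 4" using \<rho>0 by simp
  have c0: "fourier F 0 = of_real abar"
    by (rule fourier_zero_eq_average [OF F(3) dS hS(2) avg]) (rule line_in_ostrip [OF pos])
  define Bf0 where "Bf0 \<theta> = - 1 * S \<theta>" for \<theta>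
  have hB: "hol_per (\<rho>0 - \<rho>0 / 4) Bf0" "\<And>\<theta>. \<theta> \<in> ostrip (\<rho>0 - \<rho>0 / 4) \<Longrightarrow> norm (Bf0 \<theta>) \<le> B1"
    unfolding Bf0_def [abs_def] using hol_per_mult [OF hol_per_const [of _ "- 1"] hS(1)] hS(2) by auto
  have bB: "bnd {0} (\<rho>0 - \<rho>0 / 4) B1 (\<lambda>x. Bf0)" by (rule bnd_fixed [OF hB B1])
  have bb: "bnd {0} (\<rho>0 - \<rho>0 / 4 - \<rho>0 / 4) (B1 * (1 / \<alpha> + 0 * (1 / \<alpha>)\<^sup>2) * s1) (\<lambda>x. sol \<omega> 0 Bf0)"
    unfolding s1_def
    by (rule bnd_sol [OF bB B1, where \<nu> = "\<lambda>x. 0"]) (use \<rho>0 K1 \<alpha> in auto)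
  \<comment> \<open>The mean is subtracted so that \<open>Bf\<close> has a quasi-periodic primitive,
    \<open>bf\<close>; only the derivative of \<open>Bf\<close> is prescribed, so this constant is
    free.\<close>
  define Bf where "Bf \<theta> = Bf0 \<theta> - fourier Bf0 0" for \<theta>
  define bf where "bf = sol \<omega> 0 Bf0"
  \<comment> \<open>Two quarters of \<open>\<rho>0\<close> have been spent, one for each
    primitive.\<close>
  define \<rho>1 where "\<rho>1 = \<rho>0 / 2"
  have \<rho>1: "0 < \<rho>1" "\<rho>1 \<le> 1" "\<rho>1 \<le> \<rho>0 - \<rho>0 / 4" "\<rho>1 = \<rho>0 - \<rho>0 / 4 - \<rho>0 / 4" using \<rho>0 by (auto simp: \<rho>1_def)
  define C1 where "C1 = 2 * B1 + B1 * (1 / \<alpha>) * s1"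
  have C1: "0 \<le> C1" "2 * B1 \<le> C1" "B1 * (1 / \<alpha>) * s1 \<le> C1" using B1 \<alpha> s1 by (auto simp: C1_def)
  define \<kappa> where "\<kappa> = sqrt abar"
  have \<kappa>: "\<kappa> > 0" "(of_real \<kappa>)\<^sup>2 = complex_of_real abar"
    using \<open>abar > 0\<close> by (auto simp: \<kappa>_def simp flip: of_real_power)
  have Bf: "hol_per \<rho>1 Bf" "\<And>\<theta>. \<theta> \<in> ostrip \<rho>1 \<Longrightarrow> norm (Bf \<theta>) \<le> C1"
    "\<And>t. ((\<lambda>t. Bf (line \<omega> t)) has_vector_derivative - (F (line \<omega> t) - (of_real \<kappa>)\<^sup>2)) (at t)"
  proof -
    show "hol_per \<rho>1 Bf"
      unfolding Bf_def [abs_def] by (intro hol_per_diff hol_per_const hol_per_mono [OF hB(1) \<rho>1(3)])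
    have "norm (fourier Bf0 0) \<le> B1"
      using fourier_bound [OF hB(1) pos hB(2), of 0] by (simp add: freq_abs_eq)
    moreover have "norm (Bf0 \<theta>) \<le> B1" if "\<theta> \<in> ostrip \<rho>1" for \<theta>
      using hB(2) that ostrip_mono [OF \<rho>1(3)] by blast
    ultimately have "norm (Bf \<theta>) \<le> B1 + B1" if "\<theta> \<in> ostrip \<rho>1" for \<theta>
      unfolding Bf_def using that by (meson add_mono norm_triangle_ineq4 order_trans)
    then show "norm (Bf \<theta>) \<le> C1" if "\<theta> \<in> ostrip \<rho>1" for \<theta>
      using that C1(2) by fastforce
    show "((\<lambda>t. Bf (line \<omega> t)) has_vector_derivative - (F (line \<omega> t) - (of_real \<kappa>)\<^sup>2)) (at t)" for t
      using has_vector_derivative_diff [OF has_vector_derivative_minus [OF dS [of t]] has_vector_derivative_const [of "fourier Bf0 0" "at t"]]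
      unfolding \<kappa>(2) c0 [symmetric] by (simp add: Bf_def Bf0_def)
  qed
  have bf: "hol_per \<rho>1 bf" "\<And>\<theta>. \<theta> \<in> ostrip \<rho>1 \<Longrightarrow> norm (bf \<theta>) \<le> C1"
    "\<And>t. ((\<lambda>t. bf (line \<omega> t)) has_vector_derivative Bf (line \<omega> t)) (at t)"
  proof -
    show "hol_per \<rho>1 bf" using bndD(1) [OF bb] by (simp add: bf_def \<rho>1(4))
    show "norm (bf \<theta>) \<le> C1" if "\<theta> \<in> ostrip \<rho>1" for \<theta>
      using bndD(2) [OF bb, of 0 \<theta>] that C1(3) by (simp add: bf_def \<rho>1(4))
    show "((\<lambda>t. bf (line \<omega> t)) has_vector_derivative Bf (line \<omega> t)) (at t)" for t
      using sol_flow_aux [OF hB(1) pos hB(2), of \<omega> 0 "1 / \<alpha>" p t] K1 dio0 by (auto simp: bf_def Bf_def)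
  qed
  \<comment> \<open>Half of the Diophantine constant is reserved for the divisors shifted by
    \<open>2 * mu\<close>.\<close>
  define w0 where "w0 = \<alpha> / 2"
  define b :: real where "b = 4 * 2 ^ (2 * p + 2 * CARD('n))"
  define a1 where "a1 = 4 * (exp 4)\<^sup>2 * ((1 / w0 + 1 / \<kappa>) + 2 * \<kappa> * (1 / w0 + 1 / \<kappa>)\<^sup>2) * (sol_const TYPE('n) p * (8 / \<rho>1) ^ (2 * p + 2 * CARD('n)))"
  define a2 where "a2 = 1 / \<alpha> * (sol_const TYPE('n) p * (8 / \<rho>1) ^ (2 * p + 2 * CARD('n)))"
  have a12: "0 \<le> a1" "0 \<le> a2"
    unfolding a1_def a2_def w0_def using \<alpha> \<kappa>(1) sc0 \<rho>1
    by (auto intro!: mult_nonneg_nonneg add_nonneg_nonneg)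
  define A where "A = 1 + a1 + a2"
  define h where "h = min (1 / (4 * b\<^sup>2)) (min (1 / 8) (\<kappa> / 16))"
  have b0: "b > 0" by (simp add: b_def)
  have h: "0 < h" "h \<le> 1 / (4 * b\<^sup>2)" "h \<le> 1 / 8" "h \<le> \<kappa> / 16"
    using b0 \<kappa>(1) by (auto simp: h_def)
  \<comment> \<open>\<open>c\<close> dominates the coefficients of \<open>\<delta>\<close> in the
    smallness conditions and \<open>d\<close> lies below all three right-hand sides, so
    \<open>\<delta> * c \<le> d\<close> implies all of them; the summand 1 keeps \<open>c\<close>
    positive.\<close>
  define c where "c = 12 * \<kappa> * C1 + 8 * C1\<^sup>2 + 4 * C1 + 1"
  define d where "d = min (h / A\<^sup>2) (min (1 / 2) (\<kappa> / 4))"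
  define d0 where "d0 = min 1 (d / c)"
  have A1: "1 \<le> A" using a12 by (simp add: A_def)
  have cc: "12 * \<kappa> * C1 + 8 * C1\<^sup>2 \<le> c" "4 * C1 \<le> c" "0 < c"
    using C1(1) \<kappa>(1) by (auto simp: c_def intro!: add_nonneg_pos add_nonneg_nonneg mult_nonneg_nonneg)
  have dpos: "0 < d" using h A1 \<kappa>(1) by (simp add: d_def)
  have d0: "0 < d0" using dpos cc by (simp add: d0_def)
  define C where "C = 4 * (8 * w0 * (4 / w0) ^ 3 * \<kappa>\<^sup>2) * wt_sum TYPE('n)"
  have C0: "0 \<le> C" using \<alpha> wt_sum_nonneg [where 'n = 'n] by (simp add: C_def w0_def)
  have "\<exists>G\<in>lmeasurable. measure lebesgue G \<le> C * \<delta>\<^sup>2 \<and>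
      (\<forall>x\<in>{1..2} - G. reducible \<omega> (\<lambda>t. hill_A + (\<delta>\<^sup>2 * x) *\<^sub>R hill_Q a t))"
    if \<delta>: "0 < \<delta>" "\<delta> < d0" for \<delta>
  proof -
    have "\<delta> < d / c" using \<delta> by (simp add: d0_def)
    then have dc: "\<delta> * c \<le> d" using cc by (simp add: pos_less_divide_eq less_imp_le)
    have sm: "\<delta> * y \<le> d" if "y \<le> c" for y
      using mult_left_mono [OF that, of \<delta>] \<delta> dc by linarith
    interpret hill_kam F Bf bf \<omega> \<rho>1 \<kappa> w0 "1 / \<alpha>" C1 \<delta> A b h p
    proof
      show "0 < w0" using \<alpha> by (simp add: w0_def)
      show "\<delta> \<le> 1" using \<delta> by (simp add: d0_def)
      show "4 * (exp 4)\<^sup>2 * ((1 / w0 + 1 / \<kappa>) + 2 * \<kappa> * (1 / w0 + 1 / \<kappa>)\<^sup>2) * (sol_const TYPE('n) p * (8 / \<rho>1) ^ (2 * p + 2 * CARD('n))) \<le> A"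
        using a12 by (simp only: a1_def [symmetric] A_def)
      show "1 / \<alpha> * (sol_const TYPE('n) p * (8 / \<rho>1) ^ (2 * p + 2 * CARD('n))) \<le> A"
        using a12 by (simp only: a2_def [symmetric] A_def)
      show "\<delta> * (12 * \<kappa> * C1 + 8 * C1\<^sup>2) \<le> h / A\<^sup>2" "\<delta> * (4 * C1) \<le> 1 / 2" "\<delta> * (4 * C1) \<le> \<kappa> / 4"
        using sm [OF cc(1)] sm [OF cc(2)] by (auto simp: d_def)
    qed (use \<rho>1 \<kappa>(1) \<alpha> C1(1) K1 Bf bf dio0 \<delta> A1 h b_def in auto)
    have dph: "2 * w0 / freq_abs k powr \<tau> \<le> \<bar>dotp k \<omega>\<bar>" if "k \<noteq> 0" for k
      using dot [OF that] by (simp add: w0_def)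
    obtain G where G: "G \<in> lmeasurable" "measure lebesgue G \<le> C * \<delta>\<^sup>2" "\<forall>x\<in>{1..2} - G. \<forall>n. x \<in> good n"
      using kam_measure [OF dph \<tau> p] unfolding C_def by blast
    have "reducible \<omega> (\<lambda>t. hill_A + (\<delta>\<^sup>2 * x) *\<^sub>R hill_Q a t)" if x: "x \<in> {1..2} - G" for x
    proof -
      obtain M m \<mu> where M: "hol_per (\<rho>1 / 2) M" and m: "hol_per (\<rho>1 / 2) m"
        and mb: "\<And>\<theta>. \<theta> \<in> ostrip (\<rho>1 / 2) \<Longrightarrow> norm (m \<theta> - \<i> * of_real (\<delta> * \<kappa> * sqrt x)) \<le> \<delta> * \<kappa> / 2"
        and dM: "\<And>t. ((\<lambda>t. M (line \<omega> t)) has_vector_derivative m (line \<omega> t) - \<mu>) (at t)"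
        and dm: "\<And>t. ((\<lambda>t. m (line \<omega> t)) has_vector_derivative
           - (m (line \<omega> t))\<^sup>2 - of_real (\<delta>\<^sup>2 * x) * F (line \<omega> t)) (at t)"
        using kam_limit [of x] G(3) x by blast
      have dk: "0 < \<delta> * \<kappa>" using \<delta> \<kappa>(1) by simp
      have "\<delta> * \<kappa> * 1 \<le> \<delta> * \<kappa> * sqrt x" using x dk by (intro mult_left_mono) auto
      \<comment> \<open>As \<open>x\<close> is at least 1, the error
        \<open>\<delta> * \<kappa> / 2\<close> of \<open>m\<close> is at most half the modulus of
        its centre, as \<open>reducible_of_riccati\<close> asks.\<close>
      then have le: "\<delta> * \<kappa> / 2 \<le> \<delta> * \<kappa> * sqrt x / 2" by simp
      show ?thesis
      proof (rule reducible_of_riccati [OF M m, where c = "\<delta> * \<kappa> * sqrt x / 2" and \<mu> = \<mu>])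
        show "0 < \<delta> * \<kappa> * sqrt x / 2" using le dk by linarith
        show "norm (m \<theta> - \<i> * of_real (2 * (\<delta> * \<kappa> * sqrt x / 2))) \<le> \<delta> * \<kappa> * sqrt x / 2"
          if "\<theta> \<in> ostrip (\<rho>1 / 2)" for \<theta>
          using mb [OF that] le by simp
        show "((\<lambda>t. m (line \<omega> t)) has_vector_derivative
           - (m (line \<omega> t))\<^sup>2 - of_real (\<delta>\<^sup>2 * x * a t)) (at t)" for t
          using dm [of t] by (simp add: F(3) [symmetric])
      qed (use \<rho>1 dM in auto)
    qed
    then show ?thesis using G by blast
  qed
  then show ?thesis using C0 d0 by blast
qed

section \<open>Scaling of measures and dyadic blocks\<close>

lemma lmeasurable_scaling:
  fixes S :: "real set"
  assumes "0 < D" "S \<in> lmeasurable"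
  shows "(*\<^sub>R) D ` S \<in> lmeasurable" and "measure lebesgue ((*\<^sub>R) D ` S) = D * measure lebesgue S"
proof -
  have "(*\<^sub>R) D ` S = (*\<^sub>R) (1 / D) -` S \<inter> space lebesgue"
    using assms(1) by (auto simp: image_iff intro!: bexI [of _ "_ / D"])
  also have "\<dots> \<in> sets lebesgue"
    using assms(2) by (intro measurable_sets [OF lebesgue_measurable_scaling]) (rule fmeasurableD)
  finally have s: "(*\<^sub>R) D ` S \<in> sets lebesgue" .
  have "emeasure lebesgue ((*\<^sub>R) D ` S) = \<bar>D\<bar> * emeasure lebesgue S"
    using emeasure_lebesgue_affine [of D 0 S] by simp
  also have "\<dots> < \<infinity>" unfolding emeasure_eq_measure2 [OF assms(2)] by (simp add: ennreal_mult_less_top)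
  finally show "(*\<^sub>R) D ` S \<in> lmeasurable" using s by (intro fmeasurableI) auto
  show "measure lebesgue ((*\<^sub>R) D ` S) = D * measure lebesgue S"
    using measure_lebesgue_affine [of D 0 S] assms(1) by simp
qed

text \<open>The least \<open>n\<close> with \<open>\<epsilon>0 / 2 ^ n \<le> \<epsilon>\<close> is
  positive because \<open>\<epsilon> < \<epsilon>0\<close>, and its minimality gives the upper
  bound.\<close>

lemma dyadic_scale:
  fixes \<epsilon> \<epsilon>0 :: real
  assumes "0 < \<epsilon>" "\<epsilon> < \<epsilon>0"
  obtains j :: nat where "\<epsilon>0 / 2 ^ Suc j \<le> \<epsilon>" "\<epsilon> \<le> 2 * (\<epsilon>0 / 2 ^ Suc j)"
proof -
  obtain n where "(1 / 2) ^ n < \<epsilon> / \<epsilon>0"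
    using real_arch_pow_inv [of "\<epsilon> / \<epsilon>0" "1 / 2"] assms by auto
  then have ex: "\<epsilon>0 / 2 ^ n \<le> \<epsilon>" using assms by (simp add: power_divide field_simps less_imp_le)
  define k where "k = (LEAST n. \<epsilon>0 / 2 ^ n \<le> \<epsilon>)"
  have k: "\<epsilon>0 / 2 ^ k \<le> \<epsilon>" unfolding k_def by (rule LeastI [of _ n]) (rule ex)
  have "k \<noteq> 0" using k assms by (auto intro: ccontr)
  then obtain j where j: "k = Suc j" using not0_implies_Suc by blast
  have "\<not> \<epsilon>0 / 2 ^ j \<le> \<epsilon>" using not_less_Least [of j "\<lambda>n. \<epsilon>0 / 2 ^ n \<le> \<epsilon>"] j by (simp add: k_def)
  then show ?thesis using that [of j] k j by simp
qed

theorem theorem4p1: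
  fixes a :: "real \<Rightarrow> real" and \<omega> :: "real ^ 'n" and \<rho> abar \<alpha> \<tau> :: real
  assumes "\<rho> > 0" and "analytic_quasi_periodic \<omega> \<rho> a"
    and "has_average a abar" and "abar > 0"
    and "\<alpha> > 0" and "\<tau> > real CARD('n) - 1" and "diophantine \<omega> \<alpha> \<tau>"
  shows "\<exists>E :: real \<Rightarrow> real set.
      (\<exists>\<epsilon>1>0. \<forall>\<epsilon>0. 0 < \<epsilon>0 \<and> \<epsilon>0 < \<epsilon>1 \<longrightarrow>
         cantor_set (E \<epsilon>0) \<and> E \<epsilon>0 \<subseteq> {0<..<\<epsilon>0} \<and>
         measure lebesgue (E \<epsilon>0) > 0 \<and>
         (\<forall>\<epsilon>\<in>E \<epsilon>0. reducible \<omega> (\<lambda>t. hill_A + \<epsilon> *\<^sub>R hill_Q a t))) \<and>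
      ((\<lambda>\<epsilon>0. measure lebesgue (E \<epsilon>0) / \<epsilon>0) \<longlongrightarrow> 1) (at_right 0)"
proof -
  have "CARD('n) \<ge> 1" by (simp add: Suc_leI)
  then have \<tau>: "\<tau> > 0" using assms(6) by linarith
  obtain C d0 where C: "0 \<le> C" and d0: "0 < d0"
    and G: "\<And>\<delta>. 0 < \<delta> \<Longrightarrow> \<delta> < d0 \<Longrightarrow> \<exists>G\<in>lmeasurable. measure lebesgue G \<le> C * \<delta>\<^sup>2 \<and>
      (\<forall>x\<in>{1..2} - G. reducible \<omega> (\<lambda>t. hill_A + (\<delta>\<^sup>2 * x) *\<^sub>R hill_Q a t))"
    using reducible_outside_small_set [OF assms(1-5) \<tau> assms(7)] by blast
  \<comment> \<open>The change of variables \<open>\<epsilon> = D * x\<close> with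
    \<open>D = \<delta>\<^sup>2\<close> maps \<open>{1..2}\<close> to \<open>{D..2 * D}\<close> and
    multiplies measures by \<open>D\<close>, so \<open>C * \<delta>\<^sup>2\<close> becomes
    \<open>C * D\<^sup>2\<close>.\<close>
  have G2: "\<exists>G\<in>lmeasurable. measure lebesgue G \<le> C * D\<^sup>2 \<and>
      (\<forall>\<epsilon>\<in>{D..2 * D} - G. reducible \<omega> (\<lambda>t. hill_A + \<epsilon> *\<^sub>R hill_Q a t))"
    if D: "0 < D" "D < d0\<^sup>2" for D
  proof -
    have s: "0 < sqrt D" "sqrt D < d0" "(sqrt D)\<^sup>2 = D"
      using D d0 by (auto intro: real_less_lsqrt)
    obtain G0 where G0: "G0 \<in> lmeasurable" "measure lebesgue G0 \<le> C * (sqrt D)\<^sup>2"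
      "\<forall>x\<in>{1..2} - G0. reducible \<omega> (\<lambda>t. hill_A + ((sqrt D)\<^sup>2 * x) *\<^sub>R hill_Q a t)"
      using G [OF s(1,2)] by blast
    show ?thesis
    proof (intro bexI conjI ballI)
      show "(*\<^sub>R) D ` G0 \<in> lmeasurable" by (rule lmeasurable_scaling(1) [OF D(1) G0(1)])
      have "measure lebesgue ((*\<^sub>R) D ` G0) = D * measure lebesgue G0"
        by (rule lmeasurable_scaling(2) [OF D(1) G0(1)])
      also have "\<dots> \<le> D * (C * D)" using G0(2) D unfolding s(3) by (intro mult_left_mono) auto
      finally show "measure lebesgue ((*\<^sub>R) D ` G0) \<le> C * D\<^sup>2" by (simp add: power2_eq_square mult_ac)
      fix \<epsilon> assume \<epsilon>: "\<epsilon> \<in> {D..2 * D} - (*\<^sub>R) D ` G0"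
      have "\<epsilon> / D \<in> {1..2} - G0"
      proof -
        have "\<epsilon> / D \<notin> G0"
        proof
          assume "\<epsilon> / D \<in> G0"
          then have "D *\<^sub>R (\<epsilon> / D) \<in> (*\<^sub>R) D ` G0" by blast
          then show False using \<epsilon> D by simp
        qed
        then show ?thesis using \<epsilon> D by (simp add: field_simps)
      qed
      then have "reducible \<omega> (\<lambda>t. hill_A + ((sqrt D)\<^sup>2 * (\<epsilon> / D)) *\<^sub>R hill_Q a t)" using G0(3) by blast
      then show "reducible \<omega> (\<lambda>t. hill_A + \<epsilon> *\<^sub>R hill_Q a t)" using D s by simp
    qed
  qed
  \<comment> \<open>The first bound admits every dyadic block to the iteration; the second makes
    \<open>\<epsilon>0 - (C + 1) * \<epsilon>0\<^sup>2\<close> nonnegative, as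
    \<open>cantor_subset\<close> asks.\<close>
  define \<epsilon>1 where "\<epsilon>1 = min (d0\<^sup>2) (1 / (C + 1))"
  have \<epsilon>1: "0 < \<epsilon>1" using d0 C by (simp add: \<epsilon>1_def)
  \<comment> \<open>\<open>C + 1\<close> in place of \<open>C\<close> gives the strict inequality
    that leaves room for passing to a Cantor subset.\<close>
  have E: "\<exists>E. cantor_set E \<and> E \<subseteq> {0<..<\<epsilon>0} \<and> \<epsilon>0 - (C + 1) * \<epsilon>0\<^sup>2 < measure lebesgue E \<and> 0 < measure lebesgue E \<and>
      (\<forall>\<epsilon>\<in>E. reducible \<omega> (\<lambda>t. hill_A + \<epsilon> *\<^sub>R hill_Q a t))"
    if \<epsilon>0: "0 < \<epsilon>0" "\<epsilon>0 < \<epsilon>1" for \<epsilon>0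
  proof -
    \<comment> \<open>The blocks \<open>{D j..2 * D j}\<close> cover
      \<open>{0<..<\<epsilon>0}\<close>, and their losses \<open>C * (D j)\<^sup>2\<close> sum to at
      most \<open>C * \<epsilon>0\<^sup>2\<close>, which is small relative to
      \<open>\<epsilon>0\<close>.\<close>
    define D where "D j = \<epsilon>0 / 2 ^ Suc j" for j
    have D: "0 < D j" "D j < d0\<^sup>2" for j
    proof -
      show "0 < D j" using \<epsilon>0 by (simp add: D_def)
      have "\<epsilon>0 / 2 ^ Suc j \<le> \<epsilon>0 / 1" using \<epsilon>0 by (intro divide_left_mono) (auto simp: one_le_power simp del: power_Suc)
      then show "D j < d0\<^sup>2" using \<epsilon>0 by (simp add: D_def \<epsilon>1_def)
    qed
    obtain G where Gm: "\<And>j. G j \<in> lmeasurable" "\<And>j. measure lebesgue (G j) \<le> C * (D j)\<^sup>2"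
      and Gr: "\<And>j \<epsilon>. \<epsilon> \<in> {D j..2 * D j} - G j \<Longrightarrow> reducible \<omega> (\<lambda>t. hill_A + \<epsilon> *\<^sub>R hill_Q a t)"
      using G2 [OF D] by metis
    have bound: "measure lebesgue (\<Union>j\<in>I. G j) \<le> C * \<epsilon>0\<^sup>2" if I: "finite I" for I
    proof -
      have "measure lebesgue (\<Union>j\<in>I. G j) \<le> (\<Sum>j\<in>I. measure lebesgue (G j))"
        by (intro measure_UNION_le I) (use Gm in auto)
      also have "\<dots> \<le> (\<Sum>j\<in>I. C * \<epsilon>0\<^sup>2 * (1 / 2) ^ Suc j)"
      proof (rule sum_mono)
        fix j
        have "(D j)\<^sup>2 = \<epsilon>0\<^sup>2 * ((1 / 2) ^ Suc j)\<^sup>2" by (simp add: D_def power_divide power_mult_distrib)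
        also have "\<dots> \<le> \<epsilon>0\<^sup>2 * (1 / 2) ^ Suc j"
        proof (intro mult_left_mono)
          have "(1 / 2 :: real) ^ Suc j \<le> 1" by (rule power_le_one) auto
          then show "((1 / 2 :: real) ^ Suc j)\<^sup>2 \<le> (1 / 2) ^ Suc j"
            unfolding power2_eq_square by (intro mult_left_le) auto
        qed auto
        finally have "C * (D j)\<^sup>2 \<le> C * (\<epsilon>0\<^sup>2 * (1 / 2) ^ Suc j)" using C by (rule mult_left_mono)
        then show "measure lebesgue (G j) \<le> C * \<epsilon>0\<^sup>2 * (1 / 2) ^ Suc j"
          using Gm(2) [of j] by (simp only: mult.assoc)
      qed
      also have "\<dots> = C * \<epsilon>0\<^sup>2 * (\<Sum>j\<in>I. (1 / 2) ^ Suc j)" by (simp only: sum_distrib_left)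
      also have "\<dots> \<le> C * \<epsilon>0\<^sup>2 * 1"
      proof (intro mult_left_mono)
        have "(\<Sum>j\<in>I. (1 / 2 :: real) ^ Suc j) \<le> (\<Sum>j. (1 / 2) ^ Suc j)"
          by (intro sum_le_suminf sums_summable [OF power_half_series] I) auto
        then show "(\<Sum>j\<in>I. (1 / 2 :: real) ^ Suc j) \<le> 1"
          using sums_unique [OF power_half_series] by simp
      qed (use C in auto)
      finally show ?thesis by simp
    qed
    have U: "(\<Union>j\<in>UNIV. G j) \<in> lmeasurable" "measure lebesgue (\<Union>j\<in>UNIV. G j) \<le> C * \<epsilon>0\<^sup>2"
      by (rule fmeasurable_UN_bound [OF _ _ bound] measure_UN_bound [OF _ _ bound]; use Gm in auto)+
    define A where "A = {0<..<\<epsilon>0} - (\<Union>j\<in>UNIV. G j)"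
    have i: "{0<..<\<epsilon>0} \<in> lmeasurable" "measure lebesgue {0<..<\<epsilon>0} = \<epsilon>0" using \<epsilon>0 by auto
    have A: "A \<in> lmeasurable" unfolding A_def using i U by (intro fmeasurable_Diff) auto
    have mA: "\<epsilon>0 - C * \<epsilon>0\<^sup>2 \<le> measure lebesgue A"
    proof -
      have "measure lebesgue {0<..<\<epsilon>0} \<le> measure lebesgue (A \<union> (\<Union>j\<in>UNIV. G j))"
        by (rule measure_mono_fmeasurable) (use i A U in \<open>auto simp: A_def intro!: fmeasurable.Un\<close>)
      also have "\<dots> \<le> measure lebesgue A + measure lebesgue (\<Union>j\<in>UNIV. G j)"
        by (rule measure_Un_le) (use A U in \<open>auto intro: fmeasurableD\<close>)
      finally show ?thesis using i U by linarith
    qed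
    have e2: "0 < \<epsilon>0\<^sup>2" using \<epsilon>0 by simp
    have "\<epsilon>0 < 1 / (C + 1)" using \<epsilon>0 by (simp add: \<epsilon>1_def)
    then have "(C + 1) * \<epsilon>0 < 1" using C by (simp add: field_simps)
    then have "(C + 1) * \<epsilon>0 * \<epsilon>0 < 1 * \<epsilon>0" using \<epsilon>0 by (intro mult_strict_right_mono) auto
    then have c: "0 \<le> \<epsilon>0 - (C + 1) * \<epsilon>0\<^sup>2" by (simp add: power2_eq_square mult.assoc)
    have "\<epsilon>0 - (C + 1) * \<epsilon>0\<^sup>2 < measure lebesgue A" using mA e2 unfolding distrib_right by linarith
    moreover have "bounded A" by (rule bounded_subset [of "{0<..<\<epsilon>0}"]) (auto simp: A_def)
    ultimately obtain E where E: "E \<subseteq> A" "cantor_set E" "\<epsilon>0 - (C + 1) * \<epsilon>0\<^sup>2 < measure lebesgue E"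
      using cantor_subset [OF A _ c] by blast
    have "reducible \<omega> (\<lambda>t. hill_A + \<epsilon> *\<^sub>R hill_Q a t)" if "\<epsilon> \<in> E" for \<epsilon>
    proof -
      have \<epsilon>: "0 < \<epsilon>" "\<epsilon> < \<epsilon>0" "\<And>j. \<epsilon> \<notin> G j" using that E(1) by (auto simp: A_def)
      obtain j where "\<epsilon>0 / 2 ^ Suc j \<le> \<epsilon>" "\<epsilon> \<le> 2 * (\<epsilon>0 / 2 ^ Suc j)" using dyadic_scale [OF \<epsilon>(1,2)] by blast
      then have "\<epsilon> \<in> {D j..2 * D j} - G j" using \<epsilon>(3) unfolding D_def by simp
      then show ?thesis by (rule Gr)
    qed
    moreover have "E \<subseteq> {0<..<\<epsilon>0}" using E(1) by (auto simp: A_def)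
    ultimately show ?thesis using E c by (intro exI [of _ E]) auto
  qed
  define P where "P \<epsilon>0 E \<longleftrightarrow> cantor_set E \<and> E \<subseteq> {0<..<\<epsilon>0} \<and> \<epsilon>0 - (C + 1) * \<epsilon>0\<^sup>2 < measure lebesgue E \<and> 0 < measure lebesgue E \<and>
      (\<forall>\<epsilon>\<in>E. reducible \<omega> (\<lambda>t. hill_A + \<epsilon> *\<^sub>R hill_Q a t))" for \<epsilon>0 E
  \<comment> \<open>The choice is made for each \<open>\<epsilon>0\<close> separately; sets for
    different \<open>\<epsilon>0\<close> need not be related.\<close>
  define EE where "EE \<epsilon>0 = (SOME E. P \<epsilon>0 E)" for \<epsilon>0
  have EE: "P \<epsilon>0 (EE \<epsilon>0)" if "0 < \<epsilon>0" "\<epsilon>0 < \<epsilon>1" for \<epsilon>0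
    unfolding EE_def by (rule someI_ex) (use E [OF that] in \<open>simp add: P_def\<close>)
  have ev: "\<forall>\<^sub>F \<epsilon>0 in at_right 0. 0 < \<epsilon>0 \<and> \<epsilon>0 < \<epsilon>1"
    using eventually_at_right_real [OF \<epsilon>1] by simp
  have "((\<lambda>\<epsilon>0. measure lebesgue (EE \<epsilon>0) / \<epsilon>0) \<longlongrightarrow> 1) (at_right 0)"
  proof (rule tendsto_sandwich)
    show "\<forall>\<^sub>F \<epsilon>0 in at_right 0. 1 - (C + 1) * \<epsilon>0 \<le> measure lebesgue (EE \<epsilon>0) / \<epsilon>0"
      using ev
    proof eventually_elim
      case (elim \<epsilon>0)
      have "(1 - (C + 1) * \<epsilon>0) * \<epsilon>0 \<le> measure lebesgue (EE \<epsilon>0)"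
        using EE [of \<epsilon>0] elim by (simp add: P_def left_diff_distrib power2_eq_square mult.assoc)
      then show ?case using elim by (simp add: pos_le_divide_eq)
    qed
    show "\<forall>\<^sub>F \<epsilon>0 in at_right 0. measure lebesgue (EE \<epsilon>0) / \<epsilon>0 \<le> 1"
      using ev
    proof eventually_elim
      case (elim \<epsilon>0)
      have sub: "EE \<epsilon>0 \<subseteq> {0<..<\<epsilon>0}" and "compact (EE \<epsilon>0)"
        using EE [of \<epsilon>0] elim by (auto simp: P_def cantor_set_def)
      then have "EE \<epsilon>0 \<in> lmeasurable" by (intro lmeasurable_compact)
      then have "measure lebesgue (EE \<epsilon>0) \<le> measure lebesgue {0<..<\<epsilon>0}"
        by (intro measure_mono_fmeasurable sub) (auto intro: fmeasurableD)
      then show ?case using elim by simp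
    qed
    have "((\<lambda>\<epsilon>0. 1 - (C + 1) * \<epsilon>0) \<longlongrightarrow> 1 - (C + 1) * 0) (at_right 0)" by (intro tendsto_intros)
    then show "((\<lambda>\<epsilon>0. 1 - (C + 1) * \<epsilon>0) \<longlongrightarrow> 1) (at_right 0)" by simp
  qed simp
  then show ?thesis
    using EE \<epsilon>1 by (intro exI [of _ EE] conjI exI [of _ \<epsilon>1]) (auto simp: P_def)
qed

end
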